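(* There exists a one-parameter group of transformations $\Phi_t : \mathcal{X}_0 \to \mathcal{X}_0$, $t\in \mathbb{R}$, such that $t \mapsto \Phi_t(x)$ is the unique global solution to the system of equations of motion $$\dot q_i (t) = p_i(t), \qquad \dot p_i(t) = F_i(x(t)), \qquad i \in \mathbb{Z}^d,$$ with initial condition $\Phi_0(x)=x$. Moreover $\Phi_t(x)_j = x_j(t) = (q_j(t),p_j(t))$ are differentiable functions with respect to $x_i = (q_i,p_i)$ for any $j,i\in\mathbb{Z}^d$ and $t\in\mathbb{R}$. Finally, there exists a constant $C_0$ such that $$Q(\Phi_t(x)) \leqslant C_0 \Big\{ Q(x) \log [e+Q(x)] + t^4 \Big\}.$$
   Context: At each site $i$ of the lattice $\mathbb{Z}^d$ there is an oscillator with coordinate $q_i\in\mathbb{R}$ and momentum $p_i\in\mathbb{R}$; a state is $x=\{x_i\}_{i\in\mathbb{Z}^d}=\{(q_i,p_i)\}_{i\in\mathbb{Z}^d}$, and $\mathcal{X}$ denotes the set of all such states with the product topology. The force on the $i$-th oscillator is $F_i(x) = - U'(q_i) - K \sum_{j:|j-i|=1} (q_i-q_j)$, with $K>0$ and $U$ a non negative polynomial of degree $4$ with strictly positive leading coefficient, where $|i-j|=\sum_{\ell=1}^d |i_\ell-j_\ell|$. For $\nu\in\mathbb{Z}^d$ and $k\in\mathbb{N}$, let $\Lambda_{\nu,k}$ be the cube of center $\nu$ and side $2k+1$ and $$W_{\nu,k}(x) = \sum_{i\in\Lambda_{\nu,k}} \Big\{ \tfrac{p_i^2}{2} + U(q_i)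 + 1 \Big\} + \sum_{i,j\in\Lambda_{\nu,k},\,|j-i|=1} \tfrac K4 (q_i-q_j)^2,$$ $$Q(x) = \sup_{\nu\in\mathbb{Z}^d} \,\sup_{k>\log^{1/d}(e+|\nu|)} \frac{W_{\nu,k}(x)}{(2k+1)^d},$$ and $\mathcal{X}_0 = \{ x\in \mathcal{X} : Q(x)<\infty\}$. *)

theory Defs
  imports "HOL-Analysis.Analysis" "HOL-Computational_Algebra.Polynomial"
begin

text \<open>Lattice sites: functions 'd \<Rightarrow> int with 'd a finite type, so d = CARD('d).
  A state assigns to each site a pair (q_i, p_i).\<close>

type_synonym 'd site = "'d \<Rightarrow> int"
type_synonym 'd state = "'d site \<Rightarrow> real \<times> real"

definition lnorm :: "('d::finite) site \<Rightarrow> int" where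
  "lnorm i = (\<Sum>l\<in>UNIV. \<bar>i l\<bar>)"

definition neighbours :: "('d::finite) site \<Rightarrow> 'd site set" where
  "neighbours i = {j. lnorm (j - i) = 1}"

definition force :: "real poly \<Rightarrow> real \<Rightarrow> ('d::finite) state \<Rightarrow> 'd site \<Rightarrow> real" where
  "force U K x i = - poly (pderiv U) (fst (x i))
     - K * (\<Sum>j\<in>neighbours i. fst (x i) - fst (x j))"

definition cube :: "('d::finite) site \<Rightarrow> nat \<Rightarrow> 'd site set" where
  "cube \<nu> k = {i. \<forall>l. \<bar>i l - \<nu> l\<bar> \<le> int k}"

definition W :: "real poly \<Rightarrow> real \<Rightarrow> ('d::finite) state \<Rightarrow> 'd site \<Rightarrow> nat \<Rightarrow> real" where
  "W U K x \<nu> k =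
     (\<Sum>i\<in>cube \<nu> k. (snd (x i))\<^sup>2 / 2 + poly U (fst (x i)) + 1)
     + (\<Sum>(i,j)\<in>{(i,j). i \<in> cube \<nu> k \<and> j \<in> cube \<nu> k \<and> lnorm (j - i) = 1}.
          K / 4 * (fst (x i) - fst (x j))\<^sup>2)"

definition Qfun :: "real poly \<Rightarrow> real \<Rightarrow> ('d::finite) state \<Rightarrow> ereal" where
  "Qfun U K x =
     (SUP (\<nu>,k)\<in>{(\<nu>::'d site, k::nat).
              real k > ln (exp 1 + real_of_int (lnorm \<nu>)) powr (1 / real CARD('d))}.
        ereal (W U K x \<nu> k / (2 * real k + 1) ^ CARD('d)))"

definition X0 :: "real poly \<Rightarrow> real \<Rightarrow> ('d::finite) state set" where
  "X0 U K = {x. Qfun U K x < \<infinity>}"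

definition is_solution :: "real poly \<Rightarrow> real \<Rightarrow> (real \<Rightarrow> ('d::finite) state) \<Rightarrow> bool" where
  "is_solution U K y \<longleftrightarrow>
     (\<forall>t i. ((\<lambda>s. fst (y s i)) has_real_derivative snd (y t i)) (at t)
          \<and> ((\<lambda>s. snd (y s i)) has_real_derivative force U K (y t) i) (at t))"

end

theory Submission
  imports Defs
begin

text \<open>Energy leaves the cube \<open>\<Lambda>\<^bsub>\<nu>,m\<^esub>\<close> only through bonds \<open>(i, j)\<close> crossing its boundary, at rate at most
  \<open>K |p\<^sub>i| |q\<^sub>i - q\<^sub>j|\<close>, and each bond crosses the boundary of at most one of the cubes
  \<open>k \<le> m < 2k\<close>. Averaging the energies over these \<open>m\<close> and using \<open>|p| \<lesssim> W\<^sup>1\<^sup>/\<^sup>2\<close>, \<open>|q| \<lesssim> W\<^sup>1\<^sup>/\<^sup>4\<close> gives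
  \<open>M \<le> C Q(x) + C |t| M\<^sup>3\<^sup>/\<^sup>4\<close> for the supremum \<open>M\<close> of \<open>Q\<close> over a time interval, hence
  \<open>Q(x(t)) \<le> C (Q(x) + t\<^sup>4)\<close> as soon as \<open>M < \<infinity>\<close>. The bound also holds for the dynamics in a finite
  cube with all other particles frozen. Finite \<open>Q\<close> makes the force near site \<open>j\<close> Lipschitz with constant
  \<open>O(log (e + |j|)) = o(|j|)\<close>, so that a Gronwall argument with weights \<open>exp (- (\<alpha> + \<beta> t) |j|)\<close> yields
  convergence of the finite-volume dynamics, uniqueness, and differentiability.\<close>

subsection \<open>The lattice\<close>

text \<open>The recurring obstacle is the proviso M < \<infinity>: the a priori inequality says
  nothing about an infinite supremum. Finiteness is secured in three different ways. With finitely
  many moving particles the flux through all cubes is bounded at once on compact time intervals, by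
  a bound that depends on the volume but is used only qualitatively. In the limit of growing cubes
  the good bound survives, because it is a family of closed conditions, each on finitely many
  coordinates. For an arbitrary solution in \<open>X0\<close>, whose \<open>Q\<close> is known to be
  finite only at each single time, a category argument is required; this is what uniqueness in the
  full class costs. The power t^4 comes from absorption: if the term with M^(3/4) dominates, then
  M^(1/4) is at most a multiple of |t|. The bound obtained, C (Q + t^4), implies the stated one
  because the summand 1 per site in \<open>W\<close> makes Q at least 1 and log (e + Q) is at least
  1.\<close>

definition lw :: "('d::finite) site \<Rightarrow> real" where
  "lw j = ln (exp 1 + real_of_int (lnorm j))"

lemma lnorm_nonneg: "0 \<le> lnorm i"
  by (simp add: lnorm_def sum_nonneg)

lemma lnorm_triangle: "lnorm i \<le> lnorm j + lnorm (i - j)"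
  unfolding lnorm_def sum.distrib[symmetric] by (rule sum_mono) auto

lemma lnorm_diff_commute: "lnorm (i - j) = lnorm (j - i)"
  unfolding lnorm_def by (rule sum.cong) auto

lemma coord_le_lnorm: "\<bar>i l\<bar> \<le> lnorm i"
  unfolding lnorm_def by (rule member_le_sum) auto

lemma neighbours_sym: "j \<in> neighbours i \<longleftrightarrow> i \<in> neighbours j"
  by (simp add: neighbours_def lnorm_diff_commute[of i j])

lemma coord_neighbour:
  assumes "j \<in> neighbours i"
  shows "\<bar>j l - i l\<bar> \<le> 1"
  using coord_le_lnorm[of "j - i" l] assms by (simp add: neighbours_def)

lemma lnorm_neighbour: "k \<in> neighbours j \<Longrightarrow> lnorm k \<le> lnorm j + 1"
  using lnorm_triangle[of k j] by (simp add: neighbours_def)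

lemma cube_eq_PiE: "cube \<nu> k = (\<Pi>\<^sub>E l\<in>UNIV. {\<nu> l - int k..\<nu> l + int k})"
proof -
  have "\<bar>a - b\<bar> \<le> int k \<longleftrightarrow> a \<in> {b - int k..b + int k}" for a b by auto
  then show ?thesis by (simp add: cube_def PiE_UNIV_domain Pi_def)
qed

lemma finite_cube [simp]: "finite (cube \<nu> k)"
  unfolding cube_eq_PiE by (rule finite_PiE) auto

lemma card_cube: "card (cube (\<nu> :: ('d::finite) site) k) = (2 * k + 1) ^ CARD('d)"
  by (simp add: cube_eq_PiE card_PiE nat_add_distrib nat_mult_distrib)

lemma neighbours_subset_cube: "neighbours i \<subseteq> cube i 1"
  using coord_neighbour by (auto simp: cube_def)

lemma finite_neighbours [simp]: "finite (neighbours i)"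
  using neighbours_subset_cube finite_cube finite_subset by blast

text \<open>The enclosing cube of side 3 replaces the exact count 2d; the difference only changes
  constants.\<close>

lemma card_neighbours_le: "card (neighbours (i :: ('d::finite) site)) \<le> 3 ^ CARD('d)"
  using card_mono[OF finite_cube neighbours_subset_cube, of i] by (simp add: card_cube)

lemma cube_neighbour_Suc:
  assumes "i \<in> cube \<nu> m" "j \<in> neighbours i"
  shows "j \<in> cube \<nu> (Suc m)"
  unfolding cube_def mem_Collect_eq
proof
  fix l
  show "\<bar>j l - \<nu> l\<bar> \<le> int (Suc m)"
    using coord_neighbour[OF assms(2), of l] assms(1)[unfolded cube_def] 
    by (auto dest: spec[of _ l])
qed

lemma cube_mono: "m \<le> n \<Longrightarrow> cube \<nu> m \<subseteq> cube \<nu> n"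
  unfolding cube_def by (auto intro: order_trans)

lemma center_in_cube [simp]: "\<nu> \<in> cube \<nu> k"
  by (simp add: cube_def)

lemma lnorm_gt_if_notin_cube:
  assumes "j \<notin> cube (\<lambda>_. 0) n"
  shows "real n < real_of_int (lnorm j)"
proof -
  obtain l where "int n < \<bar>j l\<bar>" using assms by (auto simp: cube_def not_le)
  then have "int n < lnorm j" using coord_le_lnorm[of j l] by linarith
  then show ?thesis by linarith
qed

lemma in_cube_lnorm: "j \<in> cube (\<lambda>_. 0) (nat (lnorm j))"
  using coord_le_lnorm[of j] by (auto simp: cube_def lnorm_nonneg)

section \<open>Growth of the logarithmic weight\<close>

lemma lw_ge_1: "1 \<le> lw j"
proof -
  have "ln (exp 1) \<le> lw j" unfolding lw_def
    using lnorm_nonneg[of j] by (subst ln_le_cancel_iff) (auto simp: add_pos_nonneg)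
  then show ?thesis by simp
qed

text \<open>With a = e + |j| \<ge> 2, the argument of the logarithm at a neighbour is at most a + 1
  \<le> a^2, and the logarithm turns the square into a factor 2.\<close>

lemma lw_neighbour:
  assumes "k \<in> neighbours j"
  shows "lw k \<le> 2 * lw j"
proof -
  have e: "exp 1 \<ge> (2::real)" using exp_ge_add_one_self[of 1] by simp
  let ?a = "exp 1 + real_of_int (lnorm j)"
  have a: "?a \<ge> 2" using e lnorm_nonneg[of j] by (smt (verit) of_int_nonneg)
  have "exp 1 + real_of_int (lnorm k) \<le> ?a + 1"
    using lnorm_neighbour[OF assms] by linarith
  also have "\<dots> \<le> 2 * ?a" using a by simp
  also have "\<dots> \<le> ?a * ?a" using a by (intro mult_right_mono) auto
  finally have "exp 1 + real_of_int (lnorm k) \<le> ?a * ?a" .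
  moreover have "0 < exp 1 + real_of_int (lnorm k)"
    using lnorm_nonneg[of k] by (simp add: add_pos_nonneg)
  ultimately have "lw k \<le> ln (?a * ?a)" unfolding lw_def using a 
    by (smt (verit) ln_le_cancel_iff)
  also have "\<dots> = 2 * lw j" unfolding lw_def using a by (subst ln_mult) auto
  finally show ?thesis .
qed

text \<open>The slope can be as small as desired, at the price of a shift M: apply ln (\<eta> a)
  \<le> \<eta> a - 1 with a = e + |j| and let M absorb - ln \<eta>. Lipschitz constants proportional
  to \<open>lw\<close> are therefore beaten by exponential weights on time intervals of any
  length.\<close>

lemma lw_sublinear:
  assumes "\<eta> > 0"
  obtains M where "M \<ge> 0" "\<And>j :: ('d::finite) site. lw j \<le> \<eta> * (real_of_int (lnorm j) + M)"
proof
  define M where "M = (exp 1 + \<bar>ln \<eta>\<bar> / \<eta>)"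
  show "M \<ge> 0" using assms by (simp add: M_def add_nonneg_nonneg)
  show "lw j \<le> \<eta> * (real_of_int (lnorm j) + M)" for j
  proof -
    let ?a = "exp 1 + real_of_int (lnorm j)"
    have a: "?a > 0" using lnorm_nonneg[of j] by (simp add: add_pos_nonneg)
    have "ln (\<eta> * ?a) \<le> \<eta> * ?a - 1" using assms a by (intro ln_le_minus_one) simp
    then have "ln ?a \<le> \<eta> * ?a + \<bar>ln \<eta>\<bar>" using a assms by (simp add: ln_mult)
    also have "\<dots> = \<eta> * (real_of_int (lnorm j) + M)" using assms by (simp add: M_def field_simps)
    finally show ?thesis by (simp add: lw_def)
  qed
qed

lemma lw_le_exp:
  assumes "\<alpha> > 0"
  obtains C where "C > 0" "\<And>j :: ('d::finite) site. lw j \<le> C * exp (\<alpha> * real_of_int (lnorm j))"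
proof -
  obtain M where M: "M \<ge> 0" "\<And>j :: ('d::finite) site. lw j \<le> \<alpha> * (real_of_int (lnorm j) + M)"
    using lw_sublinear[OF assms] by auto
  show thesis
  proof
    show "exp (\<alpha> * M) > 0" by simp
    fix j :: "'d site"
    have "lw j \<le> exp (\<alpha> * (real_of_int (lnorm j) + M))"
      using M(2)[of j] exp_ge_add_one_self[of "\<alpha> * (real_of_int (lnorm j) + M)"] by linarith
    then show "lw j \<le> exp (\<alpha> * M) * exp (\<alpha> * real_of_int (lnorm j))"
      by (simp add: exp_add[symmetric] algebra_simps)
  qed
qed

lemma lw_sq_le_exp:
  assumes "\<alpha> > 0"
  obtains C where "C > 0" "\<And>j :: ('d::finite) site. (lw j)\<^sup>2 \<le> C * exp (\<alpha> * real_of_int (lnorm j))"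
proof -
  obtain C where C: "C > 0" "\<And>j :: ('d::finite) site. lw j \<le> C * exp (\<alpha>/2 * real_of_int (lnorm j))"
    using lw_le_exp[of "\<alpha>/2"] assms by auto
  show thesis
  proof
    show "C\<^sup>2 > 0" using C by simp
    fix j :: "'d site"
    have "(lw j)\<^sup>2 \<le> (C * exp (\<alpha>/2 * real_of_int (lnorm j)))\<^sup>2"
      using C(2)[of j] lw_ge_1[of j] by (intro power_mono) auto
    also have "\<dots> = C\<^sup>2 * exp (\<alpha> * real_of_int (lnorm j))"
      by (simp add: power_mult_distrib exp_of_nat_mult[symmetric] exp_double[symmetric])
    finally show "(lw j)\<^sup>2 \<le> C\<^sup>2 * exp (\<alpha> * real_of_int (lnorm j))" .
  qed
qed

subsection \<open>Ordinary differential equations on infinite products\<close>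

text \<open>The weights \<open>exp ((\<alpha> + \<alpha> t / T) (|j| + M))\<close> grow in time fast enough to absorb the Lipschitz
  constants \<open>\<Lambda> log (e + |j|)\<close>; the supremum \<open>v\<close> of the weighted norms then satisfies \<open>v \<le> v / 2 + V\<close>.\<close>

lemma weighted_gronwall_forward:
  fixes u u' :: "real \<Rightarrow> ('d::finite) site \<Rightarrow> 'b::real_normed_vector"
  assumes T: "T > 0" and al: "\<alpha> > 0" and Lam: "\<Lambda> \<ge> 0" and M: "M \<ge> 0"
    and lw: "\<And>j::'d site. 2 * T * exp (2*\<alpha>) * \<Lambda> * lw j \<le> \<alpha> * (real_of_int (lnorm j) + M)"
    and du: "\<And>j t. t \<in> {0..T} \<Longrightarrow> ((\<lambda>s. u s j) has_vector_derivative u' t j) (at t)"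
    and u': "\<And>j t m. t \<in> {0..T} \<Longrightarrow> (\<And>k. k \<in> insert j (neighbours j) \<Longrightarrow> norm (u t k) \<le> m)
               \<Longrightarrow> norm (u' t j) \<le> \<Lambda> * lw j * m + S j"
    and u0: "\<And>j. norm (u 0 j) \<le> a j"
    and S: "\<And>j. 0 \<le> S j"
    and V: "\<And>j. a j + T * S j \<le> V * exp (\<alpha> * real_of_int (lnorm j))"
    and B: "\<And>j t. t \<in> {0..T} \<Longrightarrow> norm (u t j) \<le> B * exp (\<alpha> * real_of_int (lnorm j))"
    and t: "t \<in> {0..T}"
  shows "norm (u t j) \<le> 2 * exp (2 * \<alpha> * M) * V * exp (2 * \<alpha> * real_of_int (lnorm j))"
proof -
  define r where "r j = real_of_int (lnorm j)" for j :: "'d site"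
  have r0: "0 \<le> r j" for j by (simp add: r_def lnorm_nonneg)
  define E where "E j s = exp ((\<alpha> + \<alpha> * s / T) * (r j + M))" for j s
  have E_pos: "E j s > 0" for j s by (simp add: E_def)
  have E_ge: "exp (\<alpha> * r j) \<le> E j s" if "s \<in> {0..T}" for j s
  proof -
    have "\<alpha> * r j \<le> (\<alpha> + \<alpha> * s / T) * (r j + M)"
      using that T al M r0[of j] by (intro mult_mono) auto
    then show ?thesis by (simp add: E_def)
  qed
  have V0: "V \<ge> 0"
  proof -
    have "0 \<le> a j + T * S j" using u0[of j] S[of j] T norm_ge_zero[of "u 0 j"]
      by (meson add_nonneg_nonneg mult_nonneg_nonneg order_less_imp_le order_trans)
    then have "0 \<le> V * exp (\<alpha> * real_of_int (lnorm j))" using V[of j] by linarith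
    then show ?thesis by (simp add: zero_le_mult_iff)
  qed
  have B0: "B \<ge> 0"
  proof -
    have "0 \<le> B * exp (\<alpha> * real_of_int (lnorm j))" using B[OF t, of j] norm_ge_zero order_trans by blast
    then show ?thesis by (simp add: zero_le_mult_iff)
  qed
  define X where "X = {0..T} \<times> (UNIV :: 'd site set)"
  define v where "v = (SUP (s, j)\<in>X. norm (u s j) / E j s)"
  \<comment> \<open>The a priori bound \<open>B\<close> makes the supremum finite; its value does
    not enter the conclusion.\<close>
  have bdd: "bdd_above ((\<lambda>(s, j). norm (u s j) / E j s) ` X)"
  proof (rule bdd_aboveI2[where M = B])
    fix z assume "z \<in> X"
    then obtain s j where z: "z = (s, j)" "s \<in> {0..T}" by (auto simp: X_def)
    have "norm (u s j) \<le> B * E j s"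
      using B[OF z(2), of j] mult_left_mono[OF E_ge[OF z(2), of j] B0] by (simp add: r_def)
    then show "(case z of (s, j) \<Rightarrow> norm (u s j) / E j s) \<le> B"
      by (simp add: z pos_divide_le_eq E_pos)
  qed
  have uv: "norm (u s j) \<le> v * E j s" if "s \<in> {0..T}" for s j
  proof -
    have "norm (u s j) / E j s \<le> v" unfolding v_def
      using cSUP_upper[OF _ bdd, of "(s, j)"] that by (simp add: X_def)
    then show ?thesis by (simp add: pos_divide_le_eq E_pos)
  qed
  have v0: "0 \<le> v"
    using uv[OF t, of j] E_pos[of j t] norm_ge_zero[of "u t j"] 
    by (meson dual_order.trans zero_le_mult_iff not_less)
  have step: "norm (u s j) \<le> (v / 2 + V) * E j s" if s: "s \<in> {0..T}" for s j
  proof (cases "s = 0")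
    case True
    have "a j \<le> a j + T * S j" using S[of j] T by simp
    then have "norm (u s j) \<le> V * exp (\<alpha> * r j)"
      using u0[of j] V[of j] True by (simp add: r_def)
    also have "\<dots> \<le> V * E j s" using E_ge[OF s, of j] V0 by (intro mult_left_mono)
    also have "\<dots> \<le> (v / 2 + V) * E j s" using v0 E_pos[of j s] by (intro mult_right_mono) auto
    finally show ?thesis .
  next
    case False
    then have s0: "0 < s" using s by simp
    \<comment> \<open>The time derivative of \<open>E\<close> brings down the factor \<alpha> / T
      (|j| + M), which by assumption dominates 2 exp (2 \<alpha>) \<Lambda> \<open>lw j\<close>. The
      spare factor 2 is the reason why v / 2 suffices in \<phi>.\<close>
    define \<phi> where "\<phi> \<tau> = v / 2 * E j \<tau> + S j * \<tau>" for \<tau>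
    define \<phi>' where "\<phi>' \<tau> = v / 2 * (E j \<tau> * (\<alpha> / T * (r j + M))) + S j" for \<tau>
    have d\<phi>: "(\<phi> has_vector_derivative \<phi>' \<tau>) (at \<tau>)" for \<tau>
      unfolding \<phi>_def \<phi>'_def E_def has_real_derivative_iff_has_vector_derivative[symmetric]
      using T by (auto intro!: derivative_eq_intros)
    have bound: "norm (u' \<tau> j) \<le> \<phi>' \<tau>" if "0 < \<tau>" "\<tau> < s" for \<tau>
    proof -
      have tau: "\<tau> \<in> {0..T}" using that s by auto
      \<comment> \<open>The exponent has slope at most 2 \<alpha> in |j|, so passing to a neighbour
        costs a factor exp (2 \<alpha>).\<close>
      have "norm (u \<tau> k) \<le> v * (exp (2 * \<alpha>) * E j \<tau>)" if k: "k \<in> insert j (neighbours j)" for k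
      proof -
        have rk: "r k \<le> r j + 1" using k lnorm_neighbour[of k j] by (auto simp: r_def) 
        have ab: "\<alpha> + \<alpha> * \<tau> / T \<le> 2 * \<alpha>" "0 \<le> \<alpha> + \<alpha> * \<tau> / T"
          using tau T al by (auto simp: field_simps)
        have "(\<alpha> + \<alpha> * \<tau> / T) * (r k + M) \<le> (\<alpha> + \<alpha> * \<tau> / T) * (r j + M) + (\<alpha> + \<alpha> * \<tau> / T)"
          using mult_left_mono[OF rk ab(2)] by (simp add: ring_distribs)
        then have "E k \<tau> \<le> exp (2 * \<alpha>) * E j \<tau>"
          unfolding E_def exp_add[symmetric] exp_le_cancel_iff using ab by linarith
        then show ?thesis using uv[OF tau, of k] v0 by (meson mult_left_mono order_trans)
      qed
      from u'[OF tau this] have "norm (u' \<tau> j) \<le> \<Lambda> * lw j * (v * (exp (2 * \<alpha>) * E j \<tau>)) + S j" .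
      also have "\<Lambda> * lw j * (v * (exp (2 * \<alpha>) * E j \<tau>)) 
          = (2 * T * exp (2*\<alpha>) * \<Lambda> * lw j) * (v * E j \<tau> / (2 * T))"
        using T by (simp add: field_simps)
      also have "\<dots> \<le> (\<alpha> * (r j + M)) * (v * E j \<tau> / (2 * T))"
        using lw[of j] v0 E_pos[of j \<tau>] T by (intro mult_right_mono) (auto simp: r_def)
      finally show ?thesis by (simp add: \<phi>'_def field_simps)
    qed
    have "norm (u s j - u 0 j) \<le> \<phi> s - \<phi> 0"
    proof (rule differentiable_bound_general[OF s0])
      show "continuous_on {0..s} (\<lambda>s. u s j)"
        using s by (intro continuous_at_imp_continuous_on ballI has_vector_derivative_continuous[OF du]) auto
      show "continuous_on {0..s} \<phi>"
        using d\<phi> by (intro continuous_at_imp_continuous_on ballI has_vector_derivative_continuous) auto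
    qed (use s du d\<phi> bound in auto)
    moreover have "\<phi> 0 \<ge> 0" using v0 E_pos[of j 0] by (simp add: \<phi>_def)
    moreover have "norm (u s j) \<le> norm (u 0 j) + norm (u s j - u 0 j)"
      using norm_triangle_ineq[of "u 0 j" "u s j - u 0 j"] by simp
    moreover have "S j * s \<le> T * S j" using s S[of j] by (simp add: mult.commute[of "S j"] mult_right_mono)
    ultimately have "norm (u s j) \<le> V * exp (\<alpha> * r j) + v / 2 * E j s"
      using u0[of j] V[of j] by (simp add: \<phi>_def r_def)
    also have "V * exp (\<alpha> * r j) \<le> V * E j s" using E_ge[OF s, of j] V0 by (intro mult_left_mono)
    finally show ?thesis by (simp add: algebra_simps)
  qed
  have "v \<le> v / 2 + V" unfolding v_def
  proof (rule cSUP_least, goal_cases)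
    case 1 then show ?case using T by (auto simp: X_def)
  next
    case (2 z)
    then obtain s j where "z = (s, j)" "s \<in> {0..T}" by (auto simp: X_def)
    then show ?case using step[of s j] unfolding v_def by (simp add: pos_divide_le_eq E_pos)
  qed
  then have "v \<le> 2 * V" by simp
  have "norm (u t j) \<le> v * E j t" by (rule uv[OF t])
  also have "\<dots> \<le> (2 * V) * exp (2 * \<alpha> * (r j + M))"
  proof (rule mult_mono)
    have "\<alpha> * t / T \<le> \<alpha>" using t T al by (auto simp: field_simps)
    then show "E j t \<le> exp (2 * \<alpha> * (r j + M))"
      unfolding E_def exp_le_cancel_iff using r0[of j] M by (intro mult_right_mono) auto
  qed (use \<open>v \<le> 2 * V\<close> V0 E_pos[of j t] in auto)
  finally show ?thesis by (simp add: r_def exp_add[symmetric] algebra_simps)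
qed

text \<open>Everything that must not influence the Gronwall constant is hidden behind the
  existential quantifier, in particular the a priori bound \<open>B\<close>. The joint size of the
  initial values \<open>a\<close> and the sources \<open>S\<close> is kept visible as V, in which
  the final estimate is linear.\<close>

definition subsolution :: "real \<Rightarrow> real \<Rightarrow> real \<Rightarrow> real \<Rightarrow> (real \<Rightarrow> ('d::finite) site \<Rightarrow> 'b::real_normed_vector) \<Rightarrow> bool" where
  "subsolution \<Lambda> T \<alpha> V u \<longleftrightarrow> (\<exists>u' S a B.
     (\<forall>j t. \<bar>t\<bar> \<le> T \<longrightarrow> ((\<lambda>s. u s j) has_vector_derivative u' t j) (at t)) \<and>
     (\<forall>j t m. \<bar>t\<bar> \<le> T \<longrightarrow> (\<forall>k\<in>insert j (neighbours j). norm (u t k) \<le> m) \<longrightarrow>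
        norm (u' t j) \<le> \<Lambda> * lw j * m + S j) \<and>
     (\<forall>j. norm (u 0 j) \<le> a j \<and> 0 \<le> S j \<and> a j + T * S j \<le> V * exp (\<alpha> * real_of_int (lnorm j))) \<and>
     (\<forall>j t. \<bar>t\<bar> \<le> T \<longrightarrow> norm (u t j) \<le> B * exp (\<alpha> * real_of_int (lnorm j))))"

lemma subsolutionI:
  assumes "\<And>j t. \<bar>t\<bar> \<le> T \<Longrightarrow> ((\<lambda>s. u s j) has_vector_derivative u' t j) (at t)"
    and "\<And>j t m. \<bar>t\<bar> \<le> T \<Longrightarrow> (\<And>k. k \<in> insert j (neighbours j) \<Longrightarrow> norm (u t k) \<le> m)
               \<Longrightarrow> norm (u' t j) \<le> \<Lambda> * lw j * m + S j"
    and "\<And>j. norm (u 0 j) \<le> a j" and "\<And>j. 0 \<le> S j"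
    and "\<And>j. a j + T * S j \<le> V * exp (\<alpha> * real_of_int (lnorm j))"
    and "\<And>j t. \<bar>t\<bar> \<le> T \<Longrightarrow> norm (u t j) \<le> B * exp (\<alpha> * real_of_int (lnorm j))"
  shows "subsolution \<Lambda> T \<alpha> V u"
  unfolding subsolution_def
proof (intro exI conjI allI impI)
  show "norm (u' t j) \<le> \<Lambda> * lw j * m + S j" 
    if "\<bar>t\<bar> \<le> T" "\<forall>k\<in>insert j (neighbours j). norm (u t k) \<le> m" for j t m
    using assms(2)[OF that(1)] that(2) by blast
qed (fact assms)+

lemma weighted_gronwall:
  fixes \<alpha> \<Lambda> T :: real
  assumes T: "T > 0" and al: "\<alpha> > 0" and Lam: "\<Lambda> \<ge> 0"
  obtains C where "C > 0"
    "\<And>(u :: real \<Rightarrow> ('d::finite) site \<Rightarrow> 'b::real_normed_vector) V t j.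
      subsolution \<Lambda> T \<alpha> V u \<Longrightarrow> \<bar>t\<bar> \<le> T \<Longrightarrow> norm (u t j) \<le> C * V * exp (2 * \<alpha> * real_of_int (lnorm j))"
proof -
  \<comment> \<open>Solved for the hypothesis of the forward lemma: this slope gives 2 T exp (2
    \<alpha>) (\<Lambda> + 1) \<open>lw j\<close> \<le> \<alpha> (|j| + M). The summand 1 keeps the
    denominator positive when \<Lambda> = 0.\<close>
  define \<eta> where "\<eta> = \<alpha> / (2 * T * exp (2*\<alpha>) * (\<Lambda> + 1))"
  have eta: "\<eta> > 0" using assms by (simp add: \<eta>_def)
  obtain M where M: "M \<ge> 0" "\<And>j::'d site. lw j \<le> \<eta> * (real_of_int (lnorm j) + M)"
    using lw_sublinear[OF eta] by auto
  have lw: "2 * T * exp (2*\<alpha>) * \<Lambda> * lw j \<le> \<alpha> * (real_of_int (lnorm j) + M)" for j :: "'d site"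
  proof -
    have "2 * T * exp (2*\<alpha>) * \<Lambda> * lw j \<le> 2 * T * exp (2*\<alpha>) * (\<Lambda> + 1) * lw j"
      using T Lam lw_ge_1[of j] by (intro mult_right_mono) auto
    also have "\<dots> \<le> 2 * T * exp (2*\<alpha>) * (\<Lambda> + 1) * (\<eta> * (real_of_int (lnorm j) + M))"
      using T Lam M(2)[of j] by (intro mult_left_mono) auto
    also have "\<dots> = \<alpha> * (real_of_int (lnorm j) + M)"
      using T Lam by (simp add: \<eta>_def)
    finally show ?thesis .
  qed
  show thesis
  proof (rule that[of "2 * exp (2 * \<alpha> * M)"])
    fix u :: "real \<Rightarrow> 'd site \<Rightarrow> 'b" and V t j
    assume "subsolution \<Lambda> T \<alpha> V u" and t: "\<bar>t\<bar> \<le> T"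
    then obtain u' S a B where du: "\<And>j t. \<bar>t\<bar> \<le> T \<Longrightarrow> ((\<lambda>s. u s j) has_vector_derivative u' t j) (at t)"
      and u': "\<And>j t m. \<bar>t\<bar> \<le> T \<Longrightarrow> (\<And>k. k \<in> insert j (neighbours j) \<Longrightarrow> norm (u t k) \<le> m)
               \<Longrightarrow> norm (u' t j) \<le> \<Lambda> * lw j * m + S j"
      and u0: "\<And>j. norm (u 0 j) \<le> a j" and S: "\<And>j. 0 \<le> S j"
      and V: "\<And>j. a j + T * S j \<le> V * exp (\<alpha> * real_of_int (lnorm j))"
      and B: "\<And>j t. \<bar>t\<bar> \<le> T \<Longrightarrow> norm (u t j) \<le> B * exp (\<alpha> * real_of_int (lnorm j))"
      unfolding subsolution_def by metis
    show "norm (u t j) \<le> 2 * exp (2 * \<alpha> * M) * V * exp (2 * \<alpha> * real_of_int (lnorm j))"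
    proof (cases "t \<ge> 0")
      case True
      show ?thesis
        by (rule weighted_gronwall_forward[OF T al Lam M(1) lw, where u = u and u' = u' and S = S and a = a and B = B])
           (use du u' u0 S V B t True in auto)
    next
      case False
      have du2: "((\<lambda>s. u (- s) j) has_vector_derivative - u' (- t) j) (at t)" if "t \<in> {0..T}" for t j
      proof -
        have "((\<lambda>s. u s j) \<circ> uminus has_vector_derivative (-1) *\<^sub>R u' (- t) j) (at t)"
          using that by (intro vector_diff_chain_at du derivative_eq_intros) (auto intro!: derivative_eq_intros)
        then show ?thesis by (simp add: o_def)
      qed
      have "norm (u (- (- t)) j) \<le> 2 * exp (2 * \<alpha> * M) * V * exp (2 * \<alpha> * real_of_int (lnorm j))"
        by (rule weighted_gronwall_forward[OF T al Lam M(1) lw, where u = "\<lambda>t. u (- t)" 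
              and u' = "\<lambda>t j. - u' (- t) j" and S = S and a = a and B = B])
           (use du2 u' u0 S V B t False in auto)
      then show ?thesis by simp
    qed
  qed simp
qed

section \<open>Limits of curves and Picard iteration\<close>

lemma has_vector_derivative_limit:
  fixes f :: "nat \<Rightarrow> real \<Rightarrow> 'b::banach"
  assumes der: "\<And>n t. (f n has_vector_derivative f' n t) (at t)"
    and lim: "\<And>t. (\<lambda>n. f n t) \<longlonglongrightarrow> g t"
    and unif: "\<And>T. uniform_limit {-T..T} f' g' sequentially"
  shows "(g has_vector_derivative g' t) (at t)"
proof -
  define T where "T = \<bar>t\<bar> + 1"
  \<comment> \<open>The interval is convex, as termwise differentiation requires, and open, so that
    the derivative within it is the derivative at t.\<close>
  let ?S = "{-T<..<T}"
  have t: "t \<in> ?S" by (auto simp: T_def)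
  have "\<exists>h. \<forall>x\<in>?S. (\<lambda>n. f n x) \<longlonglongrightarrow> h x \<and> (h has_derivative (\<lambda>y. y *\<^sub>R g' x)) (at x within ?S)"
  proof (rule has_derivative_sequence[where f' = "\<lambda>n x y. y *\<^sub>R f' n x"])
    show "(f n has_derivative (\<lambda>y. y *\<^sub>R f' n x)) (at x within ?S)" for n x
      using der[of n x] unfolding has_vector_derivative_def by (rule has_derivative_at_withinI)
    show "\<forall>\<^sub>F n in sequentially. \<forall>x\<in>?S. \<forall>h. norm (h *\<^sub>R f' n x - h *\<^sub>R g' x) \<le> e * norm h"
      if "e > 0" for e
    proof -
      have "\<forall>\<^sub>F n in sequentially. \<forall>x\<in>{-T..T}. dist (f' n x) (g' x) < e"
        using unif[of T] that by (simp add: uniform_limit_iff)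
      then show ?thesis
      proof (rule eventually_mono, intro ballI allI)
        fix n x h assume "\<forall>x\<in>{-T..T}. dist (f' n x) (g' x) < e" "x \<in> ?S"
        then have "norm (f' n x - g' x) \<le> e" by (auto simp: dist_norm intro: less_imp_le)
        then show "norm (h *\<^sub>R f' n x - h *\<^sub>R g' x) \<le> e * norm h"
          by (simp add: scaleR_right_diff_distrib[symmetric] mult.commute[of e] mult_left_mono)
      qed
    qed
    show "(\<lambda>n. f n t) \<longlonglongrightarrow> g t" by (rule lim)
  qed (use t in auto)
  then obtain h where h: "\<forall>x\<in>?S. (\<lambda>n. f n x) \<longlonglongrightarrow> h x \<and> (h has_derivative (\<lambda>y. y *\<^sub>R g' x)) (at x within ?S)"
    by blast
  have eq: "h x = g x" if "x \<in> ?S" for x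
    using h that lim LIMSEQ_unique by blast
  have "(g has_derivative (\<lambda>y. y *\<^sub>R g' t)) (at t within ?S)"
    using h t eq by (auto intro: has_derivative_transform[where f = h])
  moreover have "at t within ?S = at t" using t by (intro at_within_open) auto
  ultimately show ?thesis by (simp add: has_vector_derivative_def)
qed

lemma antiderivative_exists:
  fixes g :: "real \<Rightarrow> 'b::banach"
  assumes "continuous_on UNIV g"
  shows "\<exists>G. G 0 = 0 \<and> (\<forall>t. (G has_vector_derivative g t) (at t))"
proof -
  define G where "G t = (if t \<ge> 0 then integral {0..t} g else - integral {t..0} g)" for t
  \<comment> \<open>A fixed lower end -T removes the case distinction, so that the fundamental
    theorem applies at 0 as well.\<close>
  have G_eq: "G t = integral {-T..t} g - integral {-T..0} g" if "\<bar>t\<bar> \<le> T" for t T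
  proof -
    have int: "g integrable_on {a..b}" for a b
      using assms continuous_on_subset by (blast intro: integrable_continuous_real)
    show ?thesis
    proof (cases "t \<ge> 0")
      case True
      then show ?thesis using Henstock_Kurzweil_Integration.integral_combine[of "-T" 0 t g] int that
        by (auto simp: G_def algebra_simps)
    next
      case False
      then show ?thesis using Henstock_Kurzweil_Integration.integral_combine[of "-T" t 0 g] int that
        by (auto simp: G_def algebra_simps)
    qed
  qed
  have "(G has_vector_derivative g t) (at t)" for t
  proof -
    define T where "T = \<bar>t\<bar> + 1"
    have "((\<lambda>s. integral {-T..s} g) has_vector_derivative g t) (at t within {-T..T})"
      using assms by (intro integral_has_vector_derivative) (auto simp: T_def intro: continuous_on_subset)
    then have "((\<lambda>s. integral {-T..s} g - integral {-T..0} g) has_vector_derivative g t) (at t within {-T..T})"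
      by (auto intro!: derivative_eq_intros)
    then have "((\<lambda>s. integral {-T..s} g - integral {-T..0} g) has_vector_derivative g t) (at t within {-T<..<T})"
      by (rule has_vector_derivative_within_subset) auto
    then have "(G has_vector_derivative g t) (at t within {-T<..<T})"
      by (rule has_vector_derivative_transform[rotated 2]) (use G_eq[of _ T] in \<open>auto simp: T_def\<close>)
    moreover have "at t within {-T<..<T} = at t"
      by (rule at_within_open) (auto simp: T_def)
    ultimately show ?thesis by simp
  qed
  moreover have "G 0 = 0" by (simp add: G_def)
  ultimately show ?thesis by blast
qed

text \<open>Integrates a bound c |t|^n in both time directions; its iteration produces the
  factorials in Picard's scheme.\<close>

lemma vector_derivative_power_bound:
  fixes f :: "real \<Rightarrow> 'b::real_normed_vector"
  assumes der: "\<And>t. (f has_vector_derivative f' t) (at t)" and "f 0 = 0"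
    and bound: "\<And>t. norm (f' t) \<le> c * \<bar>t\<bar> ^ n"
  shows "norm (f t) \<le> c * \<bar>t\<bar> ^ Suc n / real (Suc n)"
proof -
  have pos: "norm (h t) \<le> c * \<bar>t\<bar> ^ Suc n / real (Suc n)"
    if h: "\<And>t. (h has_vector_derivative h' t) (at t)" "h 0 = 0" 
      and b: "\<And>t. norm (h' t) \<le> c * \<bar>t\<bar> ^ n" and "t > 0" for h h' :: "real \<Rightarrow> 'b" and t
  proof -
    let ?\<phi> = "\<lambda>s. c * s ^ Suc n / real (Suc n)"
    have d\<phi>: "(?\<phi> has_vector_derivative c * s ^ n) (at s)" for s
      unfolding has_real_derivative_iff_has_vector_derivative[symmetric]
      by (rule derivative_eq_intros refl | simp)+
    have "norm (h t - h 0) \<le> ?\<phi> t - ?\<phi> 0"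
    proof (rule differentiable_bound_general[OF \<open>t > 0\<close>])
      show "continuous_on {0..t} h"
        using h(1) by (intro continuous_at_imp_continuous_on ballI has_vector_derivative_continuous)
      show "continuous_on {0..t} ?\<phi>"
        using d\<phi> by (intro continuous_at_imp_continuous_on ballI has_vector_derivative_continuous)
      show "norm (h' s) \<le> c * s ^ n" if "0 < s" for s using b[of s] that by simp
    qed (use h d\<phi> in auto)
    then show ?thesis using h(2) \<open>t > 0\<close> by simp
  qed
  consider "t = 0" | "t > 0" | "t < 0" by linarith
  then show ?thesis
  proof cases
    case 3
    have "((\<lambda>s. f (- s)) has_vector_derivative - f' (- s)) (at s)" for s
    proof -
      have "(f \<circ> uminus has_vector_derivative (-1) *\<^sub>R f' (- s)) (at s)"
        by (intro vector_diff_chain_at der) (auto intro!: derivative_eq_intros)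
      then show ?thesis by (simp add: o_def)
    qed
    then have "norm (f (- (- t))) \<le> c * \<bar>- t\<bar> ^ Suc n / real (Suc n)"
    proof (rule pos)
      show "norm (- f' (- s)) \<le> c * \<bar>s\<bar> ^ n" for s using bound[of "- s"] by simp
    qed (use \<open>f 0 = 0\<close> 3 in simp_all)
    then show ?thesis by simp
  next
    case 1
    then show ?thesis using \<open>f 0 = 0\<close> by simp
  next
    case 2
    show ?thesis by (rule pos[OF der \<open>f 0 = 0\<close> bound 2])
  qed
qed

text \<open>States may be unbounded over the index set. Only displacements are measured in the
  supremum norm, which is why the Lipschitz condition speaks of a common bound D on differences. The
  bound B on the velocity at x starts the induction: consecutive iterates differ by at most B L^n
  |t|^(n+1) / (n+1)!, uniformly in the index.\<close>

theorem picard_lindelof_product: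
  fixes G :: "('a \<Rightarrow> 'b::banach) \<Rightarrow> 'a \<Rightarrow> 'b"
  assumes L: "L \<ge> 0"
    and lip: "\<And>x y i D. (\<And>j. norm (x j - y j) \<le> D) \<Longrightarrow> norm (G x i - G y i) \<le> L * D"
    and cont: "\<And>(y :: real \<Rightarrow> 'a \<Rightarrow> 'b) i. (\<And>j. continuous_on UNIV (\<lambda>t. y t j)) \<Longrightarrow> continuous_on UNIV (\<lambda>t. G (y t) i)"
    and B: "\<And>i. norm (G x i) \<le> B"
  obtains y where "y 0 = x" "\<And>t i. ((\<lambda>s. y s i) has_vector_derivative G (y t) i) (at t)"
proof -
  \<comment> \<open>A chosen antiderivative, meaningful for continuous integrands; each iterate is
    shown continuous before \<open>J\<close> is evaluated along it.\<close>
  define J :: "(real \<Rightarrow> 'b) \<Rightarrow> real \<Rightarrow> 'b"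
    where "J g = (SOME h. h 0 = 0 \<and> (\<forall>t. (h has_vector_derivative g t) (at t)))" for g
  have J: "J g 0 = 0" "(J g has_vector_derivative g t) (at t)" if "continuous_on UNIV g" for g t
    using someI_ex[OF antiderivative_exists[OF that]] by (auto simp: J_def)
  define Y where "Y = rec_nat (\<lambda>t i. x i) (\<lambda>_ y t i. x i + J (\<lambda>s. G (y s) i) t)"
  have Y0: "Y 0 t i = x i" and YS: "Y (Suc n) t i = x i + J (\<lambda>s. G (Y n s) i) t" for n t i
    by (simp_all add: Y_def)
  have Y0': "Y 0 t = x" for t by (simp add: Y_def)
  have Yc: "continuous_on UNIV (\<lambda>t. Y n t i)" for n i
  proof (induction n arbitrary: i)
    case (Suc n)
    have "continuous_on UNIV (J (\<lambda>s. G (Y n s) i))"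
      using J(2)[OF cont[OF Suc]] by (intro continuous_at_imp_continuous_on ballI has_vector_derivative_continuous)
    then show ?case unfolding YS by (intro continuous_intros)
  qed (simp add: Y0)
  have YD: "((\<lambda>s. Y (Suc n) s i) has_vector_derivative G (Y n t) i) (at t)" for n t i
    unfolding YS using J(2)[OF cont[OF Yc]] by (auto intro!: derivative_eq_intros)
  have Yz: "Y n 0 i = x i" for n i
    by (cases n) (simp_all add: Y0 YS J(1)[OF cont[OF Yc]])
  have diff: "norm (Y (Suc n) t i - Y n t i) \<le> B * L ^ n / fact n * \<bar>t\<bar> ^ Suc n / real (Suc n)" for n t i
  proof (induction n arbitrary: t i)
    case 0
    show ?case
      by (rule vector_derivative_power_bound[where f = "\<lambda>t. Y (Suc 0) t i - Y 0 t i" and f' = "\<lambda>t. G (Y 0 t) i"])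
         (use YD[of 0 i] B in \<open>auto simp: Y0 Y0' Yz intro!: derivative_eq_intros\<close>)
  next
    case (Suc n)
    show ?case
    proof (rule vector_derivative_power_bound[where f = "\<lambda>t. Y (Suc (Suc n)) t i - Y (Suc n) t i"
            and f' = "\<lambda>t. G (Y (Suc n) t) i - G (Y n t) i"])
      show "((\<lambda>t. Y (Suc (Suc n)) t i - Y (Suc n) t i) has_vector_derivative G (Y (Suc n) t) i - G (Y n t) i) (at t)" for t
        by (intro has_vector_derivative_diff YD)
      show "norm (G (Y (Suc n) t) i - G (Y n t) i) \<le> B * L ^ Suc n / fact (Suc n) * \<bar>t\<bar> ^ Suc n" for t
        using lip[of "Y (Suc n) t" "Y n t", OF Suc, of i] by (simp add: field_simps)
    qed (simp add: Yz)
  qed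
  have B0: "B \<ge> 0" using B norm_ge_zero order_trans by blast
  define y where "y t i = x i + (\<Sum>n. Y (Suc n) t i - Y n t i)" for t i
  have UL: "uniform_limit ({-T..T} \<times> UNIV) (\<lambda>n (t, i). Y n t i) (\<lambda>(t, i). y t i) sequentially" for T
  proof -
    have "uniform_limit ({-T..T} \<times> UNIV) 
        (\<lambda>n z. \<Sum>k<n. Y (Suc k) (fst z) (snd z) - Y k (fst z) (snd z)) 
        (\<lambda>z. \<Sum>k. Y (Suc k) (fst z) (snd z) - Y k (fst z) (snd z)) sequentially"
    proof (rule Weierstrass_m_test)
      show "summable (\<lambda>n. B * \<bar>T\<bar> * ((L * \<bar>T\<bar>) ^ n /\<^sub>R fact n))"
        by (intro summable_mult summable_exp_generic)
      fix n and z :: "real \<times> 'a" assume z: "z \<in> {-T..T} \<times> UNIV"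
      obtain t i where [simp]: "z = (t, i)" by (cases z)
      have t: "\<bar>t\<bar> \<le> \<bar>T\<bar>" using z by auto
      have "norm (Y (Suc n) t i - Y n t i) \<le> B * L ^ n / fact n * \<bar>t\<bar> ^ Suc n / real (Suc n)"
        by (rule diff)
      also have "\<dots> \<le> B * L ^ n / fact n * \<bar>t\<bar> ^ Suc n / 1"
        using B0 L by (intro divide_left_mono) auto
      also have "\<dots> \<le> B * L ^ n / fact n * \<bar>T\<bar> ^ Suc n"
        using B0 L power_mono[OF t, of "Suc n"] by (simp add: mult_left_mono divide_right_mono del: power_Suc)
      finally show "norm (Y (Suc n) (fst z) (snd z) - Y n (fst z) (snd z)) 
          \<le> B * \<bar>T\<bar> * ((L * \<bar>T\<bar>) ^ n /\<^sub>R fact n)"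
        by (simp add: power_mult_distrib field_simps)
    qed
    then have "uniform_limit ({-T..T} \<times> UNIV) (\<lambda>n z. Y n (fst z) (snd z) - x (snd z)) 
        (\<lambda>z. y (fst z) (snd z) - x (snd z)) sequentially"
      by (simp add: sum_lessThan_telescope[of "\<lambda>k. Y k t i" for t i] Y0 y_def)
    then show ?thesis by (simp add: uniform_limit_iff dist_norm case_prod_beta)
  qed
  show thesis
  proof
    show "y 0 = x" by (auto simp: y_def Yz)
    fix t i
    have lim: "(\<lambda>n. Y n t i) \<longlonglongrightarrow> y t i" for t i
    proof -
      have "(t, i) \<in> {-\<bar>t\<bar>..\<bar>t\<bar>} \<times> UNIV" by auto
      from tendsto_uniform_limitI[OF UL this] show ?thesis by simp
    qed
    show "((\<lambda>s. y s i) has_vector_derivative G (y t) i) (at t)"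
    proof (rule has_vector_derivative_limit[where f = "\<lambda>n t. Y (Suc n) t i" and f' = "\<lambda>n t. G (Y n t) i"])
      show "(\<lambda>n. Y (Suc n) t i) \<longlonglongrightarrow> y t i" for t using lim by (rule LIMSEQ_Suc)
      show "uniform_limit {-T..T} (\<lambda>n t. G (Y n t) i) (\<lambda>t. G (y t) i) sequentially" for T
        unfolding uniform_limit_iff
      proof (intro allI impI)
        fix e :: real assume e: "e > 0"
        then have "e / (L + 1) > 0" using L by simp
        with UL[of T] have "\<forall>\<^sub>F n in sequentially. \<forall>z\<in>{-T..T} \<times> UNIV. 
            dist (case z of (t, i) \<Rightarrow> Y n t i) (case z of (t, i) \<Rightarrow> y t i) < e / (L + 1)"
          unfolding uniform_limit_iff by blast
        then show "\<forall>\<^sub>F n in sequentially. \<forall>t\<in>{-T..T}. dist (G (Y n t) i) (G (y t) i) < e"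
        proof (rule eventually_mono, intro ballI)
          fix n t assume "\<forall>z\<in>{-T..T} \<times> UNIV. 
            dist (case z of (t, i) \<Rightarrow> Y n t i) (case z of (t, i) \<Rightarrow> y t i) < e / (L + 1)" "t \<in> {-T..T}"
          then have "norm (Y n t j - y t j) \<le> e / (L + 1)" for j
            by (auto simp: dist_norm intro: less_imp_le)
          then have "norm (G (Y n t) i - G (y t) i) \<le> L * (e / (L + 1))" by (rule lip)
          also have "\<dots> < e" using e L by (simp add: field_simps)
          finally show "dist (G (Y n t) i) (G (y t) i) < e" by (simp add: dist_norm)
        qed
      qed
    qed (rule YD)
  qed
qed

subsection \<open>Dynamics in a subset of the lattice and the energy flux\<close>

text \<open>Particles outside \<open>A\<close> are frozen; \<open>A = UNIV\<close> is the infinite system. The force law \<open>g\<close> is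
  kept general because the finite-volume dynamics is first constructed for a cut-off potential.\<close>

definition velocity :: "(real \<Rightarrow> real) \<Rightarrow> real \<Rightarrow> ('d::finite) site set \<Rightarrow> 'd state \<Rightarrow> 'd state" where
  "velocity g K A x i = (if i \<in> A
     then (snd (x i), - g (fst (x i)) - K * (\<Sum>j\<in>neighbours i. fst (x i) - fst (x j)))
     else (0, 0))"

definition motion :: "(real \<Rightarrow> real) \<Rightarrow> real \<Rightarrow> ('d::finite) site set \<Rightarrow> (real \<Rightarrow> 'd state) \<Rightarrow> bool" where
  "motion g K A y \<longleftrightarrow> (\<forall>t i. ((\<lambda>s. y s i) has_vector_derivative velocity g K A (y t) i) (at t))"

text \<open>Each bond inside C occurs as two ordered pairs, hence K / 4 where a bond carries K /
  2.\<close>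

definition energy :: "(real \<Rightarrow> real) \<Rightarrow> real \<Rightarrow> ('d::finite) state \<Rightarrow> 'd site set \<Rightarrow> real" where
  "energy V K x C = (\<Sum>i\<in>C. (snd (x i))\<^sup>2 / 2 + V (fst (x i)) + 1)
     + (\<Sum>i\<in>C. \<Sum>j | j \<in> C \<and> j \<in> neighbours i. K / 4 * (fst (x i) - fst (x j))\<^sup>2)"

text \<open>The work done per unit time on the sites of C by their neighbours outside C. A frozen
  site keeps its momentum but does not move, so its velocity is 0 and not
  \<open>snd (x i)\<close>.\<close>

definition flux :: "real \<Rightarrow> ('d::finite) site set \<Rightarrow> 'd state \<Rightarrow> 'd site set \<Rightarrow> real" where
  "flux K A x C = - K * (\<Sum>i\<in>C. \<Sum>j\<in>neighbours i - C.
     (if i \<in> A then snd (x i) else 0) * (fst (x i) - fst (x j)))"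

section \<open>Link to the given definitions and energy balance\<close>

lemma W_eq_energy: "W U K x \<nu> k = energy (poly U) K x (cube \<nu> k)"
proof -
  have "{(i, j). i \<in> cube \<nu> k \<and> j \<in> cube \<nu> k \<and> lnorm (j - i) = 1}
      = (SIGMA i:cube \<nu> k. {j. j \<in> cube \<nu> k \<and> j \<in> neighbours i})"
    by (auto simp: neighbours_def)
  then show ?thesis
    by (simp add: W_def energy_def sum.Sigma)
qed

lemma is_solution_iff_motion: "is_solution U K y \<longleftrightarrow> motion (poly (pderiv U)) K UNIV y"
proof -
  have "((\<lambda>s. y s i) has_vector_derivative velocity (poly (pderiv U)) K UNIV (y t) i) (at t) \<longleftrightarrow>
    ((\<lambda>s. fst (y s i)) has_real_derivative snd (y t i)) (at t) \<and>
    ((\<lambda>s. snd (y s i)) has_real_derivative force U K (y t) i) (at t)" (is "?l \<longleftrightarrow> ?r1 \<and> ?r2") for t i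
  proof
    assume ?l
    then have "((\<lambda>s. fst (y s i)) has_vector_derivative fst (velocity (poly (pderiv U)) K UNIV (y t) i)) (at t)"
      "((\<lambda>s. snd (y s i)) has_vector_derivative snd (velocity (poly (pderiv U)) K UNIV (y t) i)) (at t)"
      by (auto intro: bounded_linear.has_vector_derivative bounded_linear_fst bounded_linear_snd)
    then show "?r1 \<and> ?r2"
      by (simp add: velocity_def force_def has_real_derivative_iff_has_vector_derivative)
  next
    assume "?r1 \<and> ?r2"
    then have "((\<lambda>s. (fst (y s i), snd (y s i))) has_vector_derivative (snd (y t i), force U K (y t) i)) (at t)"
      by (intro has_vector_derivative_Pair) (auto simp: has_real_derivative_iff_has_vector_derivative)
    then show ?l by (simp add: velocity_def force_def)
  qed
  then show ?thesis by (auto simp: is_solution_def motion_def)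
qed

lemma motion_fst:
  "motion g K A y \<Longrightarrow> ((\<lambda>s. fst (y s i)) has_real_derivative (if i \<in> A then snd (y t i) else 0)) (at t)"
  using bounded_linear.has_vector_derivative[OF bounded_linear_fst, of "\<lambda>s. y s i" "velocity g K A (y t) i" "at t"]
  by (auto simp: motion_def velocity_def has_real_derivative_iff_has_vector_derivative)

lemma motion_snd:
  "motion g K A y \<Longrightarrow> ((\<lambda>s. snd (y s i)) has_real_derivative 
     (if i \<in> A then - g (fst (y t i)) - K * (\<Sum>j\<in>neighbours i. fst (y t i) - fst (y t j)) else 0)) (at t)"
  using bounded_linear.has_vector_derivative[OF bounded_linear_snd, of "\<lambda>s. y s i" "velocity g K A (y t) i" "at t"]
  by (auto simp: motion_def velocity_def has_real_derivative_iff_has_vector_derivative)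

lemma motion_continuous: "motion g K A y \<Longrightarrow> continuous_on UNIV (\<lambda>t. y t i)"
  by (auto simp: motion_def intro!: continuous_at_imp_continuous_on intro: has_vector_derivative_continuous)

text \<open>The on-site terms cancel because g is the derivative of V. Exchanging the two indices
  turns the derivative of the coupling energy into K times the sum of v_i (q_i - q_j) over ordered
  pairs inside C, which cancels the work of the inner bonds. A frozen site has zero velocity and
  zero momentum derivative, so the same identity holds for every A; this makes the later bounds
  uniform in the volume.\<close>

lemma energy_has_derivative_flux:
  assumes y: "motion g K A y" and V: "\<And>q. (V has_real_derivative g q) (at q)" and C: "finite C"
  shows "((\<lambda>t. energy V K (y t) C) has_real_derivative flux K A (y t) C) (at t)"
proof -
  define v where "v i = (if i \<in> A then snd (y t i) else 0)" for i
  define q where "q i = fst (y t i)" for i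
  define f where "f i = (if i \<in> A then - g (q i) - K * (\<Sum>j\<in>neighbours i. q i - q j) else 0)" for i
  have dq: "((\<lambda>s. fst (y s i)) has_real_derivative v i) (at t)" for i
    using motion_fst[OF y, of i t] unfolding v_def .
  have dp: "((\<lambda>s. snd (y s i)) has_real_derivative f i) (at t)" for i
    using motion_snd[OF y, of i t] unfolding f_def q_def .
  have dV: "((\<lambda>s. V (fst (y s i))) has_real_derivative g (q i) * v i) (at t)" for i
    using DERIV_chain2[OF V dq] by (simp add: q_def)
  have 1: "((\<lambda>s. energy V K (y s) C) has_real_derivative
      (\<Sum>i\<in>C. snd (y t i) * f i + g (q i) * v i)
      + (\<Sum>i\<in>C. \<Sum>j | j \<in> C \<and> j \<in> neighbours i. K / 2 * ((q i - q j) * (v i - v j)))) (at t)"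
    unfolding energy_def
    by (rule derivative_eq_intros dq dp dV DERIV_sum refl | simp add: q_def mult_ac)+
  have 2: "snd (y t i) * f i + g (q i) * v i = - K * (\<Sum>j\<in>neighbours i. v i * (q i - q j))" for i
  proof -
    define S where "S = (\<Sum>j\<in>neighbours i. q i - q j)"
    have "(\<Sum>j\<in>neighbours i. v i * (q i - q j)) = v i * S" by (simp add: S_def sum_distrib_left)
    then show ?thesis by (simp add: f_def v_def S_def[symmetric] algebra_simps)
  qed
  have swap: "(\<Sum>i\<in>C. \<Sum>j | j \<in> C \<and> j \<in> neighbours i. (q i - q j) * v j)
      = (\<Sum>i\<in>C. \<Sum>j | j \<in> C \<and> j \<in> neighbours i. (q j - q i) * v i)"
    by (subst sum.swap_restrict[OF C C], intro sum.cong refl) (auto simp: neighbours_sym)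
  have "(\<Sum>i\<in>C. \<Sum>j | j \<in> C \<and> j \<in> neighbours i. K / 2 * ((q i - q j) * (v i - v j)))
    = K / 2 * ((\<Sum>i\<in>C. \<Sum>j | j \<in> C \<and> j \<in> neighbours i. (q i - q j) * v i)
             - (\<Sum>i\<in>C. \<Sum>j | j \<in> C \<and> j \<in> neighbours i. (q i - q j) * v j))"
    by (simp add: sum_distrib_left right_diff_distrib sum_subtractf)
  also have "\<dots> = K * (\<Sum>i\<in>C. \<Sum>j | j \<in> C \<and> j \<in> neighbours i. v i * (q i - q j))"
    unfolding swap sum_subtractf[symmetric] sum_distrib_left
    by (intro sum.cong refl) (simp add: algebra_simps)
  finally have 3: "(\<Sum>i\<in>C. \<Sum>j | j \<in> C \<and> j \<in> neighbours i. K / 2 * ((q i - q j) * (v i - v j)))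
    = K * (\<Sum>i\<in>C. \<Sum>j | j \<in> C \<and> j \<in> neighbours i. v i * (q i - q j))" .
  have 4: "(\<Sum>j\<in>neighbours i. v i * (q i - q j)) = (\<Sum>j | j \<in> C \<and> j \<in> neighbours i. v i * (q i - q j))
      + (\<Sum>j\<in>neighbours i - C. v i * (q i - q j))" for i
  proof -
    have "neighbours i = {j. j \<in> C \<and> j \<in> neighbours i} \<union> (neighbours i - C)" by auto
    moreover have "finite {j. j \<in> C \<and> j \<in> neighbours i}"
      using C by simp
    ultimately show ?thesis
      by (subst sum.union_disjoint[symmetric]) auto
  qed
  have "(\<Sum>i\<in>C. snd (y t i) * f i + g (q i) * v i)
      + (\<Sum>i\<in>C. \<Sum>j | j \<in> C \<and> j \<in> neighbours i. K / 2 * ((q i - q j) * (v i - v j)))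
      = flux K A (y t) C"
    unfolding 2 3 unfolding 4 flux_def v_def[symmetric] q_def[symmetric]
    unfolding sum_distrib_left[symmetric] distrib_left sum.distrib by simp
  with 1 show ?thesis by simp
qed

lemma energy_mono:
  assumes "K > 0" "\<And>q. V q \<ge> 0" "finite D" "C \<subseteq> D"
  shows "energy V K x C \<le> energy V K x D"
proof -
  have fin: "finite C" using assms finite_subset by blast
  have "(\<Sum>i\<in>C. \<Sum>j | j \<in> C \<and> j \<in> neighbours i. K / 4 * (fst (x i) - fst (x j))\<^sup>2)
      \<le> (\<Sum>i\<in>C. \<Sum>j | j \<in> D \<and> j \<in> neighbours i. K / 4 * (fst (x i) - fst (x j))\<^sup>2)"
    using assms by (intro sum_mono sum_mono2) auto
  also have "\<dots> \<le> (\<Sum>i\<in>D. \<Sum>j | j \<in> D \<and> j \<in> neighbours i. K / 4 * (fst (x i) - fst (x j))\<^sup>2)"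
    using assms by (intro sum_mono2 sum_nonneg) auto
  finally show ?thesis
    unfolding energy_def using assms by (intro add_mono sum_mono2) (auto intro!: add_nonneg_nonneg)
qed

lemma energy_ge_sum:
  assumes "K > 0"
  shows "(\<Sum>i\<in>C. (snd (x i))\<^sup>2 / 2 + V (fst (x i)) + 1) \<le> energy V K x C"
  unfolding energy_def using assms by (auto intro!: sum_nonneg)

lemma sum_flux_bound:
  assumes K: "K > 0"
  shows "(\<Sum>m\<in>{k..<n}. \<bar>flux K A x (cube \<nu> m)\<bar>)
    \<le> K * (\<Sum>i\<in>cube \<nu> n. \<Sum>j | j \<in> cube \<nu> n \<and> j \<in> neighbours i.
         \<bar>snd (x i)\<bar> * (\<bar>fst (x i)\<bar> + \<bar>fst (x j)\<bar>))"
proof -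
  define h where "h = (\<lambda>(i, j). \<bar>snd (x i)\<bar> * (\<bar>fst (x i)\<bar> + \<bar>fst (x j)\<bar>))"
  define B where "B m = (SIGMA i:cube \<nu> m. neighbours i - cube \<nu> m)" for m
  have finB: "finite (B m)" for m unfolding B_def by auto
  have 1: "\<bar>flux K A x (cube \<nu> m)\<bar> \<le> K * sum h (B m)" for m
  proof -
    have "\<bar>flux K A x (cube \<nu> m)\<bar> = K * \<bar>\<Sum>i\<in>cube \<nu> m. \<Sum>j\<in>neighbours i - cube \<nu> m.
     (if i \<in> A then snd (x i) else 0) * (fst (x i) - fst (x j))\<bar>"
      using K by (simp add: flux_def abs_mult)
    also have "\<dots> \<le> K * (\<Sum>i\<in>cube \<nu> m. \<Sum>j\<in>neighbours i - cube \<nu> m. h (i, j))"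
    proof (intro mult_left_mono order_trans[OF sum_abs] sum_mono)
      fix i j
      show "\<bar>(if i \<in> A then snd (x i) else 0) * (fst (x i) - fst (x j))\<bar> \<le> h (i, j)"
        by (auto simp: h_def abs_mult intro!: mult_left_mono)
    qed (use K in auto)
    also have "\<dots> = K * sum h (B m)" by (simp add: B_def sum.Sigma)
    finally show ?thesis .
  qed
  \<comment> \<open>Neighbours of a site of the m-th cube lie in the next one, so a directed bond
    leaving the m-th cube leaves no larger cube.\<close>
  have disj: "B m \<inter> B m' = {}" if "m < m'" for m m'
  proof (rule equals0I)
    fix z assume "z \<in> B m \<inter> B m'"
    then obtain i j where "i \<in> cube \<nu> m" "j \<in> neighbours i" "j \<notin> cube \<nu> m'" by (auto simp: B_def)
    moreover have "cube \<nu> (Suc m) \<subseteq> cube \<nu> m'" using that by (intro cube_mono) simp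
    ultimately show False using cube_neighbour_Suc by blast
  qed
  have "(\<Sum>m\<in>{k..<n}. \<bar>flux K A x (cube \<nu> m)\<bar>) \<le> (\<Sum>m\<in>{k..<n}. K * sum h (B m))"
    using 1 by (rule sum_mono)
  also have "\<dots> = K * (\<Sum>m\<in>{k..<n}. sum h (B m))" by (simp add: sum_distrib_left)
  also have "(\<Sum>m\<in>{k..<n}. sum h (B m)) = sum h (\<Union>m\<in>{k..<n}. B m)"
  proof (rule sum.UNION_disjoint[symmetric])
    show "\<forall>i\<in>{k..<n}. \<forall>j\<in>{k..<n}. i \<noteq> j \<longrightarrow> B i \<inter> B j = {}"
      using disj by (metis inf_commute linorder_neqE_nat)
  qed (use finB in auto)
  also have "\<dots> \<le> sum h (SIGMA i:cube \<nu> n. {j. j \<in> cube \<nu> n \<and> j \<in> neighbours i})"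
  proof (rule sum_mono2)
    show "(\<Union>m\<in>{k..<n}. B m) \<subseteq> (SIGMA i:cube \<nu> n. {j. j \<in> cube \<nu> n \<and> j \<in> neighbours i})"
    proof
      fix z assume "z \<in> (\<Union>m\<in>{k..<n}. B m)"
      then obtain m i j where z: "m < n" "z = (i, j)" "i \<in> cube \<nu> m" "j \<in> neighbours i" 
        by (auto simp: B_def)
      moreover have "cube \<nu> (Suc m) \<subseteq> cube \<nu> n" "cube \<nu> m \<subseteq> cube \<nu> n"
        using z by (auto intro!: cube_mono)
      ultimately show "z \<in> (SIGMA i:cube \<nu> n. {j. j \<in> cube \<nu> n \<and> j \<in> neighbours i})"
        using cube_neighbour_Suc by blast
    qed
  qed (auto simp: h_def intro!: finite_SigmaI)
  also have "\<dots> = (\<Sum>i\<in>cube \<nu> n. \<Sum>j | j \<in> cube \<nu> n \<and> j \<in> neighbours i. h (i, j))"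
    by (subst sum.Sigma) auto
  finally show ?thesis using K by (simp add: h_def)
qed

subsection \<open>Quartic potentials\<close>

text \<open>Stated for a general quartic because it is applied both to U(q) and to q U'(q).\<close>

lemma quartic_lower_bound:
  fixes P :: "real poly"
  assumes "degree P = 4" "lead_coeff P > 0"
  obtains R where "R \<ge> 1" "\<And>q. \<bar>q\<bar> \<ge> R \<Longrightarrow> poly P q \<ge> lead_coeff P / 2 * q ^ 4"
proof -
  define a where "a = coeff P 4"
  define S where "S = \<bar>coeff P 0\<bar> + \<bar>coeff P 1\<bar> + \<bar>coeff P 2\<bar> + \<bar>coeff P 3\<bar>"
  have a: "a > 0" "lead_coeff P = a" using assms by (simp_all add: a_def)
  \<comment> \<open>For |q| \<ge> 1 the lower order terms are at most S |q|^3, and |q| \<ge> 2 S / a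
    makes this at most half of the leading term.\<close>
  define R where "R = max 1 (2 * S / a)"
  have lower: "poly P q \<ge> a / 2 * q ^ 4" if q: "\<bar>q\<bar> \<ge> R" for q
  proof -
    have q1: "1 \<le> \<bar>q\<bar>" and qS: "2 * S / a \<le> \<bar>q\<bar>" using q by (auto simp: R_def)
    have le: "\<bar>c * q ^ i\<bar> \<le> \<bar>c\<bar> * \<bar>q\<bar> ^ 3" if "i \<le> 3" for c :: real and i
      using power_increasing[OF that q1] by (auto simp: abs_mult power_abs intro!: mult_left_mono)
    have "poly P q = coeff P 0 * q ^ 0 + coeff P 1 * q ^ 1 + coeff P 2 * q ^ 2 + coeff P 3 * q ^ 3 + a * q ^ 4"
      by (simp add: poly_altdef assms a_def numeral_eq_Suc)
    then have "a * q ^ 4 - poly P q \<le> \<bar>coeff P 0 * q ^ 0\<bar> + \<bar>coeff P 1 * q ^ 1\<bar> + \<bar>coeff P 2 * q ^ 2\<bar> + \<bar>coeff P 3 * q ^ 3\<bar>"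
      by linarith
    also have "\<dots> \<le> \<bar>coeff P 0\<bar> * \<bar>q\<bar> ^ 3 + \<bar>coeff P 1\<bar> * \<bar>q\<bar> ^ 3 + \<bar>coeff P 2\<bar> * \<bar>q\<bar> ^ 3 + \<bar>coeff P 3\<bar> * \<bar>q\<bar> ^ 3"
      by (intro add_mono le) auto
    also have "\<dots> = S * \<bar>q\<bar> ^ 3" by (simp add: S_def algebra_simps)
    also have "S \<le> a / 2 * \<bar>q\<bar>" using qS a by (simp add: field_simps)
    then have "S * \<bar>q\<bar> ^ 3 \<le> a / 2 * \<bar>q\<bar> * \<bar>q\<bar> ^ 3" by (intro mult_right_mono) auto
    also have "\<dots> = a / 2 * q ^ 4" by (simp add: power4_eq_xxxx power3_eq_cube abs_mult[symmetric] mult.assoc)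
    finally show ?thesis by (simp add: field_simps)
  qed
  show thesis
  proof (rule that)
    show "1 \<le> R" by (simp add: R_def)
    show "poly P q \<ge> lead_coeff P / 2 * q ^ 4" if "\<bar>q\<bar> \<ge> R" for q
      using lower[OF that] by (simp add: a(2))
  qed
qed

section \<open>Growth and difference estimates for the potential\<close>

locale anharmonic =
  fixes U :: "real poly" and K :: real
  assumes K_pos: "K > 0" and U_deg: "degree U = 4"
    and U_lead: "lead_coeff U > 0" and U_nonneg: "\<And>r. poly U r \<ge> 0"
begin

abbreviation "U' \<equiv> poly (pderiv U)"
abbreviation "U'' \<equiv> poly (pderiv (pderiv U))"

lemma U_derivative: "(poly U has_real_derivative U' q) (at q)"
  by (rule poly_DERIV)

text \<open>The source of |q| \<le> C W^(1/4). For small |q| the summand 1 provides the bound, since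
  U itself may vanish.\<close>

lemma U_growth: "\<exists>c\<ge>1. \<forall>q. q ^ 4 \<le> c * (poly U q + 1)"
proof -
  obtain R where R: "R \<ge> 1" "\<And>q. \<bar>q\<bar> \<ge> R \<Longrightarrow> poly U q \<ge> lead_coeff U / 2 * q ^ 4"
    using quartic_lower_bound[OF U_deg U_lead] by blast
  define c where "c = R ^ 4 + 2 / lead_coeff U"
  have c: "R ^ 4 \<le> c" "2 / lead_coeff U \<le> c" using R(1) U_lead by (auto simp: c_def)
  have "1 \<le> R ^ 4" using R(1) by simp
  then have c1: "1 \<le> c" using c by linarith
  have "q ^ 4 \<le> c * (poly U q + 1)" for q
  proof (cases "\<bar>q\<bar> \<ge> R")
    case True
    have "q ^ 4 = 2 / lead_coeff U * (lead_coeff U / 2 * q ^ 4)"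
    proof -
      have "b = 2 / a * (a / 2 * b)" if "a > 0" for a b :: real using that by simp
      then show ?thesis using U_lead by blast
    qed
    also have "\<dots> \<le> 2 / lead_coeff U * (poly U q + 1)"
      using R(2)[OF True] U_lead by (intro mult_left_mono) auto
    also have "\<dots> \<le> c * (poly U q + 1)" using c U_nonneg[of q] by (intro mult_right_mono) auto
    finally show ?thesis .
  next
    case False
    then have "\<bar>q\<bar> ^ 4 \<le> R ^ 4" by (intro power_mono) auto
    also have "\<dots> \<le> c * 1" using c by simp
    also have "\<dots> \<le> c * (poly U q + 1)" using c1 U_nonneg[of q] by (intro mult_left_mono) auto
    finally show ?thesis by simp
  qed
  with c1 show ?thesis by blast
qed

definition cU :: real where "cU = (SOME c. c \<ge> 1 \<and> (\<forall>q. q ^ 4 \<le> c * (poly U q + 1)))"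

lemma cU_ge_1: "cU \<ge> 1" and quartic_le: "q ^ 4 \<le> cU * (poly U q + 1)"
  using someI_ex[OF U_growth[simplified Bex_def]] by (auto simp: cU_def)

text \<open>The polynomial q U'(q) is again quartic with positive leading coefficient, hence
  nonnegative for large |q|. This sign keeps the cut-off potential from decreasing outside the
  cut-off.\<close>

lemma U'_outward: "\<exists>R\<ge>1. \<forall>q. (q \<ge> R \<longrightarrow> U' q \<ge> 0) \<and> (q \<le> - R \<longrightarrow> U' q \<le> 0)"
proof -
  let ?P = "pCons 0 (pderiv U)"
  have "pderiv U \<noteq> 0" using U_deg by (simp add: pderiv_eq_0_iff)
  then have deg: "degree ?P = 4" by (simp add: degree_pderiv U_deg)
  have lead: "lead_coeff ?P > 0" unfolding deg using U_lead U_deg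
    by (simp add: numeral_eq_Suc coeff_pCons coeff_pderiv)
  obtain R where R: "R \<ge> 1" "\<And>q. \<bar>q\<bar> \<ge> R \<Longrightarrow> poly ?P q \<ge> lead_coeff ?P / 2 * q ^ 4"
    using quartic_lower_bound[OF deg lead] by blast
  have pos: "q * U' q \<ge> 0" if "\<bar>q\<bar> \<ge> R" for q
  proof -
    have "0 \<le> lead_coeff ?P / 2 * q ^ 4" using lead by simp
    also have "\<dots> \<le> poly ?P q" by (rule R(2)[OF that])
    finally show ?thesis by simp
  qed
  have "(q \<ge> R \<longrightarrow> U' q \<ge> 0) \<and> (q \<le> - R \<longrightarrow> U' q \<le> 0)" for q
    using pos[of q] R(1) by (auto simp: zero_le_mult_iff)
  with R(1) show ?thesis by blast
qed

text \<open>As U' is cubic, r - q and its square factor out of the difference and the Taylor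
  remainder exactly. The cofactors are combinations of the coefficients b1, b2, b3 whose multipliers
  are at most 1, 2 and 3 times 1 + q^2 + r^2, which gives the weights in c and lets
  \<open>key\<close> treat all three claims.\<close>

lemma U'_estimates:
  "\<exists>c\<ge>0. \<forall>q r. \<bar>U' r - U' q\<bar> \<le> c * (1 + q\<^sup>2 + r\<^sup>2) * \<bar>r - q\<bar>
     \<and> \<bar>U' r - U' q - U'' q * (r - q)\<bar> \<le> c * (1 + q\<^sup>2 + r\<^sup>2) * (r - q)\<^sup>2
     \<and> \<bar>U'' q\<bar> \<le> c * (1 + q\<^sup>2 + r\<^sup>2)"
proof -
  define b1 b2 b3 where "b1 = coeff (pderiv U) 1" and "b2 = coeff (pderiv U) 2" and "b3 = coeff (pderiv U) 3"
  have deg: "degree (pderiv U) = 3" "degree (pderiv (pderiv U)) = 2"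
    by (simp_all add: degree_pderiv U_deg)
  have U': "U' q = coeff (pderiv U) 0 + b1 * q + b2 * q\<^sup>2 + b3 * q ^ 3" for q
    by (simp add: poly_altdef deg b1_def b2_def b3_def numeral_eq_Suc)
  have U'': "U'' q = b1 + 2 * b2 * q + 3 * b3 * q\<^sup>2" for q
    by (simp add: poly_altdef deg b1_def b2_def b3_def numeral_eq_Suc coeff_pderiv)
  define c where "c = \<bar>b1\<bar> + 2 * \<bar>b2\<bar> + 3 * \<bar>b3\<bar>"
  have q2: "\<bar>q\<bar> \<le> (1 + q\<^sup>2) / 2" for q :: real
    using sum_squares_bound[of 1 "\<bar>q\<bar>"] by simp
  have key: "\<bar>\<beta>\<^sub>1 * b1 + \<beta>\<^sub>2 * b2 + \<beta>\<^sub>3 * b3\<bar> \<le> c * (1 + q\<^sup>2 + r\<^sup>2)"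
    if "\<bar>\<beta>\<^sub>1\<bar> \<le> 1 + q\<^sup>2 + r\<^sup>2" "\<bar>\<beta>\<^sub>2\<bar> \<le> 2 * (1 + q\<^sup>2 + r\<^sup>2)" "\<bar>\<beta>\<^sub>3\<bar> \<le> 3 * (1 + q\<^sup>2 + r\<^sup>2)" 
    for \<beta>\<^sub>1 \<beta>\<^sub>2 \<beta>\<^sub>3 q r :: real
  proof -
    have "\<bar>\<beta>\<^sub>1 * b1 + \<beta>\<^sub>2 * b2 + \<beta>\<^sub>3 * b3\<bar> \<le> \<bar>\<beta>\<^sub>1\<bar> * \<bar>b1\<bar> + \<bar>\<beta>\<^sub>2\<bar> * \<bar>b2\<bar> + \<bar>\<beta>\<^sub>3\<bar> * \<bar>b3\<bar>"
      unfolding abs_mult[symmetric] by linarith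
    also have "\<dots> \<le> (1 + q\<^sup>2 + r\<^sup>2) * \<bar>b1\<bar> + (2 * (1 + q\<^sup>2 + r\<^sup>2)) * \<bar>b2\<bar> + (3 * (1 + q\<^sup>2 + r\<^sup>2)) * \<bar>b3\<bar>"
      using that by (intro add_mono mult_right_mono) auto
    finally show ?thesis by (simp add: c_def algebra_simps)
  qed
  have qr: "\<bar>q\<bar> + \<bar>r\<bar> \<le> 1 + q\<^sup>2 + r\<^sup>2" "\<bar>q * r\<bar> \<le> (q\<^sup>2 + r\<^sup>2) / 2" "\<bar>q\<bar> \<le> 1 + q\<^sup>2 + r\<^sup>2"  for q r :: real
  proof -
    have nn: "0 \<le> q\<^sup>2" "0 \<le> r\<^sup>2" by auto
    show "\<bar>q\<bar> + \<bar>r\<bar> \<le> 1 + q\<^sup>2 + r\<^sup>2" "\<bar>q\<bar> \<le> 1 + q\<^sup>2 + r\<^sup>2"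
      using q2[of q] q2[of r] nn by argo+
    show "\<bar>q * r\<bar> \<le> (q\<^sup>2 + r\<^sup>2) / 2"
      using sum_squares_bound[of "\<bar>q\<bar>" "\<bar>r\<bar>"] by (simp add: abs_mult)
  qed
  show ?thesis
  proof (intro exI[of _ c] conjI allI)
    show "c \<ge> 0" by (simp add: c_def)
    fix q r :: real
    have nn: "0 \<le> q\<^sup>2" "0 \<le> r\<^sup>2" by auto
    have lin: "\<bar>r + q\<bar> \<le> 2 * (1 + q\<^sup>2 + r\<^sup>2)" "\<bar>r\<^sup>2 + q * r + q\<^sup>2\<bar> \<le> 3 * (1 + q\<^sup>2 + r\<^sup>2)"
      "\<bar>r + 2 * q\<bar> \<le> 3 * (1 + q\<^sup>2 + r\<^sup>2)" "\<bar>2 * q\<bar> \<le> 2 * (1 + q\<^sup>2 + r\<^sup>2)" 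
      "\<bar>3 * q\<^sup>2\<bar> \<le> 3 * (1 + q\<^sup>2 + r\<^sup>2)"
    proof -
      \<comment> \<open>The squares and the product are replaced by variables a, b and s, which
        makes the claims linear.\<close>
      have lin: "\<bar>r + q\<bar> \<le> 2 * (1 + a + b)" "\<bar>b + s + a\<bar> \<le> 3 * (1 + a + b)"
        "\<bar>r + 2 * q\<bar> \<le> 3 * (1 + a + b)" "\<bar>2 * q\<bar> \<le> 2 * (1 + a + b)" "\<bar>3 * a\<bar> \<le> 3 * (1 + a + b)"
        if "0 \<le> a" "0 \<le> b" "\<bar>q\<bar> + \<bar>r\<bar> \<le> 1 + a + b" "\<bar>s\<bar> \<le> (a + b) / 2" "\<bar>q\<bar> \<le> 1 + a + b" 
        for a b s :: real
      proof -
        have "s \<le> (a + b) / 2" "- s \<le> (a + b) / 2" "q + r \<le> 1 + a + b" "- q - r \<le> 1 + a + b"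
          "q \<le> 1 + a + b" "- q \<le> 1 + a + b"
          using that by (auto simp: abs_le_iff)
        with that(1,2) show "\<bar>r + q\<bar> \<le> 2 * (1 + a + b)" "\<bar>b + s + a\<bar> \<le> 3 * (1 + a + b)"
          "\<bar>r + 2 * q\<bar> \<le> 3 * (1 + a + b)" "\<bar>2 * q\<bar> \<le> 2 * (1 + a + b)" "\<bar>3 * a\<bar> \<le> 3 * (1 + a + b)"
          unfolding abs_le_iff by auto
      qed
      note * = lin[OF nn qr[of q r]]
      show "\<bar>r + q\<bar> \<le> 2 * (1 + q\<^sup>2 + r\<^sup>2)" "\<bar>r\<^sup>2 + q * r + q\<^sup>2\<bar> \<le> 3 * (1 + q\<^sup>2 + r\<^sup>2)"
        "\<bar>r + 2 * q\<bar> \<le> 3 * (1 + q\<^sup>2 + r\<^sup>2)" "\<bar>2 * q\<bar> \<le> 2 * (1 + q\<^sup>2 + r\<^sup>2)" 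
        "\<bar>3 * q\<^sup>2\<bar> \<le> 3 * (1 + q\<^sup>2 + r\<^sup>2)" 
        using * by (-, blast+)
    qed
    have "U' r - U' q = (1 * b1 + (r + q) * b2 + (r\<^sup>2 + q * r + q\<^sup>2) * b3) * (r - q)"
      by (simp add: U' power2_eq_square power3_eq_cube algebra_simps)
    moreover have "\<bar>1 * b1 + (r + q) * b2 + (r\<^sup>2 + q * r + q\<^sup>2) * b3\<bar> \<le> c * (1 + q\<^sup>2 + r\<^sup>2)"
      by (rule key) (use lin in simp_all)
    ultimately show "\<bar>U' r - U' q\<bar> \<le> c * (1 + q\<^sup>2 + r\<^sup>2) * \<bar>r - q\<bar>"
      by (simp add: abs_mult mult_right_mono)
    have "U' r - U' q - U'' q * (r - q) = (0 * b1 + 1 * b2 + (r + 2 * q) * b3) * (r - q)\<^sup>2"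
      by (simp add: U' U'' power2_eq_square power3_eq_cube algebra_simps)
    moreover have "\<bar>0 * b1 + 1 * b2 + (r + 2 * q) * b3\<bar> \<le> c * (1 + q\<^sup>2 + r\<^sup>2)"
      by (rule key) (use lin in simp_all)
    ultimately show "\<bar>U' r - U' q - U'' q * (r - q)\<bar> \<le> c * (1 + q\<^sup>2 + r\<^sup>2) * (r - q)\<^sup>2"
      by (simp add: abs_mult mult_right_mono)
    have "U'' q = 1 * b1 + (2 * q) * b2 + (3 * q\<^sup>2) * b3" by (simp add: U'')
    moreover have "\<bar>1 * b1 + (2 * q) * b2 + (3 * q\<^sup>2) * b3\<bar> \<le> c * (1 + q\<^sup>2 + r\<^sup>2)"
      by (rule key) (use lin in simp_all)
    ultimately show "\<bar>U'' q\<bar> \<le> c * (1 + q\<^sup>2 + r\<^sup>2)" by simp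
  qed
qed

definition cU' :: real where "cU' = (SOME c. c \<ge> 0 \<and> (\<forall>q r. \<bar>U' r - U' q\<bar> \<le> c * (1 + q\<^sup>2 + r\<^sup>2) * \<bar>r - q\<bar>
     \<and> \<bar>U' r - U' q - U'' q * (r - q)\<bar> \<le> c * (1 + q\<^sup>2 + r\<^sup>2) * (r - q)\<^sup>2
     \<and> \<bar>U'' q\<bar> \<le> c * (1 + q\<^sup>2 + r\<^sup>2)))"

lemma cU'_nonneg: "cU' \<ge> 0"
  and U'_lipschitz: "\<bar>U' r - U' q\<bar> \<le> cU' * (1 + q\<^sup>2 + r\<^sup>2) * \<bar>r - q\<bar>"
  and U'_taylor: "\<bar>U' r - U' q - U'' q * (r - q)\<bar> \<le> cU' * (1 + q\<^sup>2 + r\<^sup>2) * (r - q)\<^sup>2"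
  and U''_bound: "\<bar>U'' q\<bar> \<le> cU' * (1 + q\<^sup>2 + r\<^sup>2)"
  using someI_ex[OF U'_estimates[simplified Bex_def]] unfolding cU'_def[symmetric] by blast+

end

subsection \<open>A priori growth of the maximal energy density\<close>

definition admissible :: "('d::finite) site \<Rightarrow> nat \<Rightarrow> bool" where
  "admissible \<nu> k \<longleftrightarrow> lw \<nu> powr (1 / real CARD('d)) < real k"

lemma admissible_pos:
  assumes "admissible \<nu> k"
  shows "k \<ge> 1"
proof -
  have "0 < lw \<nu> powr (1 / real CARD('a))" using lw_ge_1[of \<nu>] by simp
  then have "0 < real k" using assms unfolding admissible_def by linarith
  then show ?thesis by simp
qed

lemma admissible_mono: "admissible \<nu> k \<Longrightarrow> k \<le> l \<Longrightarrow> admissible \<nu> l"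
  by (auto simp: admissible_def)

text \<open>The smallest admissible cube around a site has volume of order \<open>lw\<close>, so
  finite \<open>Q\<close> bounds the energy of a single site logarithmically. The factor 5 comes
  from 2 k + 1 \<le> 2 r + 3 \<le> 5 r for r \<ge> 1.\<close>

lemma admissible_small:
  obtains k where "admissible (\<nu> :: ('d::finite) site) k" "(2 * real k + 1) ^ CARD('d) \<le> 5 ^ CARD('d) * lw \<nu>"
proof -
  define r where "r = lw \<nu> powr (1 / real CARD('d))"
  have r: "r \<ge> 1" using lw_ge_1[of \<nu>] by (simp add: r_def ge_one_powr_ge_zero)
  define k where "k = nat \<lfloor>r\<rfloor> + 1"
  have k: "real k > r" "real k \<le> r + 1" using r by (simp_all add: k_def) linarith
  have "2 * real k + 1 \<le> 5 * r" using k r by simp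
  then have "(2 * real k + 1) ^ CARD('d) \<le> (5 * r) ^ CARD('d)" by (intro power_mono) auto
  also have "\<dots> = 5 ^ CARD('d) * r powr real CARD('d)"
    using r by (simp add: power_mult_distrib powr_realpow)
  also have "r powr real CARD('d) = lw \<nu>" using lw_ge_1[of \<nu>] by (simp add: r_def powr_powr)
  finally have "(2 * real k + 1) ^ CARD('d) \<le> 5 ^ CARD('d) * lw \<nu>" .
  moreover have "admissible \<nu> k" using k by (simp add: admissible_def r_def)
  ultimately show thesis using that by blast
qed

lemma sum_pairs_fst_le:
  fixes f :: "('d::finite) site \<Rightarrow> real"
  assumes "finite C" "\<And>i. f i \<ge> 0"
  shows "(\<Sum>i\<in>C. \<Sum>j | j \<in> C \<and> j \<in> neighbours i. f i) \<le> 3 ^ CARD('d) * (\<Sum>i\<in>C. f i)"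
  unfolding sum_distrib_left
proof (rule sum_mono)
  fix i
  have "card {j. j \<in> C \<and> j \<in> neighbours i} \<le> card (neighbours i)"
    by (rule card_mono) auto
  also have "\<dots> \<le> 3 ^ CARD('d)" by (rule card_neighbours_le)
  finally have "real (card {j. j \<in> C \<and> j \<in> neighbours i}) \<le> 3 ^ CARD('d)"
    by (metis of_nat_le_iff of_nat_numeral of_nat_power)
  then show "(\<Sum>j | j \<in> C \<and> j \<in> neighbours i. f i) \<le> 3 ^ CARD('d) * f i"
    using assms by (simp add: mult_right_mono)
qed

lemma sum_pairs_snd_le:
  fixes f :: "('d::finite) site \<Rightarrow> real"
  assumes "finite C" "\<And>i. f i \<ge> 0"
  shows "(\<Sum>i\<in>C. \<Sum>j | j \<in> C \<and> j \<in> neighbours i. f j) \<le> 3 ^ CARD('d) * (\<Sum>i\<in>C. f i)"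
proof -
  have "(\<Sum>i\<in>C. \<Sum>j | j \<in> C \<and> j \<in> neighbours i. f j) = (\<Sum>i\<in>C. \<Sum>j | j \<in> C \<and> j \<in> neighbours i. f i)"
    by (subst sum.swap_restrict[OF assms(1) assms(1)], intro sum.cong refl) (auto simp: neighbours_sym)
  then show ?thesis using sum_pairs_fst_le[OF assms] by simp
qed

section \<open>The energy current and its integration in time\<close>

context anharmonic
begin

text \<open>Expresses Q(x) \<le> M without extended reals or suprema (see
  \<open>Qfun_le_iff\<close>). Each of its inequalities involves finitely many coordinates, so the
  condition is closed under sitewise limits.\<close>

definition Qle :: "('d::finite) state \<Rightarrow> real \<Rightarrow> bool" where
  "Qle x M \<longleftrightarrow> (\<forall>\<nu> k. admissible \<nu> k \<longrightarrow> energy (poly U) K x (cube \<nu> k) \<le> M * (2 * real k + 1) ^ CARD('d))"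

lemma Qle_mono: 
  assumes "Qle x M" "M \<le> N"
  shows "Qle x N"
  unfolding Qle_def
proof (intro allI impI)
  fix \<nu> :: "'a site" and k :: nat assume "admissible \<nu> k"
  then have "energy (poly U) K x (cube \<nu> k) \<le> M * (2 * real k + 1) ^ CARD('a)"
    using assms by (simp add: Qle_def)
  also have "\<dots> \<le> N * (2 * real k + 1) ^ CARD('a)" using assms by (intro mult_right_mono) auto
  finally show "energy (poly U) K x (cube \<nu> k) \<le> N * (2 * real k + 1) ^ CARD('a)" .
qed

lemma energy_ge_card: "real (card C) \<le> energy (poly U) K x C"
proof -
  have "real (card C) = (\<Sum>i\<in>C. 1)" by simp
  also have "\<dots> \<le> (\<Sum>i\<in>C. (snd (x i))\<^sup>2 / 2 + poly U (fst (x i)) + 1)"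
    using U_nonneg by (intro sum_mono) simp
  also have "\<dots> \<le> energy (poly U) K x C" by (rule energy_ge_sum[OF K_pos])
  finally show ?thesis .
qed

text \<open>The summand 1 per site and U \<ge> 0 keep every energy density at least 1, so bounds on
  \<open>Q\<close> are positive and their fourth roots are at least 1.\<close>

lemma Qle_ge_1:
  assumes "Qle (x :: ('d::finite) state) M"
  shows "M \<ge> 1"
proof -
  obtain k where "admissible (undefined :: 'd site) k" by (rule admissible_small)
  then have "energy (poly U) K x (cube undefined k) \<le> M * (2 * real k + 1) ^ CARD('d)"
    using assms by (simp add: Qle_def)
  moreover have "(2 * real k + 1) ^ CARD('d) \<le> energy (poly U) K x (cube undefined k)"
    using energy_ge_card[of "cube undefined k" x] by (simp add: card_cube add.commute)
  ultimately have "1 * (2 * real k + 1) ^ CARD('d) \<le> M * (2 * real k + 1) ^ CARD('d)" by linarith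
  then show ?thesis by (rule mult_right_le_imp_le) simp
qed

text \<open>The scaling behind the exponent 3/4. Momenta are measured in units of \<mu>^2 and
  positions in units of \<mu>; Young's inequality P (R + S) \<le> P^2 + R^4 + S^4 + 1 then contains
  only terms controlled by the energy divided by \<mu>^4. If the energy is at most \<mu>^4 per site,
  the whole sum is of order \<mu>^3 per site.\<close>

lemma current_bound:
  fixes x :: "('d::finite) state"
  assumes "finite C" "\<mu> > 0"
  shows "(\<Sum>i\<in>C. \<Sum>j | j \<in> C \<and> j \<in> neighbours i. \<bar>snd (x i)\<bar> * (\<bar>fst (x i)\<bar> + \<bar>fst (x j)\<bar>))
    \<le> 3 ^ CARD('d) * \<mu> ^ 3 * ((2 + 2 * cU) * energy (poly U) K x C / \<mu> ^ 4 + real (card C))"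
proof -
  define e where "e i = (snd (x i))\<^sup>2 / 2 + poly U (fst (x i)) + 1" for i
  have e: "(snd (x i))\<^sup>2 \<le> 2 * e i" "(fst (x i)) ^ 4 \<le> cU * e i" "0 \<le> e i" for i
  proof -
    show "(snd (x i))\<^sup>2 \<le> 2 * e i" "0 \<le> e i" using U_nonneg[of "fst (x i)"] by (auto simp: e_def)
    have "(fst (x i)) ^ 4 \<le> cU * (poly U (fst (x i)) + 1)" by (rule quartic_le)
    also have "\<dots> \<le> cU * e i" using cU_ge_1 by (intro mult_left_mono) (auto simp: e_def)
    finally show "(fst (x i)) ^ 4 \<le> cU * e i" .
  qed
  \<comment> \<open>The share of the first site in a pair, including its momentum and the constant;
    \<open>h'\<close> is the share of the second site. The double sum thereby splits into sums over
    single sites.\<close>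
  define h where "h i = \<mu> ^ 3 * ((2 + cU) * e i / \<mu> ^ 4 + 1)" for i
  define h' where "h' i = \<mu> ^ 3 * (cU * e i / \<mu> ^ 4)" for i
  have hh: "h i \<ge> 0" "h' i \<ge> 0" for i using assms e(3)[of i] cU_ge_1 by (auto simp: h_def h'_def)
  have young: "P * (R + S) \<le> P\<^sup>2 + R ^ 4 + S ^ 4 + 1" if "P \<ge> 0" "R \<ge> 0" "S \<ge> 0" for P R S :: real
  proof -
    have a: "P * R \<le> (P\<^sup>2 + R\<^sup>2) / 2" for P R :: real using sum_squares_bound[of P R] by simp
    have "R\<^sup>2 \<le> (R ^ 4 + 1) / 2" for R :: real using a[of "R\<^sup>2" 1] by (simp flip: power_mult)
    from this[of R] this[of S] a[of P R] a[of P S] show ?thesis 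
      using zero_le_power2[of P] zero_le_power[OF that(2), of 4] zero_le_power[OF that(3), of 4]
      unfolding distrib_left by argo
  qed
  have pt: "\<bar>snd (x i)\<bar> * (\<bar>fst (x i)\<bar> + \<bar>fst (x j)\<bar>) \<le> h i + h' j" for i j
  proof -
    have "\<bar>snd (x i)\<bar> * (\<bar>fst (x i)\<bar> + \<bar>fst (x j)\<bar>) 
        = \<mu> ^ 3 * (\<bar>snd (x i)\<bar> / \<mu>\<^sup>2 * (\<bar>fst (x i)\<bar> / \<mu> + \<bar>fst (x j)\<bar> / \<mu>))"
      using assms by (simp add: field_simps power2_eq_square power3_eq_cube)
    also have "\<dots> \<le> \<mu> ^ 3 * ((\<bar>snd (x i)\<bar> / \<mu>\<^sup>2)\<^sup>2 + (\<bar>fst (x i)\<bar> / \<mu>) ^ 4 + (\<bar>fst (x j)\<bar> / \<mu>) ^ 4 + 1)"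
      using assms by (intro mult_left_mono young) auto
    also have "\<dots> = \<mu> ^ 3 * (((snd (x i))\<^sup>2 + fst (x i) ^ 4 + fst (x j) ^ 4) / \<mu> ^ 4 + 1)"
      by (simp add: power_divide add_divide_distrib flip: power_mult)
    also have "\<dots> \<le> \<mu> ^ 3 * ((2 * e i + cU * e i + cU * e j) / \<mu> ^ 4 + 1)"
      using assms e(1)[of i] e(2)[of i] e(2)[of j] by (intro mult_left_mono add_mono divide_right_mono) auto
    also have "\<dots> = h i + h' j" by (simp add: h_def h'_def add_divide_distrib algebra_simps)
    finally show ?thesis .
  qed
  have "(\<Sum>i\<in>C. \<Sum>j | j \<in> C \<and> j \<in> neighbours i. \<bar>snd (x i)\<bar> * (\<bar>fst (x i)\<bar> + \<bar>fst (x j)\<bar>))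
      \<le> (\<Sum>i\<in>C. \<Sum>j | j \<in> C \<and> j \<in> neighbours i. h i + h' j)"
    by (intro sum_mono pt)
  also have "\<dots> \<le> 3 ^ CARD('d) * (\<Sum>i\<in>C. h i) + 3 ^ CARD('d) * (\<Sum>i\<in>C. h' i)"
    unfolding sum.distrib by (intro add_mono sum_pairs_fst_le sum_pairs_snd_le assms hh)
  also have "\<dots> = 3 ^ CARD('d) * (\<Sum>i\<in>C. h i + h' i)" by (simp add: sum.distrib distrib_left)
  also have "(\<Sum>i\<in>C. h i + h' i) = (\<Sum>i\<in>C. \<mu> ^ 3 * ((2 + 2 * cU) / \<mu> ^ 4 * e i + 1))"
    by (intro sum.cong refl) (simp add: h_def h'_def add_divide_distrib algebra_simps)
  also have "\<dots> = \<mu> ^ 3 * ((2 + 2 * cU) / \<mu> ^ 4 * (\<Sum>i\<in>C. e i) + real (card C))"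
    unfolding sum_distrib_left[symmetric] sum.distrib by simp
  also have "3 ^ CARD('d) * \<dots> \<le> 3 ^ CARD('d) * (\<mu> ^ 3 * ((2 + 2 * cU) / \<mu> ^ 4 * energy (poly U) K x C + real (card C)))"
    using energy_ge_sum[OF K_pos, of x "poly U" C] assms cU_ge_1
    by (intro mult_left_mono add_mono) (auto simp: e_def)
  finally show ?thesis by (simp add: mult.assoc)
qed

lemma apriori_step:
  fixes y :: "real \<Rightarrow> ('d::finite) state"
  assumes y: "motion U' K A y" and t: "t \<in> {a..b}" "s \<in> {a..b}"
    and M0: "Qle (y s) M0" and M: "\<And>r. r \<in> {a..b} \<Longrightarrow> Qle (y r) (\<mu> ^ 4)" and mu: "\<mu> > 0"
  shows "Qle (y t) (2 ^ CARD('d) * M0 + K * 6 ^ CARD('d) * (3 + 2 * cU) * \<mu> ^ 3 * \<bar>t - s\<bar>)"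
  unfolding Qle_def
proof (intro allI impI)
  fix \<nu> :: "'d site" and k :: nat assume adm: "admissible \<nu> k"
  let ?d = "CARD('d)"
  have k1: "k \<ge> 1" using adm by (rule admissible_pos)
  have adm2: "admissible \<nu> (2 * k)" using adm by (rule admissible_mono) simp
  let ?E = "\<lambda>r m. energy (poly U) K (y r) (cube \<nu> m)"
  \<comment> \<open>The average over the cubes k \<le> m < 2 k lies between the energies of the
    cubes k and 2 k, because the energy is monotone in the cube.\<close>
  define w where "w r = (\<Sum>m\<in>{k..<2*k}. ?E r m) / real k" for r
  define w' where "w' r = (\<Sum>m\<in>{k..<2*k}. flux K A (y r) (cube \<nu> m)) / real k" for r
  define D where "D = K * (3 ^ ?d * \<mu> ^ 3 * ((3 + 2 * cU) * (2 * real (2*k) + 1) ^ ?d))"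
  have dw: "(w has_real_derivative w' r) (at r)" for r
    unfolding w_def w'_def by (intro DERIV_cdivide DERIV_sum energy_has_derivative_flux[OF y U_derivative]) simp
  have w'_le: "\<bar>w' r\<bar> \<le> D" if r: "r \<in> {a..b}" for r
  proof -
    have Ele: "?E r (2*k) \<le> \<mu> ^ 4 * (2 * real (2*k) + 1) ^ ?d"
      using M[OF r] adm2 unfolding Qle_def by blast
    have "\<bar>w' r\<bar> \<le> (\<Sum>m\<in>{k..<2*k}. \<bar>flux K A (y r) (cube \<nu> m)\<bar>) / real k"
      unfolding w'_def abs_divide abs_of_nat by (intro divide_right_mono sum_abs) auto
    \<comment> \<open>The factor 1 / k is given away: a bound by the volume of the doubled cube is
      enough.\<close>
    also have "\<dots> \<le> (\<Sum>m\<in>{k..<2*k}. \<bar>flux K A (y r) (cube \<nu> m)\<bar>) / 1"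
      using k1 by (intro divide_left_mono) (auto intro!: sum_nonneg)
    also have "\<dots> \<le> K * (\<Sum>i\<in>cube \<nu> (2*k). \<Sum>j | j \<in> cube \<nu> (2*k) \<and> j \<in> neighbours i.
         \<bar>snd (y r i)\<bar> * (\<bar>fst (y r i)\<bar> + \<bar>fst (y r j)\<bar>))"
      using sum_flux_bound[OF K_pos] by simp
    also have "\<dots> \<le> K * (3 ^ ?d * \<mu> ^ 3 * ((2 + 2 * cU) * ?E r (2*k) / \<mu> ^ 4 + real (card (cube \<nu> (2*k)))))"
      using K_pos by (intro mult_left_mono current_bound mu) auto
    also have "(2 + 2 * cU) * ?E r (2*k) / \<mu> ^ 4 \<le> (2 + 2 * cU) * (\<mu> ^ 4 * (2 * real (2*k) + 1) ^ ?d) / \<mu> ^ 4"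
      using mu Ele cU_ge_1 by (intro divide_right_mono mult_left_mono) auto
    also have "\<dots> = (2 + 2 * cU) * (2 * real (2*k) + 1) ^ ?d" using mu by simp
    also have "\<dots> + real (card (cube \<nu> (2*k))) = (3 + 2 * cU) * (2 * real (2*k) + 1) ^ ?d"
      by (simp add: card_cube algebra_simps)
    finally show ?thesis using K_pos mu by (simp add: D_def)
  qed
  have mvt: "\<bar>w t - w s\<bar> \<le> D * \<bar>t - s\<bar>"
    using field_differentiable_bound[OF convex_real_interval(5), of a b w w' D t s] dw w'_le t
    by (auto intro: has_field_derivative_at_within)
  have lower: "?E r k \<le> w r" for r
  proof -
    have "real k * ?E r k = (\<Sum>m\<in>{k..<2*k}. ?E r k)" by simp
    also have "\<dots> \<le> (\<Sum>m\<in>{k..<2*k}. ?E r m)"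
      by (intro sum_mono energy_mono K_pos U_nonneg cube_mono) auto
    finally show ?thesis using k1 by (simp add: w_def field_simps)
  qed
  have upper: "w r \<le> ?E r (2*k)" for r
  proof -
    have "(\<Sum>m\<in>{k..<2*k}. ?E r m) \<le> (\<Sum>m\<in>{k..<2*k}. ?E r (2*k))"
      by (intro sum_mono energy_mono K_pos U_nonneg cube_mono) auto
    then show ?thesis using k1 by (simp add: w_def field_simps)
  qed
  \<comment> \<open>Doubling the cube costs 2^d; with 3^d from the neighbour count this makes the
    6^d of the statement.\<close>
  have double: "(2 * real (2*k) + 1) ^ ?d \<le> 2 ^ ?d * (2 * real k + 1) ^ ?d"
    unfolding power_mult_distrib[symmetric] by (intro power_mono) auto
  have M01: "M0 \<ge> 1" using Qle_ge_1[OF M0] .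
  have "?E t k \<le> w s + D * \<bar>t - s\<bar>" using lower[of t] mvt by linarith
  also have "w s \<le> M0 * (2 * real (2*k) + 1) ^ ?d"
    using upper[of s] M0 adm2 unfolding Qle_def by (meson order_trans)
  also have "\<dots> \<le> M0 * (2 ^ ?d * (2 * real k + 1) ^ ?d)" using double M01 by (intro mult_left_mono) auto
  also have "D \<le> K * (3 ^ ?d * \<mu> ^ 3 * ((3 + 2 * cU) * (2 ^ ?d * (2 * real k + 1) ^ ?d)))"
    unfolding D_def using double K_pos mu cU_ge_1 by (intro mult_left_mono) auto
  also have "\<dots> = K * 6 ^ ?d * (3 + 2 * cU) * \<mu> ^ 3 * (2 * real k + 1) ^ ?d"
  proof -
    have "(6::real) ^ ?d = 3 ^ ?d * 2 ^ ?d" by (simp flip: power_mult_distrib)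
    then show ?thesis by simp
  qed
  finally show "?E t k \<le> (2 ^ ?d * M0 + K * 6 ^ ?d * (3 + 2 * cU) * \<mu> ^ 3 * \<bar>t - s\<bar>) * (2 * real k + 1) ^ ?d"
    by (simp add: algebra_simps mult_right_mono)
qed

text \<open>The finite bound M ensures that a best uniform bound m^4 over the interval exists.
  Comparing m^4 with the outcome of one application of \<open>apriori_step\<close> eliminates M, and
  the constant depends neither on A nor on M.\<close>

lemma apriori_bound:
  obtains C where "C > 0"
    "\<And>A (y :: real \<Rightarrow> ('d::finite) state) t s M0 M. motion U' K A y \<Longrightarrow> Qle (y s) M0 \<Longrightarrow>
       (\<And>r. r \<in> {min s t..max s t} \<Longrightarrow> Qle (y r) M) \<Longrightarrow> Qle (y t) (C * (M0 + (t - s) ^ 4))"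
proof -
  define c where "c = K * 6 ^ CARD('d) * (3 + 2 * cU)"
  have c: "c > 0" using K_pos cU_ge_1 by (simp add: c_def)
  define C where "C = 2 * 2 ^ CARD('d) + (2 * c) ^ 4"
  show thesis
  proof (rule that[of C])
    show "C > 0" using c by (simp add: C_def add_pos_pos)
    fix A and y :: "real \<Rightarrow> 'd state" and t s M0 M
    assume y: "motion U' K A y" and M0: "Qle (y s) M0"
      and M: "\<And>r. r \<in> {min s t..max s t} \<Longrightarrow> Qle (y r) M"
    define I where "I = {min s t..max s t}"
    have st: "s \<in> I" "t \<in> I" by (auto simp: I_def)
    have M01: "M0 \<ge> 1" "M \<ge> 1" using Qle_ge_1[OF M0] Qle_ge_1[OF M[of s]] by auto
    \<comment> \<open>Fourth roots of uniform bounds on the interval. The infimum is itself such a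
      root, since every cube contributes a closed condition.\<close>
    define S where "S = {\<mu>. \<mu> \<ge> 1 \<and> (\<forall>r\<in>I. Qle (y r) (\<mu> ^ 4))}"
    define m where "m = Inf S"
    have "root 4 M \<in> S" unfolding S_def
      using M M01 by (auto simp: I_def real_root_pow_pos2)
    then have ne: "S \<noteq> {}" by blast
    have bdd: "bdd_below S" by (rule bdd_belowI[of _ 1]) (auto simp: S_def)
    have m1: "m \<ge> 1" unfolding m_def by (rule cInf_greatest[OF ne]) (auto simp: S_def)
    have mS: "Qle (y r) (m ^ 4)" if r: "r \<in> I" for r
      unfolding Qle_def
    proof (intro allI impI)
      fix \<nu> :: "'d site" and k :: nat assume adm: "admissible \<nu> k"
      let ?E = "energy (poly U) K (y r) (cube \<nu> k)" and ?B = "(2 * real k + 1) ^ CARD('d)"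
      have "root 4 (?E / ?B) \<le> \<mu>" if "\<mu> \<in> S" for \<mu>
      proof -
        have "?E \<le> \<mu> ^ 4 * ?B" using that r adm by (auto simp: S_def Qle_def)
        then have "?E / ?B \<le> \<mu> ^ 4" by (simp add: pos_divide_le_eq)
        then have "root 4 (?E / ?B) \<le> root 4 (\<mu> ^ 4)" by simp
        also have "\<dots> = \<mu>" using that by (simp add: S_def real_root_power_cancel)
        finally show ?thesis .
      qed
      then have "root 4 (?E / ?B) \<le> m" unfolding m_def by (intro cInf_greatest[OF ne])
      moreover have "0 \<le> ?E / ?B" using energy_ge_card[of "cube \<nu> k" "y r"] by simp
      ultimately have "?E / ?B \<le> m ^ 4"
        by (metis power_mono real_root_ge_zero real_root_pow_pos2 zero_less_numeral)
      then show "?E \<le> m ^ 4 * ?B" by (simp add: pos_divide_le_eq)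
    qed
    define R where "R = 2 ^ CARD('d) * M0 + c * m ^ 3 * \<bar>t - s\<bar>"
    have Rle: "Qle (y r) R" if r: "r \<in> I" for r
    proof (rule Qle_mono)
      show "Qle (y r) (2 ^ CARD('d) * M0 + K * 6 ^ CARD('d) * (3 + 2 * cU) * m ^ 3 * \<bar>r - s\<bar>)"
        by (rule apriori_step[OF y r[unfolded I_def] st(1)[unfolded I_def] M0]) (use mS m1 in \<open>auto simp: I_def\<close>)
      have "\<bar>r - s\<bar> \<le> \<bar>t - s\<bar>" using r by (auto simp: I_def)
      then show "2 ^ CARD('d) * M0 + K * 6 ^ CARD('d) * (3 + 2 * cU) * m ^ 3 * \<bar>r - s\<bar> \<le> R"
        unfolding R_def c_def[symmetric] using c m1 by (intro add_left_mono mult_left_mono) auto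
    qed
    have R1: "R \<ge> 1" using Qle_ge_1[OF Rle[OF st(1)]] .
    then have "root 4 R \<in> S" unfolding S_def using Rle by (simp add: real_root_pow_pos2)
    then have "m \<le> root 4 R" unfolding m_def by (rule cInf_lower[OF _ bdd])
    then have "m ^ 4 \<le> root 4 R ^ 4" using m1 by (intro power_mono) auto
    also have "\<dots> = R" using R1 by (simp add: real_root_pow_pos2)
    finally have mR: "m ^ 4 \<le> R" .
    have tn: "0 \<le> (t - s) ^ 4" by simp
    have "m ^ 4 \<le> C * (M0 + (t - s) ^ 4)"
    \<comment> \<open>Either the flux term is at most half of m^4 and is absorbed, or m is smaller
      than 2 c |t - s|; the two summands of \<open>C\<close> belong to these cases.\<close>
    proof (cases "2 * c * \<bar>t - s\<bar> \<le> m")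
      case True
      then have "m ^ 3 * (2 * c * \<bar>t - s\<bar>) \<le> m ^ 3 * m" using m1 by (intro mult_left_mono) auto
      then have "2 * (c * m ^ 3 * \<bar>t - s\<bar>) \<le> m ^ 4" by (simp add: power4_eq_xxxx power3_eq_cube mult_ac)
      then have "m ^ 4 \<le> 2 * 2 ^ CARD('d) * M0" using mR by (simp add: R_def)
      also have "\<dots> \<le> C * M0" using M01 by (intro mult_right_mono) (auto simp: C_def)
      also have "\<dots> \<le> C * (M0 + (t - s) ^ 4)" using tn \<open>C > 0\<close> by (intro mult_left_mono) auto
      finally show ?thesis .
    next
      case False
      then have "m ^ 4 \<le> (2 * c * \<bar>t - s\<bar>) ^ 4" using m1 by (intro power_mono) auto
      also have "\<dots> = (2 * c) ^ 4 * (t - s) ^ 4" by (simp add: power_mult_distrib)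
      also have "\<dots> \<le> C * (t - s) ^ 4" by (intro mult_right_mono) (auto simp: C_def)
      also have "\<dots> \<le> C * (M0 + (t - s) ^ 4)" using M01 \<open>C > 0\<close> by (intro mult_left_mono) auto
      finally show ?thesis .
    qed
    then show "Qle (y t) (C * (M0 + (t - s) ^ 4))" using mS[OF st(2)] Qle_mono by blast
  qed
qed

end

subsection \<open>Dynamics in a finite cube\<close>

lemma norm_real_pair_le: "norm (a :: real, b :: real) \<le> \<bar>a\<bar> + \<bar>b\<bar>"
  using norm_Pair_le[of a b] by simp

lemma abs_le_norm_pair: "\<bar>fst z\<bar> \<le> norm (z :: real \<times> real)" "\<bar>snd z\<bar> \<le> norm z"
  using norm_fst_le[of "fst z" "snd z"] norm_snd_le[of "snd z" "fst z"] by simp_all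

lemma harmonic_force_diff:
  fixes x z :: "('d::finite) state"
  assumes "\<And>k. k \<in> insert i (neighbours i) \<Longrightarrow> norm (x k - z k) \<le> D"
  shows "\<bar>(\<Sum>j\<in>neighbours i. fst (x i) - fst (x j)) - (\<Sum>j\<in>neighbours i. fst (z i) - fst (z j))\<bar>
    \<le> 2 * 3 ^ CARD('d) * D"
proof -
  have q: "\<bar>fst (x k) - fst (z k)\<bar> \<le> D" if "k \<in> insert i (neighbours i)" for k
    using assms[OF that] abs_le_norm_pair(1)[of "x k - z k"] by simp
  have D: "D \<ge> 0" using q[of i] by simp
  have "\<bar>(\<Sum>j\<in>neighbours i. fst (x i) - fst (x j)) - (\<Sum>j\<in>neighbours i. fst (z i) - fst (z j))\<bar>
    = \<bar>\<Sum>j\<in>neighbours i. (fst (x i) - fst (z i)) - (fst (x j) - fst (z j))\<bar>"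
    unfolding sum_subtractf[symmetric] by (intro arg_cong[of _ _ abs] sum.cong) auto
  also have "\<dots> \<le> (\<Sum>j\<in>neighbours i. 2 * D)"
  proof (intro order_trans[OF sum_abs] sum_mono)
    fix j assume "j \<in> neighbours i"
    then show "\<bar>(fst (x i) - fst (z i)) - (fst (x j) - fst (z j))\<bar> \<le> 2 * D" using q[of i] q[of j] by simp
  qed
  also have "\<dots> = real (card (neighbours i)) * (2 * D)" by simp
  also have "\<dots> \<le> real (3 ^ CARD('d)) * (2 * D)"
    using card_neighbours_le[of i] D by (intro mult_right_mono of_nat_mono) auto
  finally show ?thesis by simp
qed

section \<open>Global solutions with finitely many moving particles\<close>

context anharmonic
begin

lemma site_energy_le:
  assumes "finite C" "i \<in> C" "\<And>q. V q \<ge> 0"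
  shows "V (fst (x i)) + 1 \<le> energy V K x C"
proof -
  have "(snd (x i))\<^sup>2 / 2 + V (fst (x i)) + 1 \<le> (\<Sum>i\<in>C. (snd (x i))\<^sup>2 / 2 + V (fst (x i)) + 1)"
    using assms by (intro member_le_sum) (auto intro!: add_nonneg_nonneg)
  also have "\<dots> \<le> energy V K x C" by (rule energy_ge_sum[OF K_pos])
  finally show ?thesis using zero_le_power2[of "snd (x i)"] by linarith
qed

text \<open>Evaluating U' at the clamped position makes the force globally Lipschitz. Its potential
  is U inside and continues linearly outside; by the sign of U' it never drops below its value at
  the nearer end point, so the cut-off opens no escape route at low energy.\<close>

lemma cutoff_potential:
  assumes R: "R \<ge> 1" "\<And>q. q \<ge> R \<Longrightarrow> U' q \<ge> 0" "\<And>q. q \<le> - R \<Longrightarrow> U' q \<le> 0"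
  obtains V where "\<And>q. (V has_real_derivative U' (max (- R) (min R q))) (at q)"
    "\<And>q. \<bar>q\<bar> \<le> R \<Longrightarrow> V q = poly U q" "\<And>q. q \<ge> R \<Longrightarrow> V q \<ge> poly U R" "\<And>q. q \<le> - R \<Longrightarrow> V q \<ge> poly U (- R)"
proof -
  have "continuous_on UNIV (\<lambda>q. U' (max (- R) (min R q)))" by (intro continuous_intros)
  from antiderivative_exists[OF this] obtain G
    where G: "G 0 = 0" "\<And>q. (G has_real_derivative U' (max (- R) (min R q))) (at q)"
    by (auto simp: has_real_derivative_iff_has_vector_derivative)
  define V where "V q = G q + poly U 0" for q
  have dV: "(V has_real_derivative U' (max (- R) (min R q))) (at q)" for q
    unfolding V_def using G(2) by (auto intro!: derivative_eq_intros)
  have "\<exists>c. \<forall>q\<in>{-R..R}. V q - poly U q = c"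
  proof (rule has_field_derivative_zero_constant)
    fix q assume q: "q \<in> {-R..R}"
    have "((\<lambda>q. V q - poly U q) has_real_derivative U' (max (- R) (min R q)) - U' q) (at q)"
      by (intro DERIV_diff dV U_derivative)
    moreover have "max (- R) (min R q) = q" using q by auto
    ultimately show "((\<lambda>q. V q - poly U q) has_real_derivative 0) (at q within {-R..R})"
      by (auto intro: has_field_derivative_at_within)
  qed simp
  then obtain c where c: "\<forall>q\<in>{-R..R}. V q - poly U q = c" by blast
  have "V 0 - poly U 0 = 0" by (simp add: V_def G)
  then have eq: "V q = poly U q" if "\<bar>q\<bar> \<le> R" for q
    using c[rule_format, of q] c[rule_format, of 0] R(1) that by (auto simp: abs_le_iff)
  have up: "V q \<ge> poly U R" if "q \<ge> R" for q
  proof -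
    have "V R \<le> V q"
    proof (rule DERIV_nonneg_imp_nondecreasing[OF that])
      fix z assume "R \<le> z"
      then have "U' (max (- R) (min R z)) \<ge> 0" using R by (simp add: min_def max_def)
      then show "\<exists>y. (V has_real_derivative y) (at z) \<and> 0 \<le> y" using dV by blast
    qed
    then show ?thesis using eq[of R] R(1) by simp
  qed
  have down: "V q \<ge> poly U (- R)" if "q \<le> - R" for q
  proof -
    have "V (- R) \<le> V q"
    proof (rule DERIV_nonpos_imp_nonincreasing[OF that])
      fix z assume "z \<le> - R"
      then have "U' (max (- R) (min R z)) \<le> 0" using R by (simp add: min_def max_def)
      then show "\<exists>y. (V has_real_derivative y) (at z) \<and> y \<le> 0" using dV by blast
    qed
    then show ?thesis using eq[of "- R"] R(1) by simp
  qed
  show thesis using dV eq up down by (rule that)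
qed

text \<open>Picard's theorem solves the system with cut-off force for all times. Its conserved
  energy, evaluated on the cube enlarged by one layer, shows that no moving particle ever reaches
  the cut-off, so the original system is solved too.\<close>

lemma finite_dynamics_exists:
  fixes x :: "('d::finite) state"
  obtains y where "motion U' K (cube (\<lambda>_. 0) n) y" "y 0 = x"
proof -
  let ?d = "CARD('d)"
  define A C :: "'d site set" where "A = cube (\<lambda>_. 0) n" and "C = cube (\<lambda>_. 0) (Suc n)"
  have fin: "finite A" "finite C" and AC: "A \<subseteq> C" 
    using cube_mono[of n "Suc n" "\<lambda>_::'d. 0"] by (simp_all add: A_def C_def)
  define E where "E = energy (poly U) K x C"
  have E0: "E \<ge> 0" using energy_ge_card[of C x] by (simp add: E_def)
  obtain R0 where R0: "R0 \<ge> 1" "\<forall>q. (q \<ge> R0 \<longrightarrow> U' q \<ge> 0) \<and> (q \<le> - R0 \<longrightarrow> U' q \<le> 0)"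
    using U'_outward by blast
  \<comment> \<open>The first summand places R where the sign of U' is known; the second makes U
    exceed E beyond R, because R \<le> R^4 \<le> \<open>cU\<close> (U(q) + 1) for |q| \<ge>
    R.\<close>
  define R where "R = R0 + cU * (E + 1)"
  have R: "R \<ge> R0" "R \<ge> 1" "R > cU * (E + 1)"
    using E0 cU_ge_1 R0(1) by (simp_all add: R_def add_increasing2)
  have beyond: "poly U q > E" if "\<bar>q\<bar> \<ge> R" for q
  proof -
    have "cU * (E + 1) < R" by (rule R)
    also have "R \<le> R ^ 4" using R(2) self_le_power[of R 4] by simp
    also have "R ^ 4 \<le> \<bar>q\<bar> ^ 4" using that R(2) by (intro power_mono) auto
    also have "\<dots> \<le> cU * (poly U q + 1)" using quartic_le[of q] by simp
    finally show ?thesis using cU_ge_1 by simp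
  qed
  define g where "g q = U' (max (- R) (min R q))" for q
  obtain V where V: "\<And>q. (V has_real_derivative g q) (at q)"
    "\<And>q. \<bar>q\<bar> \<le> R \<Longrightarrow> V q = poly U q" "\<And>q. q \<ge> R \<Longrightarrow> V q \<ge> poly U R" "\<And>q. q \<le> - R \<Longrightarrow> V q \<ge> poly U (- R)"
  proof (rule cutoff_potential[of R])
    show "U' q \<ge> 0" if "q \<ge> R" for q using R0(2) R(1) that by force
    show "U' q \<le> 0" if "q \<le> - R" for q using R0(2) R(1) that by force
  qed (use R g_def in auto)
  have V_far: "V q > E" if "\<bar>q\<bar> \<ge> R" for q
    using V(3,4)[of q] beyond[of R] beyond[of "- R"] R(2) that by linarith
  have V0: "V q \<ge> 0" for q
    using V(2)[of q] V_far[of q] U_nonneg[of q] E0 by (cases "\<bar>q\<bar> \<le> R") auto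
  have clamp: "\<bar>max (- R) (min R q) - max (- R) (min R r)\<bar> \<le> \<bar>q - r\<bar>" "(max (- R) (min R q))\<^sup>2 \<le> R\<^sup>2" for q r
  proof -
    show "\<bar>max (- R) (min R q) - max (- R) (min R r)\<bar> \<le> \<bar>q - r\<bar>" by (auto simp: max_def min_def)
    show "(max (- R) (min R q))\<^sup>2 \<le> R\<^sup>2" using R(2) by (intro power2_le_iff_abs_le[THEN iffD2]) (auto simp: max_def min_def)
  qed
  define Lg where "Lg = cU' * (1 + R\<^sup>2 + R\<^sup>2)"
  have Lg0: "Lg \<ge> 0" using cU'_nonneg by (simp add: Lg_def)
  have g_lip: "\<bar>g q - g r\<bar> \<le> Lg * \<bar>q - r\<bar>" for q r
  proof -
    have "\<bar>g q - g r\<bar> \<le> cU' * (1 + (max (- R) (min R r))\<^sup>2 + (max (- R) (min R q))\<^sup>2) * \<bar>max (- R) (min R q) - max (- R) (min R r)\<bar>"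
      unfolding g_def by (rule U'_lipschitz)
    also have "\<dots> \<le> Lg * \<bar>q - r\<bar>"
      unfolding Lg_def using cU'_nonneg by (intro mult_mono mult_left_mono add_mono clamp order_refl) (auto intro!: mult_nonneg_nonneg add_nonneg_nonneg)
    finally show ?thesis .
  qed
  define L where "L = 1 + Lg + K * (2 * 3 ^ ?d)"
  have L0: "L \<ge> 0" using Lg0 K_pos by (simp add: L_def)
  obtain y where y: "y 0 = x" "\<And>t i. ((\<lambda>s. y s i) has_vector_derivative velocity g K A (y t) i) (at t)"
  \<comment> \<open>Frozen sites have velocity 0, so the finite sum over A bounds the velocity at
    every site.\<close>
  proof (rule picard_lindelof_product[of L "velocity g K A" x "\<Sum>i\<in>A. norm (velocity g K A x i)"])
    show "L \<ge> 0" by (rule L0)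
    show "norm (velocity g K A z i - velocity g K A w i) \<le> L * D" 
      if D: "\<And>j. norm (z j - w j) \<le> D" for z w :: "'d state" and i D
    proof (cases "i \<in> A")
      case True
      let ?S = "\<lambda>z. \<Sum>j\<in>neighbours i. fst (z i) - fst (z j)"
      have qp: "\<bar>fst (z i) - fst (w i)\<bar> \<le> D" "\<bar>snd (z i) - snd (w i)\<bar> \<le> D"
        using D[of i] abs_le_norm_pair[of "z i - w i"] by auto
      have "norm (velocity g K A z i - velocity g K A w i) \<le> 
         \<bar>snd (z i) - snd (w i)\<bar> + \<bar>- (g (fst (z i)) - g (fst (w i))) - K * (?S z - ?S w)\<bar>"
        using True norm_real_pair_le[of "snd (z i) - snd (w i)" "- (g (fst (z i)) - g (fst (w i))) - K * (?S z - ?S w)"]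
        by (simp add: velocity_def algebra_simps)
      also have "\<bar>- (g (fst (z i)) - g (fst (w i))) - K * (?S z - ?S w)\<bar> 
          \<le> \<bar>g (fst (z i)) - g (fst (w i))\<bar> + K * \<bar>?S z - ?S w\<bar>"
        using K_pos abs_triangle_ineq4[of "- (g (fst (z i)) - g (fst (w i)))" "K * (?S z - ?S w)"]
        by (simp add: abs_mult abs_minus_commute)
      also have "\<bar>g (fst (z i)) - g (fst (w i))\<bar> \<le> Lg * D"
        using g_lip mult_left_mono[OF qp(1) Lg0] order_trans by blast
      also have "\<bar>?S z - ?S w\<bar> \<le> 2 * 3 ^ ?d * D" by (rule harmonic_force_diff) (rule D)
      finally show ?thesis using qp K_pos by (simp add: L_def algebra_simps)
    next
      case False
      have "0 \<le> D" using D norm_ge_zero order_trans by blast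
      then show ?thesis using False L0 by (simp add: velocity_def)
    qed
    show "continuous_on UNIV (\<lambda>t. velocity g K A (z t) i)" 
      if z: "\<And>j. continuous_on UNIV (\<lambda>t. z t j)" for z :: "real \<Rightarrow> 'd state" and i
      by (cases "i \<in> A") (auto simp: velocity_def g_def intro!: continuous_intros z)
    show "norm (velocity g K A x i) \<le> (\<Sum>i\<in>A. norm (velocity g K A x i))" for i
    proof (cases "i \<in> A")
      case True
      then show ?thesis using fin by (intro member_le_sum) auto
    next
      case False
      then have "velocity g K A x i = 0" by (simp add: velocity_def zero_prod_def)
      then show ?thesis by (simp add: sum_nonneg)
    qed
  qed blast
  have ym: "motion g K A y" using y(2) by (simp add: motion_def)
  \<comment> \<open>Moving sites have all their neighbours in C, so bonds leaving C start at frozen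
    sites and carry no energy.\<close>
  have flux0: "flux K A z C = 0" for z :: "'d state"
  proof -
    have "i \<notin> A" if "i \<in> C" "j \<in> neighbours i - C" for i j
      using that cube_neighbour_Suc[of i "\<lambda>_. 0" n j] by (auto simp: A_def C_def)
    then show ?thesis by (simp add: flux_def sum.neutral)
  qed
  have "\<exists>c. \<forall>t\<in>UNIV. energy V K (y t) C = c"
  proof (rule has_field_derivative_zero_constant)
    show "((\<lambda>t. energy V K (y t) C) has_real_derivative 0) (at t within UNIV)" for t
      using energy_has_derivative_flux[OF ym V(1) fin(2), of t] by (simp add: flux0)
  qed simp
  then obtain c where c: "\<And>t. energy V K (y t) C = c" by auto
  have Vx: "V (fst (x i)) = poly U (fst (x i))" if "i \<in> C" for i
  proof -
    have "poly U (fst (x i)) + 1 \<le> E" unfolding E_def by (rule site_energy_le[OF fin(2) that U_nonneg])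
    then have "\<bar>fst (x i)\<bar> \<le> R" using beyond[of "fst (x i)"] by linarith
    then show ?thesis by (rule V(2))
  qed
  have "energy V K (y 0) C = E" unfolding E_def y(1) by (simp add: energy_def Vx)
  then have cE: "c = E" using c by simp
  have inside: "\<bar>fst (y t i)\<bar> < R" if "i \<in> A" for t i
  proof -
    have "V (fst (y t i)) + 1 \<le> energy V K (y t) C"
      using that AC by (intro site_energy_le fin V0) auto
    then have "V (fst (y t i)) \<le> E" using c cE by simp
    then show ?thesis using V_far[of "fst (y t i)"] by linarith
  qed
  \<comment> \<open>The clamp is inactive at moving sites, and at frozen sites both velocities
    vanish.\<close>
  have "velocity g K A (y t) i = velocity U' K A (y t) i" for t i
    using inside[of i t] by (auto simp: velocity_def g_def max_def min_def)
  then have "motion U' K A y" using ym by (simp add: motion_def)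
  then show thesis using that y(1) by (simp add: A_def)
qed

text \<open>Supplies the finiteness required by the a priori estimate. The flux through any cube is
  at most \<Psi>, the total over the finitely many moving sites, and \<Psi> is continuous in time;
  the bound depends on A and on the solution.\<close>

lemma finite_dynamics_Qle:
  fixes y :: "real \<Rightarrow> ('d::finite) state"
  assumes y: "motion U' K A y" and A: "finite A" and M0: "Qle (y 0) M0"
  shows "\<exists>M. \<forall>t\<in>{-T..T}. Qle (y t) M"
proof -
  define \<Psi> where "\<Psi> t = K * (\<Sum>i\<in>A. \<Sum>j\<in>neighbours i. \<bar>snd (y t i) * (fst (y t i) - fst (y t j))\<bar>)" for t
  have "continuous_on {-T..T} \<Psi>" unfolding \<Psi>_def
    by (intro continuous_intros continuous_on_subset[OF motion_continuous[OF y]]) auto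
  then have "bounded (\<Psi> ` {-T..T})" by (intro compact_imp_bounded compact_continuous_image) auto
  then obtain B where B: "B > 0" "\<And>t. t \<in> {-T..T} \<Longrightarrow> \<bar>\<Psi> t\<bar> \<le> B"
    by (auto simp: bounded_pos)
  have "Qle (y t) (M0 + B * \<bar>T\<bar>)" if t: "t \<in> {-T..T}" for t
    unfolding Qle_def
  proof (intro allI impI)
    fix \<nu> :: "'d site" and k :: nat assume adm: "admissible \<nu> k"
    let ?C = "cube \<nu> k"
    have flux_le: "\<bar>flux K A (y s) ?C\<bar> \<le> B" if s: "s \<in> {-T..T}" for s
    proof -
      let ?h = "\<lambda>i j. \<bar>snd (y s i) * (fst (y s i) - fst (y s j))\<bar>"
      have "\<bar>flux K A (y s) ?C\<bar> = K * \<bar>\<Sum>i\<in>?C. \<Sum>j\<in>neighbours i - ?C. (if i \<in> A then snd (y s i) else 0) * (fst (y s i) - fst (y s j))\<bar>"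
        using K_pos by (simp add: flux_def abs_mult)
      also have "\<dots> \<le> K * (\<Sum>i\<in>?C. \<Sum>j\<in>neighbours i - ?C. if i \<in> A then ?h i j else 0)"
        using K_pos by (intro mult_left_mono order_trans[OF sum_abs] sum_mono) auto
      also have "\<dots> \<le> K * (\<Sum>i\<in>?C. if i \<in> A then (\<Sum>j\<in>neighbours i. ?h i j) else 0)"
        using K_pos by (intro mult_left_mono sum_mono) (auto intro!: sum_mono2)
      also have "\<dots> = K * (\<Sum>i\<in>?C \<inter> A. \<Sum>j\<in>neighbours i. ?h i j)" by (simp add: sum.inter_restrict)
      also have "\<dots> \<le> \<Psi> s" unfolding \<Psi>_def using K_pos A by (intro mult_left_mono sum_mono2 sum_nonneg) auto
      also have "\<dots> \<le> B" using B(2)[OF s] by simp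
      finally show ?thesis .
    qed
    have "norm (energy (poly U) K (y t) ?C - energy (poly U) K (y 0) ?C) \<le> B * norm (t - 0)"
    proof (rule field_differentiable_bound[where S = "{-T..T}" and f' = "\<lambda>t. flux K A (y t) ?C"])
      show "((\<lambda>t. energy (poly U) K (y t) ?C) has_real_derivative flux K A (y s) ?C) (at s within {-T..T})" for s
        by (rule has_field_derivative_at_within[OF energy_has_derivative_flux[OF y U_derivative finite_cube]])
    qed (use flux_le t in auto)
    then have "\<bar>energy (poly U) K (y t) ?C - energy (poly U) K (y 0) ?C\<bar> \<le> B * \<bar>t - 0\<bar>" by simp
    moreover have "B * \<bar>t - 0\<bar> \<le> B * \<bar>T\<bar>" using B(1) t by (intro mult_left_mono) auto
    moreover have "energy (poly U) K (y 0) ?C \<le> M0 * (2 * real k + 1) ^ CARD('d)"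
      using M0 adm unfolding Qle_def by blast
    \<comment> \<open>The flux bound has no volume factor; as cubes have volume at least 1, it can
      be charged to the energy density.\<close>
    moreover have "B * \<bar>T\<bar> * 1 \<le> B * \<bar>T\<bar> * (2 * real k + 1) ^ CARD('d)"
      using B(1) by (intro mult_left_mono one_le_power) auto
    ultimately show "energy (poly U) K (y t) ?C \<le> (M0 + B * \<bar>T\<bar>) * (2 * real k + 1) ^ CARD('d)"
      unfolding distrib_right by linarith
  qed
  then show ?thesis by blast
qed

text \<open>The type argument records the dimension. The quantifiers over A, M0 and M stand inside
  the choice, so one constant serves all volumes and all initial states.\<close>

definition growth_const :: "('d::finite) itself \<Rightarrow> real" where
  "growth_const _ = (SOME C. C > 0 \<and> (\<forall>A (y :: real \<Rightarrow> 'd state) t s M0 M. motion U' K A y \<longrightarrow> Qle (y s) M0 \<longrightarrow>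
       (\<forall>r\<in>{min s t..max s t}. Qle (y r) M) \<longrightarrow> Qle (y t) (C * (M0 + (t - s) ^ 4))))"

lemma growth_const:
  shows growth_const_pos: "growth_const TYPE('d::finite) > 0"
    and growth_bound: "motion U' K A (y :: real \<Rightarrow> 'd state) \<Longrightarrow> Qle (y s) M0 \<Longrightarrow>
       (\<And>r. r \<in> {min s t..max s t} \<Longrightarrow> Qle (y r) M) \<Longrightarrow> Qle (y t) (growth_const TYPE('d) * (M0 + (t - s) ^ 4))"
proof -
  obtain C where C: "C > 0"
    "\<And>A (y :: real \<Rightarrow> 'd state) t s M0 M. motion U' K A y \<Longrightarrow> Qle (y s) M0 \<Longrightarrow>
       (\<And>r. r \<in> {min s t..max s t} \<Longrightarrow> Qle (y r) M) \<Longrightarrow> Qle (y t) (C * (M0 + (t - s) ^ 4))"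
    using apriori_bound by blast
  have "\<exists>C. C > 0 \<and> (\<forall>A (y :: real \<Rightarrow> 'd state) t s M0 M. motion U' K A y \<longrightarrow> Qle (y s) M0 \<longrightarrow>
       (\<forall>r\<in>{min s t..max s t}. Qle (y r) M) \<longrightarrow> Qle (y t) (C * (M0 + (t - s) ^ 4)))"
    by (intro exI[of _ C] conjI allI impI C(1)) (rule C(2), auto)
  note * = someI_ex[OF this, folded growth_const_def[of "TYPE('d)"]]
  from * show "growth_const TYPE('d) > 0"
    "motion U' K A (y :: real \<Rightarrow> 'd state) \<Longrightarrow> Qle (y s) M0 \<Longrightarrow>
       (\<And>r. r \<in> {min s t..max s t} \<Longrightarrow> Qle (y r) M) \<Longrightarrow> Qle (y t) (growth_const TYPE('d) * (M0 + (t - s) ^ 4))"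
    by (blast, blast)
qed

lemma finite_dynamics_growth:
  fixes y :: "real \<Rightarrow> ('d::finite) state"
  assumes y: "motion U' K A y" and A: "finite A" and M0: "Qle (y 0) M0"
  shows "Qle (y t) (growth_const TYPE('d) * (M0 + t ^ 4))"
proof -
  obtain M where M: "\<forall>r\<in>{-\<bar>t\<bar>..\<bar>t\<bar>}. Qle (y r) M" using finite_dynamics_Qle[OF assms] by blast
  have "Qle (y t) (growth_const TYPE('d) * (M0 + (t - 0) ^ 4))"
    by (rule growth_bound[OF y M0, where M = M]) (use M in \<open>auto simp: min_def max_def split: if_splits\<close>)
  then show ?thesis by simp
qed

end

subsection \<open>Infinite-volume limit\<close>

context anharmonic
begin

text \<open>The part of finite \<open>Q\<close> that comparing solutions needs: U'' along the
  trajectory is O(\<open>lw j\<close>), and coordinates grow slower than any exponential in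
  |j|.\<close>

definition tame :: "real \<Rightarrow> ('d::finite) state \<Rightarrow> bool" where
  "tame D x \<longleftrightarrow> (\<forall>j. (fst (x j))\<^sup>2 \<le> D * lw j \<and> (snd (x j))\<^sup>2 \<le> D * lw j)"

text \<open>The smallest admissible cube at j bounds p^2 and q^4 by a multiple of
  \<open>lw j\<close>; then 2 q^2 \<le> 1 + q^4 is used. A square root of the logarithm is lost, but
  the Lipschitz constants remain sublinear in |j|.\<close>

lemma Qle_imp_tame:
  fixes x :: "('d::finite) state"
  assumes "Qle x M"
  shows "tame (2 * cU * 5 ^ CARD('d) * M) x"
  unfolding tame_def
proof
  fix j :: "'d site"
  obtain k where k: "admissible j k" "(2 * real k + 1) ^ CARD('d) \<le> 5 ^ CARD('d) * lw j"
    by (rule admissible_small)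
  have M: "M \<ge> 1" using Qle_ge_1[OF assms] .
  define e where "e = (snd (x j))\<^sup>2 / 2 + poly U (fst (x j)) + 1"
  have "e \<le> (\<Sum>i\<in>cube j k. (snd (x i))\<^sup>2 / 2 + poly U (fst (x i)) + 1)"
    unfolding e_def using U_nonneg by (intro member_le_sum) (auto intro!: add_nonneg_nonneg)
  also have "\<dots> \<le> energy (poly U) K x (cube j k)" by (rule energy_ge_sum[OF K_pos])
  also have "\<dots> \<le> M * (2 * real k + 1) ^ CARD('d)" using assms k by (simp add: Qle_def)
  also have "\<dots> \<le> M * (5 ^ CARD('d) * lw j)" using k M by (intro mult_left_mono) auto
  finally have e: "2 * cU * e \<le> 2 * cU * (M * (5 ^ CARD('d) * lw j))"
    using cU_ge_1 by (intro mult_left_mono) auto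
  have e1: "e \<ge> 1" using U_nonneg[of "fst (x j)"] by (simp add: e_def)
  then have ce: "1 \<le> cU * e" "e \<le> cU * e" using cU_ge_1 mult_mono[of 1 cU 1 e] mult_right_mono[of 1 cU e] by auto
  have "(snd (x j))\<^sup>2 \<le> 2 * e" using U_nonneg[of "fst (x j)"] by (simp add: e_def)
  then have p: "(snd (x j))\<^sup>2 \<le> 2 * cU * e" using ce by linarith
  have "(fst (x j)) ^ 4 \<le> cU * (poly U (fst (x j)) + 1)" by (rule quartic_le)
  also have "\<dots> \<le> cU * e" using cU_ge_1 by (intro mult_left_mono) (auto simp: e_def)
  finally have "((fst (x j))\<^sup>2)\<^sup>2 \<le> cU * e" by simp
  moreover have "2 * (fst (x j))\<^sup>2 \<le> 1 + ((fst (x j))\<^sup>2)\<^sup>2"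
    using sum_squares_bound[of 1 "(fst (x j))\<^sup>2"] by simp
  ultimately have q: "(fst (x j))\<^sup>2 \<le> 2 * cU * e" using ce by linarith
  show "(fst (x j))\<^sup>2 \<le> 2 * cU * 5 ^ CARD('d) * M * lw j \<and> (snd (x j))\<^sup>2 \<le> 2 * cU * 5 ^ CARD('d) * M * lw j"
    using p q e by (simp add: mult_ac)
qed

definition lip_const :: "('d::finite) itself \<Rightarrow> real \<Rightarrow> real" where
  "lip_const _ D = 1 + cU' * (1 + 2 * D) + K * (2 * 3 ^ CARD('d))"

lemma lip_const_nonneg: "D \<ge> 0 \<Longrightarrow> lip_const TYPE('d::finite) D \<ge> 0"
  using cU'_nonneg K_pos by (simp add: lip_const_def)

lemma velocity_lipschitz:
  fixes x z :: "('d::finite) state"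
  assumes D: "D \<ge> 0" and x: "tame D x" and z: "tame D z"
    and m: "\<And>k. k \<in> insert i (neighbours i) \<Longrightarrow> norm (x k - z k) \<le> m"
  shows "norm (velocity U' K A x i - velocity U' K A z i) \<le> lip_const TYPE('d) D * lw i * m"
proof -
  have m0: "0 \<le> m" using m[of i] norm_ge_zero[of "x i - z i"] by (meson insertI1 order_trans)
  have l1: "1 \<le> lw i" by (rule lw_ge_1)
  show ?thesis
  proof (cases "i \<in> A")
    case False
    then show ?thesis using m0 l1 lip_const_nonneg[where 'd = 'd, OF D] by (simp add: velocity_def)
  next
    case True
    let ?S = "\<lambda>z. \<Sum>j\<in>neighbours i. fst (z i) - fst (z j)"
    let ?q = "fst (x i)" and ?r = "fst (z i)"
    have qp: "\<bar>?q - ?r\<bar> \<le> m" "\<bar>snd (x i) - snd (z i)\<bar> \<le> m"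
      using m[of i] abs_le_norm_pair[of "x i - z i"] by auto
    have "norm (velocity U' K A x i - velocity U' K A z i) \<le> 
       \<bar>snd (x i) - snd (z i)\<bar> + \<bar>- (U' ?q - U' ?r) - K * (?S x - ?S z)\<bar>"
      using True norm_real_pair_le[of "snd (x i) - snd (z i)" "- (U' ?q - U' ?r) - K * (?S x - ?S z)"]
      by (simp add: velocity_def algebra_simps)
    also have "\<bar>- (U' ?q - U' ?r) - K * (?S x - ?S z)\<bar> \<le> \<bar>U' ?q - U' ?r\<bar> + K * \<bar>?S x - ?S z\<bar>"
      using K_pos abs_triangle_ineq4[of "- (U' ?q - U' ?r)" "K * (?S x - ?S z)"]
      by (simp add: abs_mult abs_minus_commute)
    also have "\<bar>?S x - ?S z\<bar> \<le> 2 * 3 ^ CARD('d) * m" by (rule harmonic_force_diff) (rule m)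
    also have "\<bar>U' ?q - U' ?r\<bar> \<le> cU' * (1 + ?r\<^sup>2 + ?q\<^sup>2) * \<bar>?q - ?r\<bar>" by (rule U'_lipschitz)
    also have "\<dots> \<le> cU' * ((1 + 2 * D) * lw i) * m"
    proof (intro mult_mono mult_left_mono qp)
      have "1 + ?r\<^sup>2 + ?q\<^sup>2 \<le> lw i + D * lw i + D * lw i"
        using x z l1 unfolding tame_def by (intro add_mono) auto
      then show "1 + ?r\<^sup>2 + ?q\<^sup>2 \<le> (1 + 2 * D) * lw i" by (simp add: algebra_simps)
    qed (use cU'_nonneg D l1 in auto)
    also have "\<bar>snd (x i) - snd (z i)\<bar> \<le> m" by (rule qp)
    finally have "norm (velocity U' K A x i - velocity U' K A z i) 
       \<le> m + (cU' * ((1 + 2 * D) * lw i) * m + K * (2 * 3 ^ CARD('d) * m))"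
      using K_pos by simp
    also have "\<dots> \<le> m * lw i + (cU' * ((1 + 2 * D) * lw i) * m + K * (2 * 3 ^ CARD('d) * (m * lw i)))"
    proof -
      have mm: "m \<le> m * lw i" using mult_left_mono[OF l1 m0] by simp
      moreover have "K * (2 * 3 ^ CARD('d) * m) \<le> K * (2 * 3 ^ CARD('d) * (m * lw i))"
        using K_pos by (intro mult_left_mono mm) auto
      ultimately show ?thesis by linarith
    qed
    also have "\<dots> = lip_const TYPE('d) D * lw i * m" by (simp add: lip_const_def algebra_simps)
    finally show ?thesis .
  qed
qed

lemma tame_norm_le:
  assumes "tame D x"
  shows "norm (x j) \<le> 2 * (1 + D) * lw j"
proof -
  have a: "\<bar>r\<bar> \<le> 1 + r\<^sup>2" for r :: real
    using sum_squares_bound[of 1 "\<bar>r\<bar>"] zero_le_power2[of r] by simp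
  have "norm (x j) \<le> \<bar>fst (x j)\<bar> + \<bar>snd (x j)\<bar>" using norm_real_pair_le[of "fst (x j)" "snd (x j)"] by simp
  also have "\<dots> \<le> (1 + D * lw j) + (1 + D * lw j)"
  proof (rule add_mono)
    show "\<bar>fst (x j)\<bar> \<le> 1 + D * lw j" "\<bar>snd (x j)\<bar> \<le> 1 + D * lw j"
      using assms a[of "fst (x j)"] a[of "snd (x j)"] unfolding tame_def by (force intro: order_trans)+
  qed
  also have "\<dots> \<le> (lw j + D * lw j) + (lw j + D * lw j)" using lw_ge_1[of j] by simp
  finally show ?thesis by (simp add: algebra_simps)
qed

text \<open>Comparison with the zero state, which is tame: one factor \<open>lw\<close> comes from
  the Lipschitz constant, the other from the size of the state.\<close>

lemma velocity_bound:
  assumes D: "D \<ge> 0"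
  obtains B where "B > 0" "\<And>A (x :: ('d::finite) state) i. tame D x \<Longrightarrow> norm (velocity U' K A x i) \<le> B * (lw i)\<^sup>2"
proof
  let ?L = "lip_const TYPE('d) D"
  let ?B = "?L * (4 * (1 + D)) + \<bar>U' 0\<bar> + 1"
  show "?B > 0" using D lip_const_nonneg[where 'd = 'd, OF D] by (simp add: add_nonneg_pos)
  fix A and x :: "'d state" and i :: "'d site" assume x: "tame D x"
  let ?z = "\<lambda>_. (0, 0) :: real \<times> real"
  have l1: "1 \<le> lw i" by (rule lw_ge_1)
  have l2: "1 \<le> (lw i)\<^sup>2" using l1 by simp
  have z: "tame D ?z" unfolding tame_def using D lw_ge_1 by (auto intro!: mult_nonneg_nonneg intro: order_trans[OF zero_le_one])
  have "norm (velocity U' K A x i - velocity U' K A ?z i) \<le> ?L * lw i * (4 * (1 + D) * lw i)"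
  proof (rule velocity_lipschitz[OF D x z])
    fix k assume k: "k \<in> insert i (neighbours i)"
    have "norm (x k - ?z k) \<le> 2 * (1 + D) * lw k" using tame_norm_le[OF x, of k] by (simp add: zero_prod_def[symmetric])
    also have "\<dots> \<le> 2 * (1 + D) * (2 * lw i)" using k lw_neighbour[of k i] l1 D by (intro mult_left_mono) auto
    finally show "norm (x k - ?z k) \<le> 4 * (1 + D) * lw i" by (simp add: algebra_simps)
  qed
  moreover have "norm (velocity U' K A ?z i) \<le> \<bar>U' 0\<bar>" by (simp add: velocity_def)
  moreover have "norm (velocity U' K A x i) \<le> norm (velocity U' K A x i - velocity U' K A ?z i) + norm (velocity U' K A ?z i)"
    using norm_triangle_ineq[of "velocity U' K A x i - velocity U' K A ?z i" "velocity U' K A ?z i"] by simp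
  ultimately have "norm (velocity U' K A x i) \<le> ?L * (4 * (1 + D)) * (lw i)\<^sup>2 + \<bar>U' 0\<bar>"
    by (simp add: power2_eq_square mult_ac)
  also have "\<dots> \<le> ?L * (4 * (1 + D)) * (lw i)\<^sup>2 + (\<bar>U' 0\<bar> + 1) * (lw i)\<^sup>2"
    using mult_left_mono[OF l2, of "\<bar>U' 0\<bar> + 1"] by (intro add_left_mono) simp
  finally show "norm (velocity U' K A x i) \<le> ?B * (lw i)\<^sup>2" by (simp add: algebra_simps)
qed

section \<open>Comparison of solutions\<close>

lemma tame_diff_exp_bound:
  assumes D: "D \<ge> 0" and al: "\<alpha> > 0"
  obtains B where "B > 0"
    "\<And>(x :: ('d::finite) state) z j. tame D x \<Longrightarrow> tame D z \<Longrightarrow> norm (x j - z j) \<le> B * exp (\<alpha> * real_of_int (lnorm j))"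
proof -
  obtain C where C: "C > 0" "\<And>j :: 'd site. lw j \<le> C * exp (\<alpha> * real_of_int (lnorm j))"
    using lw_le_exp[OF al] by blast
  show thesis
  proof (rule that[of "4 * (1 + D) * C"])
    show "4 * (1 + D) * C > 0" using D C by simp
    fix x z :: "'d state" and j assume "tame D x" "tame D z"
    then have "norm (x j - z j) \<le> 2 * (1 + D) * lw j + 2 * (1 + D) * lw j"
      using norm_triangle_ineq4[of "x j" "z j"] tame_norm_le[of D x j] tame_norm_le[of D z j] by linarith
    also have "\<dots> = 4 * (1 + D) * lw j" by (simp add: algebra_simps)
    also have "\<dots> \<le> 4 * (1 + D) * (C * exp (\<alpha> * real_of_int (lnorm j)))" using D C(2) by (intro mult_left_mono) auto
    finally show "norm (x j - z j) \<le> 4 * (1 + D) * C * exp (\<alpha> * real_of_int (lnorm j))" by (simp add: mult.assoc)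
  qed
qed

text \<open>Weighted Gronwall without source for the difference of two solutions. Starting from rate
  \<alpha> the estimate ends with 2 \<alpha>, the slope that the weight attains at time T.\<close>

lemma stability:
  assumes T: "T > 0" and D: "D \<ge> 0" and al: "\<alpha> > 0"
  obtains C where "C > 0"
    "\<And>(y :: real \<Rightarrow> ('d::finite) state) z V t j. motion U' K UNIV y \<Longrightarrow> motion U' K UNIV z \<Longrightarrow>
      (\<And>s. \<bar>s\<bar> \<le> T \<Longrightarrow> tame D (y s)) \<Longrightarrow> (\<And>s. \<bar>s\<bar> \<le> T \<Longrightarrow> tame D (z s)) \<Longrightarrow>
      (\<And>j. norm (y 0 j - z 0 j) \<le> V * exp (\<alpha> * real_of_int (lnorm j))) \<Longrightarrow> \<bar>t\<bar> \<le> T \<Longrightarrow>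
      norm (y t j - z t j) \<le> C * V * exp (2 * \<alpha> * real_of_int (lnorm j))"
proof -
  obtain C where C: "C > 0" "\<And>(u :: real \<Rightarrow> 'd site \<Rightarrow> real \<times> real) V t j.
      subsolution (lip_const TYPE('d) D) T \<alpha> V u \<Longrightarrow> \<bar>t\<bar> \<le> T \<Longrightarrow> norm (u t j) \<le> C * V * exp (2 * \<alpha> * real_of_int (lnorm j))"
    using weighted_gronwall[OF T al lip_const_nonneg[OF D]] by blast
  obtain B where B: "B > 0"
    "\<And>(x :: 'd state) z j. tame D x \<Longrightarrow> tame D z \<Longrightarrow> norm (x j - z j) \<le> B * exp (\<alpha> * real_of_int (lnorm j))"
    using tame_diff_exp_bound[OF D al] by blast
  show thesis
  proof (rule that[OF C(1)])
    fix y z :: "real \<Rightarrow> 'd state" and V t j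
    assume y: "motion U' K UNIV y" and z: "motion U' K UNIV z"
      and ty: "\<And>s. \<bar>s\<bar> \<le> T \<Longrightarrow> tame D (y s)" and tz: "\<And>s. \<bar>s\<bar> \<le> T \<Longrightarrow> tame D (z s)"
      and V: "\<And>j. norm (y 0 j - z 0 j) \<le> V * exp (\<alpha> * real_of_int (lnorm j))" and t: "\<bar>t\<bar> \<le> T"
    show "norm (y t j - z t j) \<le> C * V * exp (2 * \<alpha> * real_of_int (lnorm j))"
    proof (rule C(2)[OF subsolutionI[where u = "\<lambda>t j. y t j - z t j" and S = "\<lambda>_. 0" and a = "\<lambda>j. norm (y 0 j - z 0 j)" 
          and u' = "\<lambda>t j. velocity U' K UNIV (y t) j - velocity U' K UNIV (z t) j" and B = B]])
      show "((\<lambda>s. y s j - z s j) has_vector_derivative velocity U' K UNIV (y t) j - velocity U' K UNIV (z t) j) (at t)" for j t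
        using y z by (intro has_vector_derivative_diff) (auto simp: motion_def)
      show "norm (velocity U' K UNIV (y t) j - velocity U' K UNIV (z t) j) \<le> lip_const TYPE('d) D * lw j * m + 0"
        if "\<bar>t\<bar> \<le> T" "\<And>k. k \<in> insert j (neighbours j) \<Longrightarrow> norm (y t k - z t k) \<le> m" for j t m
        using velocity_lipschitz[OF D ty[OF that(1)] tz[OF that(1)] that(2), of j] by simp
    qed (use V t B ty tz in auto)
  qed
qed

text \<open>The two dynamics follow the same law inside the smaller cube; elsewhere the discrepancy
  is a source of size O(\<open>lw j\<close> squared), hence O(exp (|j| / 2)). Since |j| > n there,
  this is at most exp (- n / 2) exp |j|, which yields the rate in n.\<close>

lemma finite_volume_cauchy:
  assumes T: "T > 0" and D: "D \<ge> 0"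
  obtains C where "C > 0"
    "\<And>n m (y :: real \<Rightarrow> ('d::finite) state) z t j. n \<le> m \<Longrightarrow> 
      motion U' K (cube (\<lambda>_. 0) n) y \<Longrightarrow> motion U' K (cube (\<lambda>_. 0) m) z \<Longrightarrow> y 0 = z 0 \<Longrightarrow>
      (\<And>s. \<bar>s\<bar> \<le> T \<Longrightarrow> tame D (y s)) \<Longrightarrow> (\<And>s. \<bar>s\<bar> \<le> T \<Longrightarrow> tame D (z s)) \<Longrightarrow> \<bar>t\<bar> \<le> T \<Longrightarrow>
      norm (y t j - z t j) \<le> C * exp (- real n / 2) * exp (2 * real_of_int (lnorm j))"
proof -
  obtain C where C: "C > 0" "\<And>(u :: real \<Rightarrow> 'd site \<Rightarrow> real \<times> real) V t j.
      subsolution (lip_const TYPE('d) D) T 1 V u \<Longrightarrow> \<bar>t\<bar> \<le> T \<Longrightarrow> norm (u t j) \<le> C * V * exp (2 * 1 * real_of_int (lnorm j))"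
    using weighted_gronwall[OF T zero_less_one lip_const_nonneg[OF D]] by blast
  obtain B where B: "B > 0"
    "\<And>(x :: 'd state) z j. tame D x \<Longrightarrow> tame D z \<Longrightarrow> norm (x j - z j) \<le> B * exp (1 * real_of_int (lnorm j))"
    using tame_diff_exp_bound[OF D zero_less_one] by blast
  obtain B' where B': "B' > 0" "\<And>A (x :: 'd state) i. tame D x \<Longrightarrow> norm (velocity U' K A x i) \<le> B' * (lw i)\<^sup>2"
    using velocity_bound[OF D] by blast
  obtain L where L: "L > 0" "\<And>j :: 'd site. (lw j)\<^sup>2 \<le> L * exp (1/2 * real_of_int (lnorm j))"
    using lw_sq_le_exp[of "1/2"] by auto
  show thesis
  proof (rule that[of "C * (T * (2 * B' * L))"])
    show "0 < C * (T * (2 * B' * L))" using C(1) T B' L by simp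
    fix n m and y z :: "real \<Rightarrow> 'd state" and t j
    assume nm: "n \<le> m" and y: "motion U' K (cube (\<lambda>_. 0) n) y" and z: "motion U' K (cube (\<lambda>_. 0) m) z"
      and yz: "y 0 = z 0" 
      and ty: "\<And>s. \<bar>s\<bar> \<le> T \<Longrightarrow> tame D (y s)" and tz: "\<And>s. \<bar>s\<bar> \<le> T \<Longrightarrow> tame D (z s)" and t: "\<bar>t\<bar> \<le> T"
    define S where "S j = (if j \<in> cube (\<lambda>_. 0) n then 0 else 2 * B' * (lw j)\<^sup>2)" for j :: "'d site"
    define V where "V = T * (2 * B' * L) * exp (- real n / 2)"
    have "norm (y t j - z t j) \<le> C * V * exp (2 * 1 * real_of_int (lnorm j))"
    proof (rule C(2)[OF subsolutionI[where u = "\<lambda>t j. y t j - z t j" and S = S and a = "\<lambda>_. 0" 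
          and u' = "\<lambda>t j. velocity U' K (cube (\<lambda>_. 0) n) (y t) j - velocity U' K (cube (\<lambda>_. 0) m) (z t) j" and B = B]])
      show "((\<lambda>s. y s j - z s j) has_vector_derivative 
          velocity U' K (cube (\<lambda>_. 0) n) (y t) j - velocity U' K (cube (\<lambda>_. 0) m) (z t) j) (at t)" for j t
        using y z by (intro has_vector_derivative_diff) (auto simp: motion_def)
      show "norm (velocity U' K (cube (\<lambda>_. 0) n) (y t) j - velocity U' K (cube (\<lambda>_. 0) m) (z t) j) 
          \<le> lip_const TYPE('d) D * lw j * m' + S j"
        if t: "\<bar>t\<bar> \<le> T" and m': "\<And>k. k \<in> insert j (neighbours j) \<Longrightarrow> norm (y t k - z t k) \<le> m'" for j t m'
      proof (cases "j \<in> cube (\<lambda>_. 0) n")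
        case True
        then have "j \<in> cube (\<lambda>_. 0) m" using cube_mono[OF nm] by blast
        then have "velocity U' K (cube (\<lambda>_. 0) m) (z t) j = velocity U' K (cube (\<lambda>_. 0) n) (z t) j"
          using True by (simp add: velocity_def)
        then show ?thesis
          using velocity_lipschitz[OF D ty[OF t] tz[OF t] m', of j "cube (\<lambda>_. 0) n"] True by (simp add: S_def)
      next
        case False
        have "0 \<le> m'" using m'[of j] norm_ge_zero[of "y t j - z t j"] by (meson insertI1 order_trans)
        then have "0 \<le> lip_const TYPE('d) D * lw j * m'"
          using lip_const_nonneg[where 'd = 'd, OF D] lw_ge_1[of j] by simp
        moreover have "norm (velocity U' K (cube (\<lambda>_. 0) n) (y t) j - velocity U' K (cube (\<lambda>_. 0) m) (z t) j)
           \<le> B' * (lw j)\<^sup>2 + B' * (lw j)\<^sup>2"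
          by (intro order_trans[OF norm_triangle_ineq4] add_mono B'(2) ty tz t)
        ultimately show ?thesis using False by (simp add: S_def)
      qed
      show "0 + T * S j \<le> V * exp (1 * real_of_int (lnorm j))" for j
      proof (cases "j \<in> cube (\<lambda>_. 0) n")
        case True
        then show ?thesis using T B' L by (simp add: S_def V_def)
      next
        case False
        have "exp (1/2 * real_of_int (lnorm j)) \<le> exp (- real n / 2 + real_of_int (lnorm j))"
          using lnorm_gt_if_notin_cube[OF False] by simp
        then have "L * exp (1/2 * real_of_int (lnorm j)) \<le> L * exp (- real n / 2 + real_of_int (lnorm j))"
          using L(1) by (intro mult_left_mono) auto
        then have "(lw j)\<^sup>2 \<le> L * (exp (- real n / 2) * exp (real_of_int (lnorm j)))"
          using L(2)[of j] unfolding exp_add[symmetric] by linarith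
        then have "T * (2 * B' * (lw j)\<^sup>2) \<le> T * (2 * B' * (L * (exp (- real n / 2) * exp (real_of_int (lnorm j)))))"
          using T B' by (intro mult_left_mono) auto
        then show ?thesis using False by (simp add: S_def V_def mult_ac)
      qed
    qed (use t B B' ty tz yz in \<open>auto simp: S_def\<close>)
    then show "norm (y t j - z t j) \<le> C * (T * (2 * B' * L)) * exp (- real n / 2) * exp (2 * real_of_int (lnorm j))"
      by (simp add: V_def mult_ac)
  qed
qed

lemma Qle_closed:
  fixes x :: "nat \<Rightarrow> ('d::finite) state"
  assumes lim: "\<And>i. (\<lambda>n. x n i) \<longlonglongrightarrow> z i" and Q: "\<And>n. Qle (x n) M"
  shows "Qle z M"
  unfolding Qle_def
proof (intro allI impI)
  fix \<nu> :: "'d site" and k :: nat assume adm: "admissible \<nu> k"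
  have "(\<lambda>n. energy (poly U) K (x n) (cube \<nu> k)) \<longlonglongrightarrow> energy (poly U) K z (cube \<nu> k)"
    unfolding energy_def by (intro tendsto_intros tendsto_poly lim) auto
  then show "energy (poly U) K z (cube \<nu> k) \<le> M * (2 * real k + 1) ^ CARD('d)"
  proof (rule LIMSEQ_le_const2)
    show "\<exists>N. \<forall>n\<ge>N. energy (poly U) K (x n) (cube \<nu> k) \<le> M * (2 * real k + 1) ^ CARD('d)"
      using Q adm by (simp add: Qle_def)
  qed
qed

section \<open>Construction of the infinite-volume solution\<close>

definition growth :: "('d::finite) itself \<Rightarrow> real \<Rightarrow> real \<Rightarrow> real" where
  "growth _ M t = growth_const TYPE('d) * (M + t ^ 4)"

definition tame_const :: "('d::finite) itself \<Rightarrow> real \<Rightarrow> real \<Rightarrow> real" where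
  "tame_const _ M T = 2 * cU * 5 ^ CARD('d) * growth TYPE('d) M T"

lemma growth_mono: "\<bar>t\<bar> \<le> \<bar>T\<bar> \<Longrightarrow> growth TYPE('d::finite) M t \<le> growth TYPE('d) M T"
  using growth_const_pos[where 'd = 'd] power_mono[of "\<bar>t\<bar>" "\<bar>T\<bar>" 4] by (simp add: growth_def)

lemma tame_const_nonneg: "M \<ge> 0 \<Longrightarrow> tame_const TYPE('d::finite) M T \<ge> 0"
  using growth_const_pos[where 'd = 'd] cU_ge_1 by (simp add: tame_const_def growth_def)

lemma Qle_growth_imp_tame:
  assumes "Qle (x :: ('d::finite) state) (growth TYPE('d) M t)" "\<bar>t\<bar> \<le> \<bar>T\<bar>"
  shows "tame (tame_const TYPE('d) M T) x"
  unfolding tame_const_def using Qle_imp_tame[OF Qle_mono[OF assms(1) growth_mono[OF assms(2)]]] .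

text \<open>The velocity at j involves only j and its neighbours, so the rate for the coordinates
  carries over to the velocities, uniformly on compact time intervals, and the limit solves the full
  system.\<close>

theorem infinite_dynamics_exists:
  fixes x :: "('d::finite) state"
  assumes x: "Qle x M"
  obtains y where "motion U' K UNIV y" "y 0 = x" "\<And>t. Qle (y t) (growth TYPE('d) M t)"
proof -
  have M0: "M \<ge> 0" using Qle_ge_1[OF x] by simp
  have "\<exists>y. motion U' K (cube (\<lambda>_. 0) n) y \<and> y 0 = x" for n
    using finite_dynamics_exists[of n x] by metis
  then obtain Y where Y: "\<And>n. motion U' K (cube (\<lambda>_. 0) n) (Y n)" "\<And>n. Y n 0 = x"
    by metis
  have YQ: "Qle (Y n t) (growth TYPE('d) M t)" for n t
    unfolding growth_def by (rule finite_dynamics_growth[OF Y(1)]) (auto simp: Y(2) x)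
  define E where "E n j = exp (- real n / 2) * exp (2 * real_of_int (lnorm j))" for n and j :: "'d site"
  have E0: "(\<lambda>n. C * E n j) \<longlonglongrightarrow> 0" for C j
  proof -
    have "filterlim (\<lambda>n. real n * (1/2)) at_top sequentially"
      by (intro filterlim_tendsto_pos_mult_at_top[OF _ _ filterlim_real_sequentially, of "\<lambda>_. 1/2" "1/2", simplified mult.commute[of "1/2"]]) auto
    then have "filterlim (\<lambda>n. - (real n * (1/2))) at_bot sequentially"
      by (simp add: filterlim_uminus_at_bot)
    then have "(\<lambda>n. exp (- (real n * (1/2)))) \<longlonglongrightarrow> 0"
      by (rule filterlim_compose[OF exp_at_bot])
    then have "(\<lambda>n. C * (exp (- (real n * (1/2))) * exp (2 * real_of_int (lnorm j)))) \<longlonglongrightarrow> C * (0 * exp (2 * real_of_int (lnorm j)))"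
      by (intro tendsto_intros)
    then show ?thesis by (simp add: E_def)
  qed
  have cauchy: "\<exists>C>0. \<forall>n m t j. n \<le> m \<longrightarrow> \<bar>t\<bar> \<le> T \<longrightarrow> norm (Y n t j - Y m t j) \<le> C * E n j" if T: "T > 0" for T
  proof -
    obtain C where C: "C > 0" "\<And>n m (y :: real \<Rightarrow> 'd state) z t j. n \<le> m \<Longrightarrow> 
      motion U' K (cube (\<lambda>_. 0) n) y \<Longrightarrow> motion U' K (cube (\<lambda>_. 0) m) z \<Longrightarrow> y 0 = z 0 \<Longrightarrow>
      (\<And>s. \<bar>s\<bar> \<le> T \<Longrightarrow> tame (tame_const TYPE('d) M T) (y s)) \<Longrightarrow> 
      (\<And>s. \<bar>s\<bar> \<le> T \<Longrightarrow> tame (tame_const TYPE('d) M T) (z s)) \<Longrightarrow> \<bar>t\<bar> \<le> T \<Longrightarrow>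
      norm (y t j - z t j) \<le> C * exp (- real n / 2) * exp (2 * real_of_int (lnorm j))"
      using finite_volume_cauchy[OF T tame_const_nonneg[OF M0]] by blast
    show ?thesis
    proof (intro exI[of _ C] conjI allI impI C(1))
      fix n m t j assume "n \<le> (m::nat)" "\<bar>t\<bar> \<le> T"
      then have "norm (Y n t j - Y m t j) \<le> C * exp (- real n / 2) * exp (2 * real_of_int (lnorm j))"
        using T by (intro C(2)) (auto simp: Y intro!: Qle_growth_imp_tame[OF YQ])
      then show "norm (Y n t j - Y m t j) \<le> C * E n j" by (simp add: E_def mult.assoc)
    qed
  qed
  have conv: "convergent (\<lambda>n. Y n t j)" for t j
  proof -
    obtain C where C: "C > 0" "\<And>n m t' j. n \<le> m \<Longrightarrow> \<bar>t'\<bar> \<le> \<bar>t\<bar> + 1 \<Longrightarrow> norm (Y n t' j - Y m t' j) \<le> C * E n j"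
      using cauchy[of "\<bar>t\<bar> + 1"] by (metis abs_ge_zero add_nonneg_pos zero_less_one)
    have "Cauchy (\<lambda>n. Y n t j)"
    proof (rule CauchyI')
      fix e :: real assume "e > 0"
      from order_tendstoD(2)[OF E0[of C j] this] obtain N where N: "\<And>n. n \<ge> N \<Longrightarrow> C * E n j < e"
        by (auto simp: eventually_sequentially)
      show "\<exists>M. \<forall>m\<ge>M. \<forall>n>m. dist (Y m t j) (Y n t j) < e"
      proof (intro exI[of _ N] allI impI)
        fix m n assume "N \<le> m" "m < n"
        then show "dist (Y m t j) (Y n t j) < e" using C(2)[of m n t j] N[of m] by (simp add: dist_norm)
      qed
    qed
    then show ?thesis by (simp add: Cauchy_convergent_iff)
  qed
  define y where "y t j = lim (\<lambda>n. Y n t j)" for t j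
  have lim: "(\<lambda>n. Y n t j) \<longlonglongrightarrow> y t j" for t j
    using conv by (simp add: y_def convergent_LIMSEQ_iff)
  have Q: "Qle (y t) (growth TYPE('d) M t)" for t
    using lim YQ by (rule Qle_closed)
  have rate: "\<exists>C>0. \<forall>n t j. \<bar>t\<bar> \<le> T \<longrightarrow> norm (Y n t j - y t j) \<le> C * E n j" if T: "T > 0" for T
  proof -
    obtain C where C: "C > 0" "\<And>n m t j. n \<le> m \<Longrightarrow> \<bar>t\<bar> \<le> T \<Longrightarrow> norm (Y n t j - Y m t j) \<le> C * E n j"
      using cauchy[OF T] by blast
    have "norm (Y n t j - y t j) \<le> C * E n j" if t: "\<bar>t\<bar> \<le> T" for n t j
    proof (rule LIMSEQ_le_const2)
      show "(\<lambda>m. norm (Y n t j - Y m t j)) \<longlonglongrightarrow> norm (Y n t j - y t j)"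
        by (intro tendsto_intros lim)
      show "\<exists>N. \<forall>m\<ge>N. norm (Y n t j - Y m t j) \<le> C * E n j" using C(2) t by blast
    qed
    with C(1) show ?thesis by blast
  qed
  have "((\<lambda>s. y s j) has_vector_derivative velocity U' K UNIV (y t) j) (at t)" for t j
  proof (rule has_vector_derivative_limit[where f = "\<lambda>n t. Y n t j" and f' = "\<lambda>n t. velocity U' K (cube (\<lambda>_. 0) n) (Y n t) j"])
    show "((\<lambda>t. Y n t j) has_vector_derivative velocity U' K (cube (\<lambda>_. 0) n) (Y n t) j) (at t)" for n t
      using Y(1) by (simp add: motion_def)
    show "(\<lambda>n. Y n t j) \<longlonglongrightarrow> y t j" for t by (rule lim)
    show "uniform_limit {-T..T} (\<lambda>n t. velocity U' K (cube (\<lambda>_. 0) n) (Y n t) j) (\<lambda>t. velocity U' K UNIV (y t) j) sequentially" for T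
      unfolding uniform_limit_iff
    proof (intro allI impI)
      fix e :: real assume e: "e > 0"
      define T' where "T' = \<bar>T\<bar> + 1"
      have T': "T' > 0" by (simp add: T'_def)
      obtain C where C: "C > 0" "\<And>n t j. \<bar>t\<bar> \<le> T' \<Longrightarrow> norm (Y n t j - y t j) \<le> C * E n j"
        using rate[of T'] T' by blast
      define D where "D = tame_const TYPE('d) M T'"
      have D0: "D \<ge> 0" using tame_const_nonneg[OF M0] by (simp add: D_def)
      define L where "L = lip_const TYPE('d) D * lw j * (C * exp 2)"
      have E_nb: "E n k \<le> exp 2 * E n j" if k: "k \<in> insert j (neighbours j)" for n k
      proof -
        have "lnorm k \<le> lnorm j + 1" using k lnorm_neighbour by auto
        then have "exp (2 * real_of_int (lnorm k)) \<le> exp (2 + 2 * real_of_int (lnorm j))" by simp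
        then show ?thesis by (simp add: E_def exp_add mult_ac)
      qed
      have "\<forall>\<^sub>F n in sequentially. L * E n j < e" by (rule order_tendstoD(2)[OF E0 e])
      \<comment> \<open>From this n on, site j lies in the cube and obeys the full equation.\<close>
      moreover have "\<forall>\<^sub>F n in sequentially. n \<ge> nat (lnorm j)" by (rule eventually_ge_at_top)
      ultimately show "\<forall>\<^sub>F n in sequentially. \<forall>t\<in>{-T..T}. dist (velocity U' K (cube (\<lambda>_. 0) n) (Y n t) j) (velocity U' K UNIV (y t) j) < e"
      proof eventually_elim
        case (elim n)
        have j: "j \<in> cube (\<lambda>_. 0) n" using in_cube_lnorm[of j] cube_mono[OF elim(2)] by blast
        show ?case
        proof
          fix t assume "t \<in> {-T..T}"
          then have t: "\<bar>t\<bar> \<le> T'" by (auto simp: T'_def)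
          have t': "\<bar>t\<bar> \<le> \<bar>T'\<bar>" using t by simp
          have eq: "velocity U' K UNIV (y t) j = velocity U' K (cube (\<lambda>_. 0) n) (y t) j"
            using j by (simp add: velocity_def)
          have "norm (velocity U' K (cube (\<lambda>_. 0) n) (Y n t) j - velocity U' K (cube (\<lambda>_. 0) n) (y t) j) 
              \<le> lip_const TYPE('d) D * lw j * (C * (exp 2 * E n j))"
          proof (rule velocity_lipschitz[OF D0])
            show "tame D (Y n t)" "tame D (y t)"
              unfolding D_def using Qle_growth_imp_tame[OF YQ t'] Qle_growth_imp_tame[OF Q t'] by auto
            show "norm (Y n t k - y t k) \<le> C * (exp 2 * E n j)" if "k \<in> insert j (neighbours j)" for k
              using C(2)[OF t, of n k] mult_left_mono[OF E_nb[OF that], of C n] C(1) by linarith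
          qed
          also have "\<dots> = L * E n j" by (simp add: L_def mult_ac)
          also have "\<dots> < e" by (rule elim)
          finally show "dist (velocity U' K (cube (\<lambda>_. 0) n) (Y n t) j) (velocity U' K UNIV (y t) j) < e"
            by (simp add: dist_norm eq)
        qed
      qed
    qed
  qed
  then have "motion U' K UNIV y" by (simp add: motion_def)
  moreover have "y 0 = x"
  proof
    fix j show "y 0 j = x j" using LIMSEQ_unique[OF lim[of 0 j], of "x j"] by (simp add: Y(2))
  qed
  ultimately show thesis using Q by (rule that)
qed

end

subsection \<open>Uniqueness\<close>

context anharmonic
begin

lemma closed_Qle_times:
  assumes y: "motion U' K A y"
  shows "closed {t. Qle (y t) M}"
  unfolding closed_sequential_limits
proof (intro allI impI, elim conjE)
  fix r t assume r: "\<forall>n. r n \<in> {t. Qle (y t) M}" "r \<longlonglongrightarrow> t"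
  have "(\<lambda>n. y (r n) i) \<longlonglongrightarrow> y t i" for i
    using motion_continuous[OF y, of i] r(2) by (auto intro: continuous_on_tendsto_compose[of UNIV "\<lambda>t. y t i"])
  then show "t \<in> {t. Qle (y t) M}" using Qle_closed[of "\<lambda>n. y (r n)"] r(1) by auto
qed

lemma Qle_bounded_on_compact:
  assumes "compact S" and "\<And>t. t \<in> S \<Longrightarrow> \<exists>e>0. \<exists>M. \<forall>s. dist s t < e \<longrightarrow> Qle (y s) M"
  shows "\<exists>M. \<forall>t\<in>S. Qle (y t) M"
proof -
  obtain e m where em: "\<And>t. t \<in> S \<Longrightarrow> e t > 0" "\<And>t s. t \<in> S \<Longrightarrow> dist s t < e t \<Longrightarrow> Qle (y s) (m t)"
    using assms(2) by metis
  obtain C where C: "C \<subseteq> S" "finite C" "S \<subseteq> (\<Union>t\<in>C. ball t (e t))"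
  proof (rule compactE_image[OF assms(1), of S "\<lambda>t. ball t (e t)"])
    show "S \<subseteq> (\<Union>t\<in>S. ball t (e t))" using em(1) by force
  qed auto
  have "Qle (y s) (\<Sum>t\<in>C. \<bar>m t\<bar>)" if "s \<in> S" for s
  proof -
    obtain t where t: "t \<in> C" "dist t s < e t" using C(3) \<open>s \<in> S\<close> by auto
    then have "Qle (y s) (m t)" using em(2)[of t s] C(1) by (auto simp: dist_commute)
    moreover have "m t \<le> (\<Sum>t\<in>C. \<bar>m t\<bar>)"
      using member_le_sum[of t C "\<lambda>t. \<bar>m t\<bar>"] t(1) C(2) by simp
    ultimately show ?thesis by (rule Qle_mono)
  qed
  then show ?thesis by blast
qed

lemma growth_bound_segment:
  fixes y :: "real \<Rightarrow> ('d::finite) state"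
  assumes "motion U' K A y" "Qle (y s) M0" "\<And>r. r \<in> closed_segment s t \<Longrightarrow> Qle (y r) M"
  shows "Qle (y t) (growth TYPE('d) M0 (t - s))"
  unfolding growth_def
proof (rule growth_bound[OF assms(1,2)])
  fix r assume "r \<in> {min s t..max s t}"
  then show "Qle (y r) M" 
    by (intro assms(3)) (auto simp: closed_segment_eq_real_ivl min_def max_def split: if_splits)
qed

text \<open>A solution is only assumed to have finite \<open>Q\<close> at each single time. The times near which \<open>Q\<close> is
  unbounded form a closed set \<open>P\<close>; by Baire's theorem \<open>Q\<close> is bounded on a relatively open piece of \<open>P\<close>.
  On the gaps of \<open>P\<close> the a priori bound is used twice: from an interior time to control \<open>Q\<close> up to the
  end points of the gap, and then from the end point, which belongs to \<open>P\<close>.\<close>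

lemma Qle_locally_bounded:
  fixes y :: "real \<Rightarrow> ('d::finite) state"
  assumes y: "motion U' K A y" and fin: "\<And>t. \<exists>M. Qle (y t) M"
  shows "\<exists>e>0. \<exists>M. \<forall>s. dist s t < e \<longrightarrow> Qle (y s) M"
proof -
  define G where "G = {t. \<exists>e>0. \<exists>M. \<forall>s. dist s t < e \<longrightarrow> Qle (y s) M}"
  define P where "P = - G"
  define F where "F n = {t. Qle (y t) (real n)}" for n
  have "open G"
    unfolding open_dist
  proof
    fix t assume "t \<in> G"
    then obtain e M where e: "e > 0" "\<And>s. dist s t < e \<Longrightarrow> Qle (y s) M" by (auto simp: G_def)
    have "t' \<in> G" if "dist t' t < e / 2" for t'
    proof -
      have "Qle (y s) M" if s: "dist s t' < e / 2" for s
      proof (rule e(2))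
        show "dist s t < e" using s \<open>dist t' t < e / 2\<close> dist_triangle_half_r[of t' s e t] by (simp add: dist_commute)
      qed
      moreover have "e / 2 > 0" using e(1) by simp
      ultimately show ?thesis unfolding G_def by blast
    qed
    then show "\<exists>e>0. \<forall>t'. dist t' t < e \<longrightarrow> t' \<in> G" using e(1) half_gt_zero by blast
  qed
  then have clP: "closed P" unfolding P_def by (rule closed_Compl)
  have clF: "closed (F n)" for n unfolding F_def by (rule closed_Qle_times[OF y])
  have cover: "\<exists>n. t \<in> F n" for t
  proof -
    obtain M where "Qle (y t) M" using fin by blast
    then have "Qle (y t) (real (nat \<lceil>M\<rceil>))" by (rule Qle_mono) linarith
    then show ?thesis by (auto simp: F_def)
  qed
  have "P = {}"
  proof (rule ccontr)
    assume "P \<noteq> {}"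
    \<comment> \<open>Otherwise every P - F n would be relatively open and dense in the closed set
      P, and so would their intersection be dense; but the sets F n cover the line and the
      intersection is empty.\<close>
    have "\<exists>n. \<not> P \<subseteq> closure (P - F n)"
    proof (rule ccontr)
      assume "\<nexists>n. \<not> P \<subseteq> closure (P - F n)"
      then have "P \<subseteq> closure (\<Inter> (range (\<lambda>n. P - F n)))"
      proof (intro Baire clP)
        fix T assume T: "T \<in> range (\<lambda>n. P - F n)"
        have "openin (top_of_set P) (P \<inter> - F n)" for n
          using clF by (intro openin_open_Int) auto
        then show "openin (top_of_set P) T \<and> P \<subseteq> closure T"
          using T \<open>\<nexists>n. \<not> P \<subseteq> closure (P - F n)\<close> by (auto simp: Diff_eq)
      qed auto
      moreover have "\<Inter> (range (\<lambda>n. P - F n)) = {}" using cover by auto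
      ultimately have "P \<subseteq> closure {}" by (simp only:)
      then show False using \<open>P \<noteq> {}\<close> by simp
    qed
    then obtain n t0 where t0: "t0 \<in> P" "t0 \<in> - closure (P - F n)" by blast
    obtain e where e: "e > 0" "ball t0 e \<subseteq> - closure (P - F n)"
      using openE[OF open_Compl[OF closed_closure] t0(2)] by blast
    have PF: "s \<in> F n" if "s \<in> P" "dist t0 s < e" for s
      using e(2) that closure_subset[of "P - F n"] by auto
    have "Qle (y s) (growth TYPE('d) (real n) e)" if s: "dist s t0 < e" for s
    proof -
      define Z where "Z = P \<inter> closed_segment t0 s"
      have "closed Z" "t0 \<in> Z" using clP t0 by (auto simp: Z_def)
      \<comment> \<open>The point of P between t0 and s nearest to s: from a to s there is no time
        of P except a.\<close>
      then obtain a where a: "a \<in> Z" "\<And>z. z \<in> Z \<Longrightarrow> dist s a \<le> dist s z"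
        using distance_attains_inf[of Z s] by blast
      have aseg: "a \<in> closed_segment t0 s" using a by (simp add: Z_def)
      have as: "dist s a \<le> dist s t0" using a(2) \<open>t0 \<in> Z\<close> by blast
      have "dist t0 a \<le> dist t0 s" using aseg segment_bound1[OF aseg] by (simp add: dist_norm norm_minus_commute)
      then have aF: "a \<in> F n" using PF[of a] a(1) s by (auto simp: Z_def dist_commute)
      \<comment> \<open>\<open>Ms\<close> depends on s. Bounds derived from it show that
        \<open>Q\<close> is bounded on the segment, without uniformity; the quantitative estimate
        then starts at a, where n is a bound.\<close>
      obtain Ms where Ms: "Qle (y s) Ms" using fin by blast
      have "\<exists>M. \<forall>r\<in>closed_segment a s. Qle (y r) M"
      proof (cases "a = s")
        case True
        then show ?thesis using Ms by auto
      next
        case False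
        have gap: "r \<in> G" if r: "r \<in> closed_segment a s" "r \<noteq> a" for r
        proof (rule ccontr)
          assume "r \<notin> G"
          moreover have "r \<in> closed_segment t0 s"
            using r(1) aseg by (auto simp: closed_segment_eq_real_ivl split: if_splits)
          ultimately have "r \<in> Z" by (simp add: Z_def P_def)
          then have "dist s a \<le> dist s r" by (rule a(2))
          then show False
            using r by (auto simp: closed_segment_eq_real_ivl dist_real_def split: if_splits)
        qed
        have "Qle (y r) (growth TYPE('d) Ms (s - a))" if r: "r \<in> open_segment a s" for r
        proof (rule Qle_mono)
          have sub: "closed_segment s r \<subseteq> closed_segment a s - {a}"
            using r by (auto simp: closed_segment_eq_real_ivl open_segment_eq_real_ivl split: if_splits)
          have "\<exists>M. \<forall>r'\<in>closed_segment s r. Qle (y r') M"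
            using sub gap by (intro Qle_bounded_on_compact) (auto simp: G_def)
          then obtain M where "\<And>r'. r' \<in> closed_segment s r \<Longrightarrow> Qle (y r') M" by blast
          then show "Qle (y r) (growth TYPE('d) Ms (r - s))" by (rule growth_bound_segment[OF y Ms])
          show "growth TYPE('d) Ms (r - s) \<le> growth TYPE('d) Ms (s - a)"
            using r by (intro growth_mono) (auto simp: open_segment_eq_real_ivl split: if_splits)
        qed
        then have "closure (open_segment a s) \<subseteq> {t. Qle (y t) (growth TYPE('d) Ms (s - a))}"
          by (intro closure_minimal closed_Qle_times[OF y]) auto
        then show ?thesis using False by auto
      qed
      then obtain M where "\<And>r. r \<in> closed_segment a s \<Longrightarrow> Qle (y r) M" by blast
      then have "Qle (y s) (growth TYPE('d) (real n) (s - a))"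
        using aF by (intro growth_bound_segment[OF y]) (auto simp: F_def)
      moreover have "growth TYPE('d) (real n) (s - a) \<le> growth TYPE('d) (real n) e"
        using as s by (intro growth_mono) (auto simp: dist_real_def)
      ultimately show ?thesis by (rule Qle_mono)
    qed
    then have "t0 \<in> G" using e(1) unfolding G_def by blast
    then show False using t0(1) by (simp add: P_def)
  qed
  then show ?thesis unfolding P_def G_def by blast
qed

lemma Qle_growth:
  fixes y :: "real \<Rightarrow> ('d::finite) state"
  assumes y: "motion U' K A y" and fin: "\<And>t. \<exists>M. Qle (y t) M" and M: "Qle (y 0) M"
  shows "Qle (y t) (growth TYPE('d) M t)"
proof -
  obtain M' where "\<And>r. r \<in> closed_segment 0 t \<Longrightarrow> Qle (y r) M'"
    using Qle_bounded_on_compact[OF compact_segment Qle_locally_bounded[OF y fin]] by blast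
  then have "Qle (y t) (growth TYPE('d) M (t - 0))" by (rule growth_bound_segment[OF y M])
  then show ?thesis by simp
qed

lemma motion_unique:
  fixes y z :: "real \<Rightarrow> ('d::finite) state"
  assumes y: "motion U' K UNIV y" "\<And>t. \<exists>M. Qle (y t) M"
    and z: "motion U' K UNIV z" "\<And>t. \<exists>M. Qle (z t) M" and eq: "y 0 = z 0"
  shows "y t = z t"
proof
  fix j
  obtain M where M: "Qle (y 0) M" using y(2) by blast
  have M0: "M \<ge> 0" using Qle_ge_1[OF M] by simp
  define T where "T = \<bar>t\<bar> + 1"
  have T: "T > 0" by (simp add: T_def)
  obtain C where "C > 0" and C: "\<And>(y :: real \<Rightarrow> 'd state) z V t j. motion U' K UNIV y \<Longrightarrow> motion U' K UNIV z \<Longrightarrow>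
      (\<And>s. \<bar>s\<bar> \<le> T \<Longrightarrow> tame (tame_const TYPE('d) M T) (y s)) \<Longrightarrow> 
      (\<And>s. \<bar>s\<bar> \<le> T \<Longrightarrow> tame (tame_const TYPE('d) M T) (z s)) \<Longrightarrow>
      (\<And>j. norm (y 0 j - z 0 j) \<le> V * exp (1 * real_of_int (lnorm j))) \<Longrightarrow> \<bar>t\<bar> \<le> T \<Longrightarrow>
      norm (y t j - z t j) \<le> C * V * exp (2 * 1 * real_of_int (lnorm j))"
    using stability[OF T tame_const_nonneg[OF M0] zero_less_one] by blast
  have "norm (y t j - z t j) \<le> C * 0 * exp (2 * 1 * real_of_int (lnorm j))"
  proof (rule C[OF y(1) z(1)])
    show "tame (tame_const TYPE('d) M T) (y s)" "tame (tame_const TYPE('d) M T) (z s)" if "\<bar>s\<bar> \<le> T" for s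
      using Qle_growth_imp_tame[OF Qle_growth[OF y(1,2) M], of s T] that
        Qle_growth_imp_tame[OF Qle_growth[OF z(1,2)], of M s T] M eq T by auto
  qed (auto simp: eq T_def)
  then show "y t j = z t j" by simp
qed

end

subsection \<open>Differentiability in the initial data\<close>

text \<open>The derivative is obtained from the difference quotients themselves, which are shown to be Cauchy,
  so that the linearised equation need not be solved.\<close>

lemma differentiable_if_quotients_additive:
  fixes f :: "real \<times> real \<Rightarrow> 'c::banach"
  assumes quot: "\<And>w h. norm w \<le> 1 \<Longrightarrow> 0 < h \<Longrightarrow> h \<le> 1 \<Longrightarrow>
     norm (f (a + w) - f a - (fst w / h) *\<^sub>R (f (a + (h, 0)) - f a) - (snd w / h) *\<^sub>R (f (a + (0, h)) - f a))
       \<le> c * ((norm w)\<^sup>2 + (\<bar>fst w\<bar> + \<bar>snd w\<bar>) * h)"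
  shows "f differentiable (at a)"
proof -
  have c0: "c \<ge> 0" using quot[of "(1, 0)" 1] norm_ge_zero by (fastforce simp: norm_Pair intro: order_trans)
  define Q1 Q2 where "Q1 h = (1 / h) *\<^sub>R (f (a + (h, 0)) - f a)" and "Q2 h = (1 / h) *\<^sub>R (f (a + (0, h)) - f a)" for h :: real
  have quot': "norm (f (a + w) - f a - fst w *\<^sub>R Q1 h - snd w *\<^sub>R Q2 h) \<le> c * ((norm w)\<^sup>2 + (\<bar>fst w\<bar> + \<bar>snd w\<bar>) * h)"
    if "norm w \<le> 1" "0 < h" "h \<le> 1" for w h
    using quot[OF that] by (simp add: Q1_def Q2_def)
  define r where "r n = 1 / real (Suc n)" for n
  have r: "0 < r n" "r n \<le> 1" for n by (auto simp: r_def)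
  have r0: "r \<longlonglongrightarrow> 0" unfolding r_def by (rule LIMSEQ_inverse_real_of_nat[unfolded inverse_eq_divide])
  have cauchyI: "convergent (\<lambda>n. Q (r n))"
    if Q: "\<And>k h. 0 < k \<Longrightarrow> k \<le> 1 \<Longrightarrow> 0 < h \<Longrightarrow> h \<le> 1 \<Longrightarrow> norm (Q k - Q h) \<le> c * (k + h)" for Q :: "real \<Rightarrow> 'c"
  proof -
    have "Cauchy (\<lambda>n. Q (r n))"
    proof (rule CauchyI)
      fix e :: real assume e: "e > 0"
      have "(\<lambda>n. c * (2 * r n)) \<longlonglongrightarrow> c * (2 * 0)" by (intro tendsto_intros r0)
      then have "\<forall>\<^sub>F n in sequentially. c * (2 * r n) < e" using e by (auto dest: order_tendstoD(2))
      then obtain N where N: "c * (2 * r N) < e" by (auto simp: eventually_sequentially)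
      have "norm (Q (r m) - Q (r n)) < e" if "m \<ge> N" "n \<ge> N" for m n
      proof -
        have "r m \<le> r N" "r n \<le> r N" using that by (auto simp: r_def field_simps)
        then have "c * (r m + r n) \<le> c * (2 * r N)" using c0 by (intro mult_left_mono) auto
        then show ?thesis using Q[OF r r, of m n] N by linarith
      qed
      then show "\<exists>M. \<forall>m\<ge>M. \<forall>n\<ge>M. norm (Q (r m) - Q (r n)) < e" by blast
    qed
    then show ?thesis by (simp add: Cauchy_convergent_iff)
  qed
  \<comment> \<open>Taking w = (k, 0) compares the quotients of steps k and h; dividing by k leaves
    a bound linear in k + h.\<close>
  have "norm (Q1 k - Q1 h) \<le> c * (k + h)" if "0 < k" "k \<le> 1" "0 < h" "h \<le> 1" for k h
  proof -
    have "norm (k *\<^sub>R (Q1 k - Q1 h)) \<le> c * (k\<^sup>2 + k * h)"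
      using quot'[of "(k, 0)" h] that by (simp add: Q1_def norm_Pair scaleR_diff_right)
    then have "k * norm (Q1 k - Q1 h) \<le> c * (k\<^sup>2 + k * h)" using that by simp
    also have "\<dots> = k * (c * (k + h))" by (simp add: power2_eq_square algebra_simps)
    finally have "k * norm (Q1 k - Q1 h) \<le> k * (c * (k + h))" .
    then show ?thesis using that by simp
  qed
  from cauchyI[OF this] obtain D1 where D1: "(\<lambda>n. Q1 (r n)) \<longlonglongrightarrow> D1" by (auto simp: convergent_def)
  have "norm (Q2 k - Q2 h) \<le> c * (k + h)" if "0 < k" "k \<le> 1" "0 < h" "h \<le> 1" for k h
  proof -
    have "norm (k *\<^sub>R (Q2 k - Q2 h)) \<le> c * (k\<^sup>2 + k * h)"
      using quot'[of "(0, k)" h] that by (simp add: Q2_def norm_Pair scaleR_diff_right)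
    then have "k * norm (Q2 k - Q2 h) \<le> c * (k\<^sup>2 + k * h)" using that by simp
    also have "\<dots> = k * (c * (k + h))" by (simp add: power2_eq_square algebra_simps)
    finally have "k * norm (Q2 k - Q2 h) \<le> k * (c * (k + h))" .
    then show ?thesis using that by simp
  qed
  from cauchyI[OF this] obtain D2 where D2: "(\<lambda>n. Q2 (r n)) \<longlonglongrightarrow> D2" by (auto simp: convergent_def)
  define D where "D w = fst w *\<^sub>R D1 + snd w *\<^sub>R D2" for w :: "real \<times> real"
  have lin: "bounded_linear D"
    unfolding D_def by (intro bounded_linear_intros)
  \<comment> \<open>Letting h tend to 0 along \<open>r\<close> removes the mixed term and leaves a
    quadratic error.\<close>
  have err: "norm (f (a + w) - f a - D w) \<le> c * (norm w)\<^sup>2" if w: "norm w \<le> 1" for w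
  proof (rule LIMSEQ_le)
    show "(\<lambda>n. norm (f (a + w) - f a - fst w *\<^sub>R Q1 (r n) - snd w *\<^sub>R Q2 (r n))) \<longlonglongrightarrow> norm (f (a + w) - f a - D w)"
      unfolding D_def diff_diff_eq[symmetric] by (intro tendsto_intros D1 D2)
    have "(\<lambda>n. c * ((norm w)\<^sup>2 + (\<bar>fst w\<bar> + \<bar>snd w\<bar>) * r n)) \<longlonglongrightarrow> c * ((norm w)\<^sup>2 + (\<bar>fst w\<bar> + \<bar>snd w\<bar>) * 0)"
      by (intro tendsto_intros r0)
    then show "(\<lambda>n. c * ((norm w)\<^sup>2 + (\<bar>fst w\<bar> + \<bar>snd w\<bar>) * r n)) \<longlonglongrightarrow> c * (norm w)\<^sup>2" by simp
    show "\<exists>N. \<forall>n\<ge>N. norm (f (a + w) - f a - fst w *\<^sub>R Q1 (r n) - snd w *\<^sub>R Q2 (r n))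
        \<le> c * ((norm w)\<^sup>2 + (\<bar>fst w\<bar> + \<bar>snd w\<bar>) * r n)"
      using quot'[OF w r] by blast
  qed
  have "((\<lambda>w. norm (f (a + w) - f a - D w) / norm w) \<longlongrightarrow> 0) (at 0)"
  proof (rule Lim_null_comparison)
    show "((\<lambda>w :: real \<times> real. c * norm w) \<longlongrightarrow> 0) (at 0)"
      by (rule tendsto_eq_intros refl | simp)+
    have "\<forall>\<^sub>F w in at (0 :: real \<times> real). w \<in> ball 0 1 \<and> w \<noteq> 0 \<and> w \<in> UNIV"
      by (rule eventually_at_ball') simp
    then show "\<forall>\<^sub>F w in at 0. norm (norm (f (a + w) - f a - D w) / norm w) \<le> c * norm w"
    proof eventually_elim
      case (elim w)
      then have "norm (f (a + w) - f a - D w) \<le> c * norm w * norm w"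
        using err[of w] by (simp add: power2_eq_square mult.assoc)
      then show ?case using elim by (simp add: pos_divide_le_eq)
    qed
  qed
  then have "(f has_derivative D) (at a)" using lin by (simp add: has_derivative_at)
  then show ?thesis by (rule differentiableI)
qed

section \<open>Linearised dynamics and quadratic remainders\<close>

definition linearized_velocity :: "(real \<Rightarrow> real) \<Rightarrow> real \<Rightarrow> ('d::finite) state \<Rightarrow> 'd state \<Rightarrow> 'd state" where
  "linearized_velocity g' K x \<zeta> j = (snd (\<zeta> j), - g' (fst (x j)) * fst (\<zeta> j)
     - K * (\<Sum>k\<in>neighbours j. fst (\<zeta> j) - fst (\<zeta> k)))"

lemma linearized_velocity_combination:
  "linearized_velocity g' K x (\<lambda>k. \<zeta> k - c *\<^sub>R \<xi> k - d *\<^sub>R \<eta> k) j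
    = linearized_velocity g' K x \<zeta> j - c *\<^sub>R linearized_velocity g' K x \<xi> j - d *\<^sub>R linearized_velocity g' K x \<eta> j"
proof -
  have lin: "(\<Sum>k\<in>S. a k - c * b k - d * e k) = sum a S - c * sum b S - d * sum e S" 
    for a b e :: "'a site \<Rightarrow> real" and S
    by (simp add: sum_subtractf sum_distrib_left)
  have "(\<Sum>k\<in>neighbours j. fst (\<zeta> j) - c * fst (\<xi> j) - d * fst (\<eta> j) - (fst (\<zeta> k) - c * fst (\<xi> k) - d * fst (\<eta> k)))
    = (\<Sum>k\<in>neighbours j. (fst (\<zeta> j) - fst (\<zeta> k)) - c * (fst (\<xi> j) - fst (\<xi> k)) - d * (fst (\<eta> j) - fst (\<eta> k)))"
    by (intro sum.cong refl) (simp add: algebra_simps)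
  also have "\<dots> = (\<Sum>k\<in>neighbours j. fst (\<zeta> j) - fst (\<zeta> k)) - c * (\<Sum>k\<in>neighbours j. fst (\<xi> j) - fst (\<xi> k))
      - d * (\<Sum>k\<in>neighbours j. fst (\<eta> j) - fst (\<eta> k))"
    by (rule lin)
  finally have *: "(\<Sum>k\<in>neighbours j. fst (\<zeta> j) - c * fst (\<xi> j) - d * fst (\<eta> j) - (fst (\<zeta> k) - c * fst (\<xi> k) - d * fst (\<eta> k)))
    = (\<Sum>k\<in>neighbours j. fst (\<zeta> j) - fst (\<zeta> k)) - c * (\<Sum>k\<in>neighbours j. fst (\<xi> j) - fst (\<xi> k))
      - d * (\<Sum>k\<in>neighbours j. fst (\<eta> j) - fst (\<eta> k))" .
  show ?thesis
  proof (rule prod_eqI)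
    have "snd (linearized_velocity g' K x (\<lambda>k. \<zeta> k - c *\<^sub>R \<xi> k - d *\<^sub>R \<eta> k) j)
      = - g' (fst (x j)) * (fst (\<zeta> j) - c * fst (\<xi> j) - d * fst (\<eta> j))
        - K * (\<Sum>k\<in>neighbours j. fst (\<zeta> j) - c * fst (\<xi> j) - d * fst (\<eta> j) - (fst (\<zeta> k) - c * fst (\<xi> k) - d * fst (\<eta> k)))"
      by (simp add: linearized_velocity_def)
    also have "\<dots> = snd (linearized_velocity g' K x \<zeta> j - c *\<^sub>R linearized_velocity g' K x \<xi> j - d *\<^sub>R linearized_velocity g' K x \<eta> j)"
      unfolding * by (simp add: linearized_velocity_def algebra_simps)
    finally show "snd (linearized_velocity g' K x (\<lambda>k. \<zeta> k - c *\<^sub>R \<xi> k - d *\<^sub>R \<eta> k) j) = \<dots>" .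
  qed (simp add: linearized_velocity_def)
qed

context anharmonic
begin

lemma linearized_velocity_bound:
  fixes x \<zeta> :: "('d::finite) state"
  assumes D: "D \<ge> 0" and x: "tame D x" and m: "\<And>k. k \<in> insert j (neighbours j) \<Longrightarrow> norm (\<zeta> k) \<le> m"
  shows "norm (linearized_velocity U'' K x \<zeta> j) \<le> lip_const TYPE('d) D * lw j * m"
proof -
  have m0: "0 \<le> m" using m[of j] norm_ge_zero[of "\<zeta> j"] by (meson insertI1 order_trans)
  have l1: "1 \<le> lw j" by (rule lw_ge_1)
  let ?S = "\<Sum>k\<in>neighbours j. fst (\<zeta> j) - fst (\<zeta> k)" and ?q = "fst (x j)"
  have qp: "\<bar>fst (\<zeta> j)\<bar> \<le> m" "\<bar>snd (\<zeta> j)\<bar> \<le> m"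
    using m[of j] abs_le_norm_pair[of "\<zeta> j"] by auto
  have mm: "m \<le> m * lw j" using mult_left_mono[OF l1 m0] by simp
  have "norm (linearized_velocity U'' K x \<zeta> j) \<le> \<bar>snd (\<zeta> j)\<bar> + \<bar>- U'' ?q * fst (\<zeta> j) - K * ?S\<bar>"
    unfolding linearized_velocity_def by (rule norm_real_pair_le)
  also have "\<bar>- U'' ?q * fst (\<zeta> j) - K * ?S\<bar> \<le> \<bar>U'' ?q\<bar> * \<bar>fst (\<zeta> j)\<bar> + K * \<bar>?S\<bar>"
    using K_pos abs_triangle_ineq4[of "- U'' ?q * fst (\<zeta> j)" "K * ?S"] by (simp add: abs_mult)
  also have "\<bar>?S\<bar> \<le> 2 * 3 ^ CARD('d) * m"
    using harmonic_force_diff[of j \<zeta> "\<lambda>_. 0" m] m by simp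
  also have "\<bar>U'' ?q\<bar> * \<bar>fst (\<zeta> j)\<bar> \<le> (cU' * ((1 + 2 * D) * lw j)) * m"
  proof (intro mult_mono qp)
    have "1 + ?q\<^sup>2 + ?q\<^sup>2 \<le> lw j + D * lw j + D * lw j"
      using x l1 unfolding tame_def by (intro add_mono) auto
    then have "cU' * (1 + ?q\<^sup>2 + ?q\<^sup>2) \<le> cU' * ((1 + 2 * D) * lw j)"
      using cU'_nonneg by (intro mult_left_mono) (auto simp: algebra_simps)
    then show "\<bar>U'' ?q\<bar> \<le> cU' * ((1 + 2 * D) * lw j)" using U''_bound[of ?q ?q] by linarith
  qed (use cU'_nonneg D l1 in auto)
  finally have "norm (linearized_velocity U'' K x \<zeta> j)
     \<le> m + ((cU' * ((1 + 2 * D) * lw j)) * m + K * (2 * 3 ^ CARD('d) * m))"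
    using K_pos qp by simp
  also have "\<dots> \<le> m * lw j + ((cU' * ((1 + 2 * D) * lw j)) * m + K * (2 * 3 ^ CARD('d) * (m * lw j)))"
  proof -
    have "K * (2 * 3 ^ CARD('d) * m) \<le> K * (2 * 3 ^ CARD('d) * (m * lw j))"
      using K_pos by (intro mult_left_mono mm) auto
    then show ?thesis using mm by linarith
  qed
  also have "\<dots> = lip_const TYPE('d) D * lw j * m" by (simp add: lip_const_def algebra_simps)
  finally show ?thesis .
qed

text \<open>The coupling is linear, so the remainder is that of U' at site j alone and no neighbour
  enters it.\<close>

lemma velocity_taylor:
  fixes x z :: "('d::finite) state"
  assumes x: "tame D x" and z: "tame D z"
  shows "norm (velocity U' K UNIV z j - velocity U' K UNIV x j - linearized_velocity U'' K x (\<lambda>k. z k - x k) j)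
    \<le> cU' * (1 + 2 * D) * lw j * (norm (z j - x j))\<^sup>2"
proof -
  let ?q = "fst (x j)" and ?r = "fst (z j)"
  have "(\<Sum>k\<in>neighbours j. ?r - ?q - (fst (z k) - fst (x k)))
    = (\<Sum>k\<in>neighbours j. ?r - fst (z k)) - (\<Sum>k\<in>neighbours j. ?q - fst (x k))"
    unfolding sum_subtractf[symmetric] by (intro sum.cong refl) simp
  then have "velocity U' K UNIV z j - velocity U' K UNIV x j - linearized_velocity U'' K x (\<lambda>k. z k - x k) j
    = (0, - (U' ?r - U' ?q - U'' ?q * (?r - ?q)))"
    by (simp add: velocity_def linearized_velocity_def right_diff_distrib)
  then have "norm (velocity U' K UNIV z j - velocity U' K UNIV x j - linearized_velocity U'' K x (\<lambda>k. z k - x k) j)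
    \<le> \<bar>U' ?r - U' ?q - U'' ?q * (?r - ?q)\<bar>"
    using norm_real_pair_le[of 0 "- (U' ?r - U' ?q - U'' ?q * (?r - ?q))"] by simp
  also have "\<dots> \<le> cU' * (1 + ?q\<^sup>2 + ?r\<^sup>2) * (?r - ?q)\<^sup>2" by (rule U'_taylor)
  also have "\<dots> \<le> cU' * ((1 + 2 * D) * lw j) * (norm (z j - x j))\<^sup>2"
  proof (intro mult_mono mult_left_mono)
    have "1 + ?q\<^sup>2 + ?r\<^sup>2 \<le> lw j + D * lw j + D * lw j"
      using x z lw_ge_1[of j] unfolding tame_def by (intro add_mono) auto
    then show *: "1 + ?q\<^sup>2 + ?r\<^sup>2 \<le> (1 + 2 * D) * lw j" by (simp add: algebra_simps)
    have "\<bar>?r - ?q\<bar> \<le> norm (z j - x j)" using abs_le_norm_pair(1)[of "z j - x j"] by simp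
    then have "\<bar>?r - ?q\<bar>\<^sup>2 \<le> (norm (z j - x j))\<^sup>2" by (intro power_mono) auto
    then show "(?r - ?q)\<^sup>2 \<le> (norm (z j - x j))\<^sup>2" by simp
    have "0 \<le> 1 + ?q\<^sup>2 + ?r\<^sup>2" by simp
    then show "0 \<le> cU' * ((1 + 2 * D) * lw j)" using * cU'_nonneg by (intro mult_nonneg_nonneg[OF cU'_nonneg]) linarith
  qed (use cU'_nonneg in auto)
  finally show ?thesis by (simp add: mult.assoc)
qed

text \<open>The combination starts at 0 and solves the equation linearised along \<open>y0\<close>,
  up to Taylor remainders of the three differences. These act as sources, quadratic in the initial
  distances by \<open>stability\<close>.\<close>

lemma second_order_estimate:
  assumes T: "T > 0" and D: "D \<ge> 0"
  obtains C where "C > 0"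
    "\<And>(y :: real \<Rightarrow> ('d::finite) state) y0 y1 y2 c1 c2 V V1 V2 t j.
      motion U' K UNIV y \<Longrightarrow> motion U' K UNIV y0 \<Longrightarrow> motion U' K UNIV y1 \<Longrightarrow> motion U' K UNIV y2 \<Longrightarrow>
      (\<And>s. \<bar>s\<bar> \<le> T \<Longrightarrow> tame D (y s) \<and> tame D (y0 s) \<and> tame D (y1 s) \<and> tame D (y2 s)) \<Longrightarrow>
      (\<And>j. norm (y 0 j - y0 0 j) \<le> V \<and> norm (y1 0 j - y0 0 j) \<le> V1 \<and> norm (y2 0 j - y0 0 j) \<le> V2) \<Longrightarrow>
      (\<And>j. y 0 j - y0 0 j - c1 *\<^sub>R (y1 0 j - y0 0 j) - c2 *\<^sub>R (y2 0 j - y0 0 j) = 0) \<Longrightarrow> \<bar>t\<bar> \<le> T \<Longrightarrow>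
      norm (y t j - y0 t j - c1 *\<^sub>R (y1 t j - y0 t j) - c2 *\<^sub>R (y2 t j - y0 t j))
        \<le> C * (V\<^sup>2 + \<bar>c1\<bar> * V1\<^sup>2 + \<bar>c2\<bar> * V2\<^sup>2) * exp (2 * real_of_int (lnorm j))"
proof -
  obtain C where C: "C > 0" "\<And>(u :: real \<Rightarrow> 'd site \<Rightarrow> real \<times> real) V t j.
      subsolution (lip_const TYPE('d) D) T 1 V u \<Longrightarrow> \<bar>t\<bar> \<le> T \<Longrightarrow> norm (u t j) \<le> C * V * exp (2 * 1 * real_of_int (lnorm j))"
    using weighted_gronwall[OF T zero_less_one lip_const_nonneg[OF D]] by blast
  \<comment> \<open>Chosen so that the rates fit: stability doubles 1/8 to 1/4, squaring gives 1/2,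
    and the factor \<open>lw\<close> costs another 1/2, so the source stays within exp |j|.\<close>
  have e8: "1/8 > (0::real)" by simp
  obtain C1 where C1: "C1 > 0" "\<And>(y :: real \<Rightarrow> 'd state) z V t j. motion U' K UNIV y \<Longrightarrow> motion U' K UNIV z \<Longrightarrow>
      (\<And>s. \<bar>s\<bar> \<le> T \<Longrightarrow> tame D (y s)) \<Longrightarrow> (\<And>s. \<bar>s\<bar> \<le> T \<Longrightarrow> tame D (z s)) \<Longrightarrow>
      (\<And>j. norm (y 0 j - z 0 j) \<le> V * exp (1/8 * real_of_int (lnorm j))) \<Longrightarrow> \<bar>t\<bar> \<le> T \<Longrightarrow>
      norm (y t j - z t j) \<le> C1 * V * exp (2 * (1/8) * real_of_int (lnorm j))"
    using stability[OF T D e8] by blast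
  obtain B where B: "B > 0"
    "\<And>(x :: 'd state) z j. tame D x \<Longrightarrow> tame D z \<Longrightarrow> norm (x j - z j) \<le> B * exp (1 * real_of_int (lnorm j))"
    using tame_diff_exp_bound[OF D zero_less_one] by blast
  obtain L where L: "L > 0" "\<And>j :: 'd site. lw j \<le> L * exp (1/2 * real_of_int (lnorm j))"
    using lw_le_exp[of "1/2"] by auto
  define E where "E = cU' * (1 + 2 * D) * L * C1\<^sup>2 + 1"
  have E0: "cU' * (1 + 2 * D) * L * C1\<^sup>2 \<le> E" "E > 0"
    using cU'_nonneg D L(1) by (auto simp: E_def add_nonneg_pos)
  show thesis
  proof (rule that[of "C * (T * E)"])
    show "0 < C * (T * E)" using C(1) T E0 by simp
    fix y y0 y1 y2 :: "real \<Rightarrow> 'd state" and c1 c2 V V1 V2 t :: real and j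
    assume y: "motion U' K UNIV y" and y0: "motion U' K UNIV y0" and y1: "motion U' K UNIV y1" and y2: "motion U' K UNIV y2"
      and tm: "\<And>s. \<bar>s\<bar> \<le> T \<Longrightarrow> tame D (y s) \<and> tame D (y0 s) \<and> tame D (y1 s) \<and> tame D (y2 s)"
      and V: "\<And>j. norm (y 0 j - y0 0 j) \<le> V \<and> norm (y1 0 j - y0 0 j) \<le> V1 \<and> norm (y2 0 j - y0 0 j) \<le> V2"
      and init: "\<And>j. y 0 j - y0 0 j - c1 *\<^sub>R (y1 0 j - y0 0 j) - c2 *\<^sub>R (y2 0 j - y0 0 j) = 0" and t: "\<bar>t\<bar> \<le> T"
    define v where "v z t j = velocity U' K UNIV (z t) j" for z :: "real \<Rightarrow> 'd state" and t j
    define R where "R z t j = v z t j - v y0 t j - linearized_velocity U'' K (y0 t) (\<lambda>k. z t k - y0 t k) j" for z t j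
    have R_le: "norm (R z s i) \<le> E * W\<^sup>2 * exp (real_of_int (lnorm i))"
      if z: "motion U' K UNIV z" "\<And>s. \<bar>s\<bar> \<le> T \<Longrightarrow> tame D (z s)" "\<And>j. norm (z 0 j - y0 0 j) \<le> W" and s: "\<bar>s\<bar> \<le> T" for z W s i
    proof -
      have W0: "W \<ge> 0" using z(3) norm_ge_zero order_trans by blast
      have "norm (z s i - y0 s i) \<le> C1 * W * exp (2 * (1/8) * real_of_int (lnorm i))"
      proof (rule C1(2)[OF z(1) y0 z(2) _ _ s])
        show "norm (z 0 j - y0 0 j) \<le> W * exp (1/8 * real_of_int (lnorm j))" for j
          using z(3)[of j] mult_left_mono[OF _ W0, of 1 "exp (1/8 * real_of_int (lnorm j))"] lnorm_nonneg[of j] by simp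
      qed (use tm in auto)
      then have sq: "(norm (z s i - y0 s i))\<^sup>2 \<le> (C1 * W * exp (2 * (1/8) * real_of_int (lnorm i)))\<^sup>2"
        by (intro power_mono) auto
      have "norm (R z s i) \<le> cU' * (1 + 2 * D) * lw i * (norm (z s i - y0 s i))\<^sup>2"
        unfolding R_def v_def using velocity_taylor[of D "y0 s" "z s" i] tm[OF s] z(2)[OF s] by simp
      also have "\<dots> \<le> cU' * (1 + 2 * D) * (L * exp (1/2 * real_of_int (lnorm i))) * (C1 * W * exp (2 * (1/8) * real_of_int (lnorm i)))\<^sup>2"
        using cU'_nonneg D L lw_ge_1[of i] by (intro mult_mono mult_left_mono sq) auto
      also have "\<dots> = (cU' * (1 + 2 * D) * L * C1\<^sup>2) * W\<^sup>2 * (exp (1/2 * real_of_int (lnorm i)) * (exp (2 * (1/8) * real_of_int (lnorm i)))\<^sup>2)"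
        by (simp add: power_mult_distrib mult_ac)
      also have "exp (1/2 * real_of_int (lnorm i)) * (exp (2 * (1/8) * real_of_int (lnorm i)))\<^sup>2 = exp (real_of_int (lnorm i))"
        by (simp add: exp_double[symmetric] exp_add[symmetric])
      also have "(cU' * (1 + 2 * D) * L * C1\<^sup>2) * W\<^sup>2 * exp (real_of_int (lnorm i)) \<le> E * W\<^sup>2 * exp (real_of_int (lnorm i))"
        using E0 by (intro mult_right_mono) auto
      finally show ?thesis .
    qed
    define \<sigma> where "\<sigma> = V\<^sup>2 + \<bar>c1\<bar> * V1\<^sup>2 + \<bar>c2\<bar> * V2\<^sup>2"
    have \<sigma>0: "\<sigma> \<ge> 0" by (simp add: \<sigma>_def)
    define \<delta> where "\<delta> t k = y t k - y0 t k - c1 *\<^sub>R (y1 t k - y0 t k) - c2 *\<^sub>R (y2 t k - y0 t k)" for t k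
    define \<delta>' where "\<delta>' t j = v y t j - v y0 t j - c1 *\<^sub>R (v y1 t j - v y0 t j) - c2 *\<^sub>R (v y2 t j - v y0 t j)" for t j
    have "norm (\<delta> t j) \<le> C * (T * E * \<sigma>) * exp (2 * 1 * real_of_int (lnorm j))"
    proof (rule C(2)[OF subsolutionI[where u' = \<delta>' and S = "\<lambda>j. E * \<sigma> * exp (real_of_int (lnorm j))"
            and a = "\<lambda>_. 0" and B = "(1 + \<bar>c1\<bar> + \<bar>c2\<bar>) * B"]])
      have d: "((\<lambda>s. z s i) has_vector_derivative v z s i) (at s)" if "motion U' K UNIV z" for z s i
        using that by (simp add: motion_def v_def)
      have scal: "((\<lambda>s. c *\<^sub>R f s) has_vector_derivative c *\<^sub>R f') (at s)"
        if "(f has_vector_derivative f') (at s)" for c :: real and f f' and s :: real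
        using bounded_linear.has_vector_derivative[OF bounded_linear_scaleR_right that] .
      show "((\<lambda>s. \<delta> s i) has_vector_derivative \<delta>' s i) (at s)" for s i
        unfolding \<delta>_def \<delta>'_def by (intro has_vector_derivative_diff scal d y y0 y1 y2)
      show "norm (\<delta>' s i) \<le> lip_const TYPE('d) D * lw i * m + E * \<sigma> * exp (real_of_int (lnorm i))"
        if s: "\<bar>s\<bar> \<le> T" and m: "\<And>k. k \<in> insert i (neighbours i) \<Longrightarrow> norm (\<delta> s k) \<le> m" for s i m
      proof -
        have "\<delta>' s i = linearized_velocity U'' K (y0 s) (\<delta> s) i + (R y s i - c1 *\<^sub>R R y1 s i - c2 *\<^sub>R R y2 s i)"
          unfolding \<delta>'_def R_def \<delta>_def linearized_velocity_combination by (simp add: algebra_simps)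
        then have "norm (\<delta>' s i) \<le> norm (linearized_velocity U'' K (y0 s) (\<delta> s) i)
            + (norm (R y s i) + \<bar>c1\<bar> * norm (R y1 s i) + \<bar>c2\<bar> * norm (R y2 s i))"
          using norm_triangle_ineq[of "linearized_velocity U'' K (y0 s) (\<delta> s) i" "R y s i - c1 *\<^sub>R R y1 s i - c2 *\<^sub>R R y2 s i"]
            norm_triangle_ineq4[of "R y s i - c1 *\<^sub>R R y1 s i" "c2 *\<^sub>R R y2 s i"]
            norm_triangle_ineq4[of "R y s i" "c1 *\<^sub>R R y1 s i"] by simp
        also have "\<dots> \<le> lip_const TYPE('d) D * lw i * m + (E * V\<^sup>2 * exp (real_of_int (lnorm i))
            + \<bar>c1\<bar> * (E * V1\<^sup>2 * exp (real_of_int (lnorm i))) + \<bar>c2\<bar> * (E * V2\<^sup>2 * exp (real_of_int (lnorm i))))"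
        proof (intro add_mono mult_left_mono)
          show "norm (linearized_velocity U'' K (y0 s) (\<delta> s) i) \<le> lip_const TYPE('d) D * lw i * m"
            using tm[OF s] m by (intro linearized_velocity_bound[OF D]) auto
        qed (use s tm V y y1 y2 in \<open>auto intro!: R_le\<close>)
        also have "\<dots> = lip_const TYPE('d) D * lw i * m + E * \<sigma> * exp (real_of_int (lnorm i))"
          by (simp add: \<sigma>_def algebra_simps)
        finally show ?thesis .
      qed
      \<comment> \<open>This bound grows with the coefficients, which will be of order 1 / h; that
        is harmless, as the final estimate does not depend on the bound \<open>B\<close> of a
        subsolution.\<close>
      show "norm (\<delta> s i) \<le> (1 + \<bar>c1\<bar> + \<bar>c2\<bar>) * B * exp (1 * real_of_int (lnorm i))" if s: "\<bar>s\<bar> \<le> T" for s i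
      proof -
        let ?B = "B * exp (1 * real_of_int (lnorm i))"
        have "norm (\<delta> s i) \<le> norm (y s i - y0 s i) + \<bar>c1\<bar> * norm (y1 s i - y0 s i) + \<bar>c2\<bar> * norm (y2 s i - y0 s i)"
          unfolding \<delta>_def
          using norm_triangle_ineq4[of "y s i - y0 s i - c1 *\<^sub>R (y1 s i - y0 s i)" "c2 *\<^sub>R (y2 s i - y0 s i)"]
            norm_triangle_ineq4[of "y s i - y0 s i" "c1 *\<^sub>R (y1 s i - y0 s i)"] by simp
        also have "\<dots> \<le> ?B + \<bar>c1\<bar> * ?B + \<bar>c2\<bar> * ?B"
          using tm[OF s] B(2) by (intro add_mono mult_left_mono) auto
        finally show ?thesis by (simp add: algebra_simps)
      qed
    qed (use t E0 \<sigma>0 init in \<open>auto simp: \<delta>_def mult_ac\<close>)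
    then show "norm (y t j - y0 t j - c1 *\<^sub>R (y1 t j - y0 t j) - c2 *\<^sub>R (y2 t j - y0 t j))
        \<le> C * (T * E) * (V\<^sup>2 + \<bar>c1\<bar> * V1\<^sup>2 + \<bar>c2\<bar> * V2\<^sup>2) * exp (2 * real_of_int (lnorm j))"
      by (simp add: \<delta>_def \<sigma>_def mult.assoc)
  qed
qed

text \<open>The old energy of site i and of its bonds is nonnegative and may stay in the sum; the
  new one is added, bonds twice because pairs are ordered. Having no volume factor, the increment is
  covered by volumes of at least 1.\<close>

lemma Qle_fun_upd:
  fixes x :: "('d::finite) state"
  assumes x: "Qle x M"
  shows "Qle (x(i := v)) (M + ((snd v)\<^sup>2 / 2 + poly U (fst v) + 1 + 2 * (\<Sum>j\<in>neighbours i. K / 4 * (fst v - fst (x j))\<^sup>2)))"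
  unfolding Qle_def
proof (intro allI impI)
  fix \<nu> :: "'d site" and k :: nat assume adm: "admissible \<nu> k"
  let ?x = "x(i := v)" and ?C = "cube \<nu> k"
  define e where "e = (snd v)\<^sup>2 / 2 + poly U (fst v) + 1"
  define g where "g j = K / 4 * (fst v - fst (x j))\<^sup>2" for j
  have e0: "e \<ge> 0" using U_nonneg[of "fst v"] by (simp add: e_def add_nonneg_nonneg)
  have g0: "g j \<ge> 0" for j using K_pos by (simp add: g_def)
  have site: "(\<Sum>a\<in>?C. (snd (?x a))\<^sup>2 / 2 + poly U (fst (?x a)) + 1)
      \<le> (\<Sum>a\<in>?C. (snd (x a))\<^sup>2 / 2 + poly U (fst (x a)) + 1) + e"
  proof -
    have "(\<Sum>a\<in>?C. (snd (?x a))\<^sup>2 / 2 + poly U (fst (?x a)) + 1)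
        \<le> (\<Sum>a\<in>?C. ((snd (x a))\<^sup>2 / 2 + poly U (fst (x a)) + 1) + (if a = i then e else 0))"
      using U_nonneg by (intro sum_mono) (auto simp: e_def add_nonneg_nonneg)
    also have "\<dots> \<le> (\<Sum>a\<in>?C. (snd (x a))\<^sup>2 / 2 + poly U (fst (x a)) + 1) + e"
      unfolding sum.distrib[of "\<lambda>a. (snd (x a))\<^sup>2 / 2 + poly U (fst (x a)) + 1"] using e0 by simp
    finally show ?thesis .
  qed
  have gsum: "(\<Sum>b | b \<in> ?C \<and> b \<in> neighbours i. g b) \<le> (\<Sum>j\<in>neighbours i. g j)"
    using g0 by (intro sum_mono2) auto
  have "(\<Sum>a\<in>?C. \<Sum>b | b \<in> ?C \<and> b \<in> neighbours a. K / 4 * (fst (?x a) - fst (?x b))\<^sup>2)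
      \<le> (\<Sum>a\<in>?C. \<Sum>b | b \<in> ?C \<and> b \<in> neighbours a. K / 4 * (fst (x a) - fst (x b))\<^sup>2 
          + (if a = i then g b else 0) + (if b = i then g a else 0))"
  proof (intro sum_mono)
    fix a b assume "b \<in> {b. b \<in> ?C \<and> b \<in> neighbours a}"
    then have "b \<noteq> a" by (auto simp: neighbours_def lnorm_def)
    then show "K / 4 * (fst (?x a) - fst (?x b))\<^sup>2 \<le> K / 4 * (fst (x a) - fst (x b))\<^sup>2 
          + (if a = i then g b else 0) + (if b = i then g a else 0)"
      using K_pos by (auto simp: g_def power2_commute[of "fst (x a)" "fst v"] add_nonneg_nonneg)
  qed
  also have "\<dots> = (\<Sum>a\<in>?C. \<Sum>b | b \<in> ?C \<and> b \<in> neighbours a. K / 4 * (fst (x a) - fst (x b))\<^sup>2)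
      + (\<Sum>a\<in>?C. \<Sum>b | b \<in> ?C \<and> b \<in> neighbours a. if a = i then g b else 0)
      + (\<Sum>a\<in>?C. \<Sum>b | b \<in> ?C \<and> b \<in> neighbours a. if b = i then g a else 0)"
    by (simp add: sum.distrib)
  also have "(\<Sum>a\<in>?C. \<Sum>b | b \<in> ?C \<and> b \<in> neighbours a. if b = i then g a else 0)
      = (\<Sum>a\<in>?C. \<Sum>b | b \<in> ?C \<and> b \<in> neighbours a. if a = i then g b else 0)"
    by (subst sum.swap_restrict, simp, simp, intro sum.cong refl) (auto simp: neighbours_sym)
  also have "(\<Sum>a\<in>?C. \<Sum>b | b \<in> ?C \<and> b \<in> neighbours a. if a = i then g b else 0)
      = (\<Sum>a\<in>?C. if a = i then (\<Sum>b | b \<in> ?C \<and> b \<in> neighbours i. g b) else 0)"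
    by (intro sum.cong refl) auto
  also have "\<dots> \<le> (\<Sum>j\<in>neighbours i. g j)" using gsum g0 by (simp add: sum_nonneg)
  finally have "energy (poly U) K ?x ?C \<le> energy (poly U) K x ?C + (e + 2 * (\<Sum>j\<in>neighbours i. g j))"
    unfolding energy_def using site by simp
  also have "\<dots> \<le> M * (2 * real k + 1) ^ CARD('d) + (e + 2 * (\<Sum>j\<in>neighbours i. g j)) * (2 * real k + 1) ^ CARD('d)"
  proof (rule add_mono)
    show "energy (poly U) K x ?C \<le> M * (2 * real k + 1) ^ CARD('d)" using x adm by (simp add: Qle_def)
    have "1 \<le> (2 * real k + 1) ^ CARD('d)" by (intro one_le_power) simp
    then show "e + 2 * (\<Sum>j\<in>neighbours i. g j) \<le> (e + 2 * (\<Sum>j\<in>neighbours i. g j)) * (2 * real k + 1) ^ CARD('d)"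
      using e0 g0 mult_left_mono[of 1 "(2 * real k + 1) ^ CARD('d)" "e + 2 * (\<Sum>j\<in>neighbours i. g j)"]
      by (simp add: sum_nonneg)
  qed
  finally show "energy (poly U) K ?x ?C \<le> (M + (e + 2 * (\<Sum>j\<in>neighbours i. g j))) * (2 * real k + 1) ^ CARD('d)"
    by (simp add: distrib_right)
qed

text \<open>With coefficients w_1 / h and w_2 / h and steps (h, 0) and (0, h), the combination of
  initial states vanishes identically. The term \<open>\<bar>c1\<bar> * V1\<^sup>2\<close> becomes
  |w_1| h, as the differentiability criterion demands.\<close>

theorem differentiable_in_initial_data:
  fixes x :: "('d::finite) state"
  assumes x: "Qle x M"
    and Y: "\<And>v. motion U' K UNIV (Y v)" "\<And>v. Y v 0 = x(i := v)" "\<And>v t. \<exists>M. Qle (Y v t) M"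
  shows "(\<lambda>v. Y v t j) differentiable (at (x i))"
proof -
  define b where "b v = (snd v)\<^sup>2 / 2 + poly U (fst v) + 1 + 2 * (\<Sum>j\<in>neighbours i. K / 4 * (fst v - fst (x j))\<^sup>2)" for v
  \<comment> \<open>Compactness of the ball gives all perturbed initial states a common energy
    bound, hence a single tameness constant.\<close>
  have "continuous_on (cball (x i) 1) b" unfolding b_def by (intro continuous_intros) auto
  then have "bounded (b ` cball (x i) 1)" by (intro compact_imp_bounded compact_continuous_image) auto
  then obtain N where N: "\<And>v. v \<in> cball (x i) 1 \<Longrightarrow> \<bar>b v\<bar> \<le> N"
    unfolding bounded_iff by (metis imageI real_norm_def)
  have Q0: "Qle (Y v 0) (M + N)" if "v \<in> cball (x i) 1" for v
  proof (rule Qle_mono)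
    show "Qle (Y v 0) (M + b v)" unfolding Y(2) b_def by (rule Qle_fun_upd[OF x])
    show "M + b v \<le> M + N" using N[OF that] by simp
  qed
  have MN: "M + N \<ge> 0" using Qle_ge_1[OF Q0[of "x i"]] by simp
  define T where "T = \<bar>t\<bar> + 1"
  have T: "T > 0" "\<bar>t\<bar> \<le> T" by (auto simp: T_def)
  define D where "D = tame_const TYPE('d) (M + N) T"
  have tameY: "tame D (Y v s)" if "v \<in> cball (x i) 1" "\<bar>s\<bar> \<le> T" for v s
    unfolding D_def using Qle_growth_imp_tame[OF Qle_growth[OF Y(1,3) Q0[OF that(1)]]] that(2) T by simp
  obtain C where C: "C > 0" 
    "\<And>(y :: real \<Rightarrow> 'd state) y0 y1 y2 c1 c2 V V1 V2 t j.
      motion U' K UNIV y \<Longrightarrow> motion U' K UNIV y0 \<Longrightarrow> motion U' K UNIV y1 \<Longrightarrow> motion U' K UNIV y2 \<Longrightarrow>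
      (\<And>s. \<bar>s\<bar> \<le> T \<Longrightarrow> tame D (y s) \<and> tame D (y0 s) \<and> tame D (y1 s) \<and> tame D (y2 s)) \<Longrightarrow>
      (\<And>j. norm (y 0 j - y0 0 j) \<le> V \<and> norm (y1 0 j - y0 0 j) \<le> V1 \<and> norm (y2 0 j - y0 0 j) \<le> V2) \<Longrightarrow>
      (\<And>j. y 0 j - y0 0 j - c1 *\<^sub>R (y1 0 j - y0 0 j) - c2 *\<^sub>R (y2 0 j - y0 0 j) = 0) \<Longrightarrow> \<bar>t\<bar> \<le> T \<Longrightarrow>
      norm (y t j - y0 t j - c1 *\<^sub>R (y1 t j - y0 t j) - c2 *\<^sub>R (y2 t j - y0 t j))
        \<le> C * (V\<^sup>2 + \<bar>c1\<bar> * V1\<^sup>2 + \<bar>c2\<bar> * V2\<^sup>2) * exp (2 * real_of_int (lnorm j))"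
    using second_order_estimate[OF T(1) tame_const_nonneg[OF MN]] unfolding D_def by blast
  show ?thesis
  proof (rule differentiable_if_quotients_additive)
    fix w :: "real \<times> real" and h :: real assume w: "norm w \<le> 1" and h: "0 < h" "h \<le> 1"
    have in_ball: "x i \<in> cball (x i) 1" "x i + w \<in> cball (x i) 1" "x i + (h, 0) \<in> cball (x i) 1" "x i + (0, h) \<in> cball (x i) 1"
      using w h by (auto simp: dist_norm norm_Pair)
    have "norm (Y (x i + w) t j - Y (x i) t j - (fst w / h) *\<^sub>R (Y (x i + (h, 0)) t j - Y (x i) t j)
        - (snd w / h) *\<^sub>R (Y (x i + (0, h)) t j - Y (x i) t j))
        \<le> C * ((norm w)\<^sup>2 + \<bar>fst w / h\<bar> * h\<^sup>2 + \<bar>snd w / h\<bar> * h\<^sup>2) * exp (2 * real_of_int (lnorm j))"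
    proof (rule C(2)[OF Y(1) Y(1) Y(1) Y(1)])
      show "Y (x i + w) 0 j - Y (x i) 0 j - (fst w / h) *\<^sub>R (Y (x i + (h, 0)) 0 j - Y (x i) 0 j)
        - (snd w / h) *\<^sub>R (Y (x i + (0, h)) 0 j - Y (x i) 0 j) = 0" for j
        using h by (cases "j = i") (auto simp: Y(2) prod_eq_iff)
    qed (use in_ball tameY h T in \<open>auto simp: Y(2) norm_Pair\<close>)
    also have "\<bar>fst w / h\<bar> * h\<^sup>2 = \<bar>fst w\<bar> * h" using h by (simp add: power2_eq_square)
    also have "\<bar>snd w / h\<bar> * h\<^sup>2 = \<bar>snd w\<bar> * h" using h by (simp add: power2_eq_square)
    finally show "norm (Y (x i + w) t j - Y (x i) t j - (fst w / h) *\<^sub>R (Y (x i + (h, 0)) t j - Y (x i) t j)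
        - (snd w / h) *\<^sub>R (Y (x i + (0, h)) t j - Y (x i) t j))
        \<le> (C * exp (2 * real_of_int (lnorm j))) * ((norm w)\<^sup>2 + (\<bar>fst w\<bar> + \<bar>snd w\<bar>) * h)"
      by (simp add: algebra_simps)
  qed
qed

end

subsection \<open>The flow\<close>

context anharmonic
begin

lemma Qfun_le_iff: "Qfun U K x \<le> ereal M \<longleftrightarrow> Qle x M"
  unfolding Qfun_def Qle_def SUP_le_iff W_eq_energy admissible_def lw_def
  by (auto simp: pos_divide_le_eq)

lemma X0_Qfun:
  assumes "x \<in> X0 U K"
  shows "Qle x (real_of_ereal (Qfun U K x))"
proof (cases "Qfun U K x")
  case (real r)
  then show ?thesis using Qfun_le_iff[of x r] by simp
next
  case PInf
  then show ?thesis using assms by (simp add: X0_def)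
next
  \<comment> \<open>The value - \<infinity>, sent to 0 by the conversion, is excluded because every
    bound is at least 1.\<close>
  case MInf
  then have "Qle x 0" using Qfun_le_iff[of x 0] by simp
  then show ?thesis using Qle_ge_1 by fastforce
qed

lemma X0_iff: "x \<in> X0 U K \<longleftrightarrow> (\<exists>M. Qle x M)"
proof
  assume "\<exists>M. Qle x M"
  then obtain M where "Qfun U K x \<le> ereal M" by (auto simp: Qfun_le_iff)
  also have "ereal M < \<infinity>" by simp
  finally show "x \<in> X0 U K" by (simp add: X0_def)
qed (use X0_Qfun in blast)

text \<open>Outside \<open>X0\<close> the value is arbitrary; the derivative in the initial data is
  meaningful because changing one site does not leave \<open>X0\<close>.\<close>

definition flow :: "real \<Rightarrow> ('d::finite) state \<Rightarrow> 'd state" where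
  "flow t x = (SOME y. motion U' K UNIV y \<and> y 0 = x \<and> (\<forall>t. \<exists>M. Qle (y t) M)) t"

lemma flow:
  assumes "x \<in> X0 U K"
  shows flow_motion: "motion U' K UNIV (\<lambda>t. flow t x)" and flow_0: "flow 0 x = x"
    and flow_X0: "flow t x \<in> X0 U K"
proof -
  obtain M where "Qle x M" using assms by (auto simp: X0_iff)
  then obtain y where "motion U' K UNIV y \<and> y 0 = x \<and> (\<forall>t. \<exists>M. Qle (y t) M)"
    using infinite_dynamics_exists by metis
  from someI[of "\<lambda>y. motion U' K UNIV y \<and> y 0 = x \<and> (\<forall>t. \<exists>M. Qle (y t) M)", OF this]
  show "motion U' K UNIV (\<lambda>t. flow t x)" "flow 0 x = x" "flow t x \<in> X0 U K"
    unfolding flow_def X0_iff by auto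
qed

lemma flow_unique:
  assumes "x \<in> X0 U K" "motion U' K UNIV y" "\<And>t. y t \<in> X0 U K" "y 0 = x"
  shows "y t = flow t x"
  using motion_unique[OF assms(2) _ flow_motion[OF assms(1)]] assms flow_X0[OF assms(1)] flow_0[OF assms(1)]
  by (auto simp: X0_iff)

text \<open>The system is autonomous: the shifted trajectory is a solution in \<open>X0\<close>, and
  uniqueness identifies it.\<close>

lemma flow_add:
  assumes x: "x \<in> X0 U K"
  shows "flow (s + t) x = flow s (flow t x)"
proof -
  have "motion U' K UNIV (\<lambda>s. flow (s + t) x)"
    unfolding motion_def
  proof (intro allI)
    fix s i
    have "((\<lambda>r. flow r x i) has_vector_derivative velocity U' K UNIV (flow (s + t) x) i) (at (s + t))"
      using flow_motion[OF x] by (simp add: motion_def)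
    then have "((\<lambda>r. flow r x i) \<circ> (\<lambda>s. s + t) has_vector_derivative 1 *\<^sub>R velocity U' K UNIV (flow (s + t) x) i) (at s)"
      by (intro vector_diff_chain_at) (auto intro!: derivative_eq_intros)
    then show "((\<lambda>s. flow (s + t) x i) has_vector_derivative velocity U' K UNIV (flow (s + t) x) i) (at s)"
      by (simp add: o_def)
  qed
  then show ?thesis
    using flow_unique[OF flow_X0[OF x, of t], of "\<lambda>s. flow (s + t) x" s] flow_X0[OF x] by simp
qed

lemma flow_differentiable:
  assumes x: "x \<in> X0 U K"
  shows "(\<lambda>v. flow t (x(i := v)) j) differentiable (at (x i))"
proof -
  obtain M where M: "Qle x M" using x by (auto simp: X0_iff)
  have upd: "x(i := v) \<in> X0 U K" for v unfolding X0_iff using Qle_fun_upd[OF M] by blast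
  have "\<exists>M. Qle (flow t (x(i := v))) M" for t v using flow_X0[OF upd] by (simp add: X0_iff)
  then show ?thesis
    by (rule differentiable_in_initial_data[OF M flow_motion[OF upd] flow_0[OF upd]])
qed

lemma flow_growth:
  fixes x :: "('d::finite) state"
  assumes x: "x \<in> X0 U K"
  defines "q \<equiv> real_of_ereal (Qfun U K x)"
  shows "Qfun U K (flow t x) \<le> ereal (growth_const TYPE('d) * (q * ln (exp 1 + q) + t ^ 4))"
proof -
  have q: "Qle x q" unfolding q_def by (rule X0_Qfun[OF x])
  then have q1: "q \<ge> 1" by (rule Qle_ge_1)
  have "Qle (flow t x) (growth TYPE('d) q t)"
    using flow_X0[OF x] q by (intro Qle_growth[OF flow_motion[OF x]]) (auto simp: X0_iff flow_0[OF x])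
  moreover have "growth TYPE('d) q t \<le> growth_const TYPE('d) * (q * ln (exp 1 + q) + t ^ 4)"
  proof -
    have "ln (exp 1) \<le> ln (exp 1 + q)" using q1 by (subst ln_le_cancel_iff) (auto simp: add_pos_nonneg)
    then have "q * 1 \<le> q * ln (exp 1 + q)" using q1 by (intro mult_left_mono) auto
    then show ?thesis unfolding growth_def using growth_const_pos[where 'd = 'd] by (intro mult_left_mono) auto
  qed
  ultimately show ?thesis unfolding Qfun_le_iff by (rule Qle_mono)
qed

end


theorem theorem2p1:
  fixes U :: "real poly" and K :: real
  assumes K_pos: "K > 0"
    and U_deg: "degree U = 4"
    and U_lead: "lead_coeff U > 0"
    and U_nonneg: "\<forall>r. poly U r \<ge> 0"
  shows "\<exists>(\<Phi> :: real \<Rightarrow> ('d::finite) state \<Rightarrow> 'd state) (C0::real).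
     (\<forall>t. \<forall>x\<in>X0 U K. \<Phi> t x \<in> X0 U K)
   \<and> (\<forall>x\<in>X0 U K. \<Phi> 0 x = x)
   \<and> (\<forall>s t. \<forall>x\<in>X0 U K. \<Phi> (s + t) x = \<Phi> s (\<Phi> t x))
   \<and> (\<forall>x\<in>X0 U K. is_solution U K (\<lambda>t. \<Phi> t x))
   \<and> (\<forall>x\<in>X0 U K. \<forall>y. is_solution U K y \<and> (\<forall>t. y t \<in> X0 U K) \<and> y 0 = x
          \<longrightarrow> (\<forall>t. y t = \<Phi> t x))
   \<and> (\<forall>x\<in>X0 U K. \<forall>t i j.
          (\<lambda>v. \<Phi> t (x(i := v)) j) differentiable (at (x i)))
   \<and> (\<forall>x\<in>X0 U K. \<forall>t.
          Qfun U K (\<Phi> t x) \<le> ereal (C0 * (real_of_ereal (Qfun U K x)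
               * ln (exp 1 + real_of_ereal (Qfun U K x)) + t ^ 4)))"
proof -
  interpret anharmonic U K using assms by unfold_locales auto
  show ?thesis
  proof (intro exI[of _ flow] exI[of _ "growth_const TYPE('d)"] conjI allI ballI impI)
    fix x y t assume "x \<in> X0 U K" "is_solution U K y \<and> (\<forall>t. y t \<in> X0 U K) \<and> y 0 = x"
    then show "y t = flow t x" by (auto intro: flow_unique simp: is_solution_iff_motion)
  qed (auto simp: is_solution_iff_motion flow_X0 flow_0 flow_add flow_motion flow_differentiable flow_growth)
qed

end
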